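(* Let $R=\mathbb{Z}[\tfrac1m]\subset\mathbb{Q}$ with $m\in\mathbb{N}_{\ge2}$. Let $S=\mathbb{F}_q[t,t^{-1},f(t)^{-1}]\subset \mathbb{F}_q(t)$, where $q$ is a power of a prime $p$ and $f(t)\in\mathbb{F}_p[t]\setminus\{t\}$ is a nonconstant monic polynomial which is irreducible over $\mathbb{F}_q$, and where in addition $f(t)\neq t-1$ if $p=2$. Let $\mathcal{O}=\mathcal{O}_{\mathbb{Q}(\sqrt d)}$ be the ring of integers of $\mathbb{Q}(\sqrt d)$, where $d\in\mathbb{N}_{\geq 2}$ is square-free and a fundamental unit $\eta\in\mathcal{O}^\times$ has minimal polynomial of the form $x^2+ax-1\in\mathbb{Z}[x]$. Then the following hold. (i) For $A\in\{\mathbb{A}\mathrm{ff},\mathbb{A}\mathrm{ff}^+\}$, the automorphism induced by any $\psi\in\mathrm{Aut}(A(R))$ on the diagonal part $\left(\begin{smallmatrix} * & 0\\0&1\end{smallmatrix}\right)\cong A(R)/\left(\begin{smallmatrix} 1 & *\\0&1\end{smallmatrix}\right)$ fixes infinitely many points. (ii) The automorphism induced by any $\psi\in\mathrm{Aut}(\mathbb{A}\mathrm{ff}^+(S))$ on the diagonal part $\left(\begin{smallmatrix} * & 0\\0&1\end{smallmatrix}\right)\cong \mathbb{A}\mathrm{ff}^+(S)/\left(\begin{smallmatrix} 1 & *\\0&1\end{smallmatrix}\right)$ fixes infinitely many points. (iii) The automorphism induced by any $\psi\in\mathrm{Aut}(\mathbb{A}\mathrm{ff}^+(\mathcal{O}))$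 on the diagonal part $\left(\begin{smallmatrix} * & 0\\0&1\end{smallmatrix}\right)\cong \mathbb{A}\mathrm{ff}^+(\mathcal{O})/\left(\begin{smallmatrix} 1 & *\\0&1\end{smallmatrix}\right)$ fixes infinitely many points. In particular, for all $n\ge2$, the groups $\mathbf{B}_n(R)$, $\mathbb{P}\mathbf{B}_n(R)$, $\mathbb{A}\mathrm{ff}(R)$, $B_n^+(R)$, $\mathbb{P}B_n^+(R)$, $\mathbb{A}\mathrm{ff}^+(R)$, $B_n^+(S)$, $\mathbb{P}B_n^+(S)$, $\mathbb{A}\mathrm{ff}^+(S)$, $B_n^+(\mathcal{O})$, $\mathbb{P}B_n^+(\mathcal{O})$ and $\mathbb{A}\mathrm{ff}^+(\mathcal{O})$ have property $R_\infty$.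
   Context: For a group $G$ and $\varphi\in\mathrm{Aut}(G)$, the Reidemeister number $R(\varphi)$ is the number of orbits of the action of $G$ on itself given by $h\cdot g = h g \varphi(h)^{-1}$. $G$ has property $R_\infty$ if $R(\varphi)=\infty$ for all $\varphi\in\mathrm{Aut}(G)$. For an integral domain $T$: $\mathbf{B}_n(T)\le\mathrm{GL}_n(T)$ is the group of upper triangular matrices; $\mathbb{P}\mathbf{B}_n(T)$ is its quotient by the scalar matrices $u\cdot\mathbf{1}_n$, $u\in T^\times$; $\mathbb{A}\mathrm{ff}(T)=\left\{\left(\begin{smallmatrix} u & r\\ 0& 1\end{smallmatrix}\right) \mid u\in T^\times, r\in T\right\}$. Let $T^\times_{\mathrm{tf}}$ be a complement of the torsion subgroup of $T^\times$. Then $B_n^+(T)\le\mathbf{B}_n(T)$ is the subgroup of upper triangular matrices with diagonal entries in $T^\times_{\mathrm{tf}}$; $\mathbb{P}B_n^+(T)$ is its quotient by the scalar matrices $u\cdot\mathbf{1}_n$, $u\in T^\times_{\mathrm{tf}}$; $\mathbb{A}\mathrm{ff}^+(T)=\left\{\left(\begin{smallmatrix} u & r\\ 0& 1\end{smallmatrix}\right) \mid u\in T^\times_{\mathrm{tf}}, r\in T\right\}$. The complements used are: for $R$, the subgroup generated by the distinct primes dividing $m$; for $S$, the subgroup generated by $t$ and $f(t)$; for $\mathcal{O}$, the subgroup generated by $\eta$. The subgroup $\left(\begin{smallmatrix} 1 & *\\0&1\end{smallmatrix}\right)$ is characteristic in each of these affine groups, so automorphisms induce automorphisms of the diagonal quotient.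 *)

theory Defs
  imports
    "HOL-Algebra.Bij"
    "HOL-Algebra.Group_Action"
    "HOL-Algebra.Generated_Groups"
    "HOL-Algebra.Generated_Rings"
    "HOL-Algebra.Generated_Fields"
    "HOL-Library.Extended_Nat"
    "HOL-Computational_Algebra.Computational_Algebra"
    "Jordan_Normal_Form.Matrix"
begin

definition twisted_conj :: "('a, 'b) monoid_scheme \<Rightarrow> ('a \<Rightarrow> 'a) \<Rightarrow> 'a \<Rightarrow> 'a \<Rightarrow> 'a" where
  "twisted_conj G \<phi> h = (\<lambda>g \<in> carrier G. h \<otimes>\<^bsub>G\<^esub> g \<otimes>\<^bsub>G\<^esub> inv\<^bsub>G\<^esub> (\<phi> h))"

definition reidemeister_number :: "('a, 'b) monoid_scheme \<Rightarrow> ('a \<Rightarrow> 'a) \<Rightarrow> enat" where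
  "reidemeister_number G \<phi> =
    (let X = orbits G (carrier G) (twisted_conj G \<phi>)
     in if finite X then enat (card X) else \<infinity>)"

definition property_R_infinity :: "('a, 'b) monoid_scheme \<Rightarrow> bool" where
  "property_R_infinity G \<longleftrightarrow> (\<forall>\<phi> \<in> auto G. reidemeister_number G \<phi> = \<infinity>)"

text \<open>An automorphism \<open>\<psi>\<close> of \<open>G\<close> that preserves a normal subgroup \<open>N\<close> maps the coset of \<open>g\<close> to
  the coset of \<open>\<psi> g\<close>; as a map on cosets (which are sets) this is taking images.
  See \<open>induced_auto_rcos\<close> and \<open>induced_auto_in_auto\<close> below.\<close>

definition induced_auto :: "('a, 'b) monoid_scheme \<Rightarrow> 'a set \<Rightarrow> ('a \<Rightarrow> 'a) \<Rightarrow> 'a set \<Rightarrow> 'a set" where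
  "induced_auto G N \<psi> = (\<lambda>C \<in> carrier (G Mod N). \<psi> ` C)"

definition induced_fixed_points :: "('a, 'b) monoid_scheme \<Rightarrow> 'a set \<Rightarrow> ('a \<Rightarrow> 'a) \<Rightarrow> 'a set set" where
  "induced_fixed_points G N \<psi> = {C \<in> carrier (G Mod N). induced_auto G N \<psi> C = C}"

text \<open>All integral domains here are subrings \<open>T\<close> of a field, given as subsets of a type of class
  \<open>field\<close>. Their torsion-free unit groups enter as a further parameter \<open>U\<close>, a subgroup of the
  units of \<open>T\<close>.\<close>

definition ring_on :: "'a::comm_ring_1 set \<Rightarrow> 'a ring" where
  "ring_on T = \<lparr>carrier = T, monoid.mult = (*), one = 1, zero = 0, add = (+)\<rparr>"

definition GL :: "nat \<Rightarrow> 'a::field set \<Rightarrow> 'a mat monoid" where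
  "GL n T = units_of ((ring_mat TYPE('a) n ())
     \<lparr>carrier := {A \<in> carrier_mat n n. elements_mat A \<subseteq> T}\<rparr>)"

definition borel :: "nat \<Rightarrow> 'a::field set \<Rightarrow> 'a mat monoid" where
  "borel n T = (GL n T)\<lparr>carrier := {A \<in> carrier (GL n T). upper_triangular A}\<rparr>"

definition borel_plus :: "nat \<Rightarrow> 'a::field set \<Rightarrow> 'a set \<Rightarrow> 'a mat monoid" where
  "borel_plus n T U =
    (borel n T)\<lparr>carrier := {A \<in> carrier (borel n T). \<forall>i<n. A $$ (i, i) \<in> U}\<rparr>"

definition scalar_mats :: "nat \<Rightarrow> 'a::field set \<Rightarrow> 'a mat set" where
  "scalar_mats n U = {u \<cdot>\<^sub>m 1\<^sub>m n | u. u \<in> U}"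

definition proj_borel :: "nat \<Rightarrow> 'a::field set \<Rightarrow> 'a mat set monoid" where
  "proj_borel n T = borel n T Mod scalar_mats n (Units (ring_on T))"

definition proj_borel_plus :: "nat \<Rightarrow> 'a::field set \<Rightarrow> 'a set \<Rightarrow> 'a mat set monoid" where
  "proj_borel_plus n T U = borel_plus n T U Mod scalar_mats n U"

definition aff_mat :: "'a::field \<Rightarrow> 'a \<Rightarrow> 'a mat" where
  "aff_mat u r = mat_of_rows_list 2 [[u, r], [0, 1]]"

definition aff_plus :: "'a::field set \<Rightarrow> 'a set \<Rightarrow> 'a mat monoid" where
  "aff_plus T U = (GL 2 T)\<lparr>carrier := {aff_mat u r | u r. u \<in> U \<and> r \<in> T}\<rparr>"

definition aff :: "'a::field set \<Rightarrow> 'a mat monoid" where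
  "aff T = aff_plus T (Units (ring_on T))"

definition aff_unipotent :: "'a::field set \<Rightarrow> 'a mat set" where
  "aff_unipotent T = {aff_mat 1 r | r. r \<in> T}"

definition Z_inv :: "nat \<Rightarrow> rat set" where
  "Z_inv m = generate_ring (ring_on UNIV) {1 / of_nat m}"

text \<open>The torsion-free unit groups below are the complements of the torsion subgroup generated by
  the given elements, as subgroups of the unit group of the ring.\<close>

definition Z_inv_tf :: "nat \<Rightarrow> rat set" where
  "Z_inv_tf m = generate (units_of (ring_on (Z_inv m))) {of_nat l | l. prime l \<and> l dvd m}"

text \<open>The field \<open>\<bbbF>\<^sub>q(t)\<close> is the type \<open>'q poly fract\<close>, and \<open>t\<close> is \<open>[:0, 1:]\<close>.\<close>

definition of_pol :: "'q::field poly \<Rightarrow> 'q poly fract" where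
  "of_pol g = Fract g 1"

definition S_ring :: "'q::field poly \<Rightarrow> 'q poly fract set" where
  "S_ring f = generate_ring (ring_on UNIV)
     ({of_pol [:c:] | c. True}
      \<union> {of_pol [:0, 1:], inverse (of_pol [:0, 1:]), inverse (of_pol f)})"

definition S_tf :: "'q::field poly \<Rightarrow> 'q poly fract set" where
  "S_tf f = generate (units_of (ring_on (S_ring f))) {of_pol [:0, 1:], of_pol f}"

text \<open>The real quadratic field is realised inside \<^typ>\<open>real\<close>.\<close>

definition quad_int :: "nat \<Rightarrow> real set" where
  "quad_int d = {x \<in> generate_field (ring_on UNIV) {sqrt (real d)}. algebraic_int x}"

text \<open>In a real quadratic order the torsion units are \<open>1\<close> and \<open>-1\<close>; a fundamental unit generates
  the units modulo torsion. All four choices (up to sign and inversion) are allowed.\<close>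

definition fundamental_unit :: "nat \<Rightarrow> real \<Rightarrow> bool" where
  "fundamental_unit d \<eta> \<longleftrightarrow>
     \<eta> \<in> Units (ring_on (quad_int d)) \<and>
     generate (units_of (ring_on (quad_int d))) {-1, \<eta>} = Units (ring_on (quad_int d))"

definition quad_int_tf :: "nat \<Rightarrow> real \<Rightarrow> real set" where
  "quad_int_tf d \<eta> = generate (units_of (ring_on (quad_int d))) {\<eta>}"

definition is_min_poly :: "rat poly \<Rightarrow> 'a::field_char_0 \<Rightarrow> bool" where
  "is_min_poly g x \<longleftrightarrow>
     lead_coeff g = 1 \<and> poly (map_poly of_rat g) x = 0 \<and>
     (\<forall>h. h \<noteq> 0 \<and> poly (map_poly of_rat h) x = 0 \<longrightarrow> degree g \<le> degree h)"

lemma induced_auto_rcos: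
  assumes "N \<lhd> G" and \<psi>: "\<psi> \<in> auto G" and N: "\<psi> ` N = N" and g: "g \<in> carrier G"
  shows "induced_auto G N \<psi> (N #>\<^bsub>G\<^esub> g) = N #>\<^bsub>G\<^esub> \<psi> g"
proof -
  interpret normal N G by fact
  have hom: "\<psi> \<in> hom G G" using \<psi> by (simp add: auto_def)
  have "N #>\<^bsub>G\<^esub> g \<in> carrier (G Mod N)"
    using g by (auto simp: FactGroup_def RCOSETS_def)
  moreover have "\<psi> ` (N #>\<^bsub>G\<^esub> g) = (\<psi> ` N) #>\<^bsub>G\<^esub> \<psi> g"
  proof -
    have "\<psi> (n \<otimes>\<^bsub>G\<^esub> g) = \<psi> n \<otimes>\<^bsub>G\<^esub> \<psi> g" if "n \<in> N" for n
      using hom_mult[OF hom mem_carrier[OF that] g] .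
    thus ?thesis unfolding r_coset_def by (auto simp: image_iff; metis)
  qed
  ultimately show ?thesis using N by (simp add: induced_auto_def)
qed

lemma induced_auto_in_auto:
  assumes "N \<lhd> G" and \<psi>: "\<psi> \<in> auto G" and N: "\<psi> ` N = N"
  shows "induced_auto G N \<psi> \<in> auto (G Mod N)"
proof -
  interpret normal N G by fact
  have hom: "\<psi> \<in> hom G G" and bij: "bij_betw \<psi> (carrier G) (carrier G)"
    using \<psi> by (auto simp: auto_def Bij_def)
  note eq = induced_auto_rcos[OF assms]
  have closed: "\<psi> g \<in> carrier G" if "g \<in> carrier G" for g
    using hom that by (auto simp: hom_def)
  have car: "carrier (G Mod N) = (\<lambda>g. N #>\<^bsub>G\<^esub> g) ` carrier G"
    by (auto simp: FactGroup_def RCOSETS_def)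
  have "induced_auto G N \<psi> \<in> hom (G Mod N) (G Mod N)"
  proof (rule homI)
    fix X Y assume "X \<in> carrier (G Mod N)" "Y \<in> carrier (G Mod N)"
    then obtain x y where xy: "x \<in> carrier G" "X = N #>\<^bsub>G\<^esub> x" "y \<in> carrier G" "Y = N #>\<^bsub>G\<^esub> y"
      using car by auto
    thus "induced_auto G N \<psi> X \<in> carrier (G Mod N)"
      using eq closed car by auto
    show "induced_auto G N \<psi> (X \<otimes>\<^bsub>G Mod N\<^esub> Y)
        = induced_auto G N \<psi> X \<otimes>\<^bsub>G Mod N\<^esub> induced_auto G N \<psi> Y"
      using xy eq closed hom_mult[OF hom] by (simp add: FactGroup_def rcos_sum)
  qed
  moreover have "induced_auto G N \<psi> ` carrier (G Mod N) = carrier (G Mod N)"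
  proof -
    have "induced_auto G N \<psi> ` carrier (G Mod N) = (\<lambda>g. N #>\<^bsub>G\<^esub> g) ` \<psi> ` carrier G"
      unfolding car image_image by (rule image_cong) (auto simp: eq)
    thus ?thesis using bij car by (simp add: bij_betw_def)
  qed
  moreover have "inj_on (induced_auto G N \<psi>) (carrier (G Mod N))"
  proof (rule inj_onI)
    fix X Y assume XY: "X \<in> carrier (G Mod N)" "Y \<in> carrier (G Mod N)"
      and "induced_auto G N \<psi> X = induced_auto G N \<psi> Y"
    hence "\<psi> ` X = \<psi> ` Y" by (simp add: induced_auto_def)
    moreover have "X \<subseteq> carrier G" "Y \<subseteq> carrier G"
      using XY rcosets_carrier by (auto simp: FactGroup_def)
    ultimately show "X = Y"
      using bij by (metis bij_betw_def inj_on_image_eq_iff)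
  qed
  ultimately show ?thesis
    by (simp add: auto_def Bij_def bij_betw_def) (simp add: induced_auto_def)
qed

end

(* The centraliser W of the set of commutators is a characteristic subgroup of each of the matrix
   groups in question. It consists of the matrices z (1 + x e_1n), so modulo the centre it is a copy
   of T on which g acts by multiplication with chi(g) = g_11 / g_nn. An automorphism phi thus
   induces an additive bijection of T that is semilinear with respect to the units, and after
   normalisation a map gamma with chi(phi g) = gamma(chi g). Such a gamma is the identity on the
   units for Z[1/m] (additivity) and for the quadratic order (the other root -1/eta of the minimal
   polynomial is not a power of eta). For F_q[t, 1/t, 1/f] the images gamma(t) and gamma(f) =
   f(gamma(t)) are monomials in t and f with exponent determinant 1 or -1; comparing the
   multiplicities of t and f leaves only involutions, besides maps of order 3 that occur only
   for p = 2 and f = t - 1. When gamma is an involution, chi(g) gamma(chi(g)) is constant on twisted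
   conjugacy classes. *)

theory Submission
  imports Defs "Jordan_Normal_Form.Char_Poly"
begin

subsection \<open>A characteristic line on which the group acts by a character\<close>

text \<open>Centralising the commutators themselves avoids any description of the commutator
  subgroup: every commutator is unitriangular, so the corner line centralises it, and the
  commutators \<open>1 + (u - 1) e_ij\<close> for a single unit \<open>u\<close> other than 1
  already force the shape of \<open>W\<close>. The induced additive bijection \<open>F\<close> of
  \<open>T\<close> satisfies \<open>F (\<chi> g * x) = \<chi> (\<phi> g) * F x\<close>, so dividing
  by \<open>F 1\<close> gives a \<gamma> that restricts to the induced automorphism of the character
  values. It is not known to be linear over constants: only additivity and multiplicativity against
  units are available. That \<gamma> is an involution does not suffice either: for inversion,
  \<open>u * \<gamma> u\<close> is always 1. Hence \<open>rigid\<close> also asks for a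
  \<open>v\<close> with \<open>v * \<gamma> v\<close> of infinite order; this product is fixed by
  the involution, and its powers supply both infinitely many twisted classes and infinitely many
  fixed points. The maps of order 3 would be fatal, since their exponent matrix \<open>M\<close> has
  \<open>det (M - 1) = 3\<close> and fixes only the trivial monomial; they permute the punctures 0,
  1 and infinity of the line cyclically.\<close>

definition comm_centralizer :: "('a, 'b) monoid_scheme \<Rightarrow> 'a set" where
  "comm_centralizer G = {w \<in> carrier G. \<forall>a \<in> carrier G. \<forall>b \<in> carrier G.
     w \<otimes>\<^bsub>G\<^esub> (a \<otimes>\<^bsub>G\<^esub> b \<otimes>\<^bsub>G\<^esub> inv\<^bsub>G\<^esub> a \<otimes>\<^bsub>G\<^esub> inv\<^bsub>G\<^esub> b)
       = (a \<otimes>\<^bsub>G\<^esub> b \<otimes>\<^bsub>G\<^esub> inv\<^bsub>G\<^esub> a \<otimes>\<^bsub>G\<^esub> inv\<^bsub>G\<^esub> b) \<otimes>\<^bsub>G\<^esub> w}"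

text \<open>The maps \<open>\<gamma>\<close> below arise from group automorphisms: they describe the action on the
  unipotent corner line \<open>T\<close>, normalised so that \<open>\<gamma> 1 = 1\<close>; on \<open>V\<close> they describe the action on
  the character of that line.\<close>

definition rigid :: "'k::field set \<Rightarrow> 'k set \<Rightarrow> bool" where
  "rigid T V \<longleftrightarrow> (\<forall>\<gamma>. (\<forall>x\<in>T. \<forall>y\<in>T. \<gamma> (x + y) = \<gamma> x + \<gamma> y)
      \<and> (\<forall>u\<in>V. \<forall>y\<in>T. \<gamma> (u * y) = \<gamma> u * \<gamma> y) \<and> \<gamma> 1 = 1 \<and> \<gamma> ` V = V
    \<longrightarrow> (\<forall>u\<in>V. \<gamma> (\<gamma> u) = u) \<and> (\<exists>v\<in>V. \<forall>n>0. (v * \<gamma> v) ^ n \<noteq> 1))"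

lemma reidemeister_number_infinite:
  assumes inv: "\<And>g h. g \<in> carrier G \<Longrightarrow> h \<in> carrier G \<Longrightarrow>
      \<mu> (h \<otimes>\<^bsub>G\<^esub> g \<otimes>\<^bsub>G\<^esub> inv\<^bsub>G\<^esub> (\<phi> h)) = \<mu> g"
    and inf: "infinite (\<mu> ` carrier G)"
  shows "reidemeister_number G \<phi> = \<infinity>"
proof -
  let ?O = "orbits G (carrier G) (twisted_conj G \<phi>)"
  have ne: "carrier G \<noteq> {}" using inf by auto
  have "\<mu> ` orbit G (twisted_conj G \<phi>) g = {\<mu> g}" if "g \<in> carrier G" for g
  proof -
    have "orbit G (twisted_conj G \<phi>) g = (\<lambda>h. h \<otimes>\<^bsub>G\<^esub> g \<otimes>\<^bsub>G\<^esub> inv\<^bsub>G\<^esub> (\<phi> h)) ` carrier G"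
      using that by (auto simp: orbit_def twisted_conj_def)
    hence "\<mu> ` orbit G (twisted_conj G \<phi>) g = (\<lambda>h. \<mu> g) ` carrier G"
      using inv[OF that] by (simp add: image_image)
    thus ?thesis using ne by auto
  qed
  hence "(\<lambda>X. the_elem (\<mu> ` X)) ` orbit G (twisted_conj G \<phi>) ` carrier G = \<mu> ` carrier G"
    unfolding image_image by (intro image_cong) auto
  moreover have "?O = orbit G (twisted_conj G \<phi>) ` carrier G"
    by (auto simp: orbits_def)
  ultimately have "\<mu> ` carrier G = (\<lambda>X. the_elem (\<mu> ` X)) ` ?O" by simp
  hence "infinite ?O" using inf by (metis finite_imageI)
  thus ?thesis by (simp add: reidemeister_number_def)
qed

section \<open>The centraliser of all commutators as a characteristic subgroup\<close>

lemma (in group) comm_centralizer_eqI: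
  assumes "w \<in> carrier G" "\<And>a b. a \<in> carrier G \<Longrightarrow> b \<in> carrier G \<Longrightarrow>
      w \<otimes> (a \<otimes> b \<otimes> inv a \<otimes> inv b) = (a \<otimes> b \<otimes> inv a \<otimes> inv b) \<otimes> w"
  shows "w \<in> comm_centralizer G"
  using assms by (simp add: comm_centralizer_def)

lemma (in group) subgroup_comm_centralizer: "subgroup (comm_centralizer G) G"
proof
  show "comm_centralizer G \<subseteq> carrier G" by (auto simp: comm_centralizer_def)
  show "\<one> \<in> comm_centralizer G" by (auto simp: comm_centralizer_def)
next
  fix x y assume xy: "x \<in> comm_centralizer G" "y \<in> comm_centralizer G"
  show "x \<otimes> y \<in> comm_centralizer G"
  proof (rule comm_centralizer_eqI)
    fix a b assume ab: "a \<in> carrier G" "b \<in> carrier G"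
    define c where "c = a \<otimes> b \<otimes> inv a \<otimes> inv b"
    have c: "c \<in> carrier G" "x \<in> carrier G" "y \<in> carrier G" "x \<otimes> c = c \<otimes> x" "y \<otimes> c = c \<otimes> y"
      using ab xy by (auto simp: c_def comm_centralizer_def)
    have "x \<otimes> y \<otimes> c = c \<otimes> (x \<otimes> y)" using c by (metis m_assoc)
    thus "x \<otimes> y \<otimes> (a \<otimes> b \<otimes> inv a \<otimes> inv b) = a \<otimes> b \<otimes> inv a \<otimes> inv b \<otimes> (x \<otimes> y)"
      unfolding c_def .
  qed (use xy in \<open>auto simp: comm_centralizer_def\<close>)
next
  fix x assume x: "x \<in> comm_centralizer G"
  show "inv x \<in> comm_centralizer G"
  proof (rule comm_centralizer_eqI)
    fix a b assume ab: "a \<in> carrier G" "b \<in> carrier G"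
    define c where "c = a \<otimes> b \<otimes> inv a \<otimes> inv b"
    have c: "c \<in> carrier G" "x \<in> carrier G" "x \<otimes> c = c \<otimes> x"
      using ab x by (auto simp: c_def comm_centralizer_def)
    have "inv x \<otimes> c = c \<otimes> inv x" using c by (metis inv_closed inv_solve_left inv_solve_right m_assoc m_closed)
    thus "inv x \<otimes> (a \<otimes> b \<otimes> inv a \<otimes> inv b) = a \<otimes> b \<otimes> inv a \<otimes> inv b \<otimes> inv x"
      unfolding c_def .
  qed (use x in \<open>auto simp: comm_centralizer_def\<close>)
qed

lemma (in group) auto_hom: "\<phi> \<in> auto G \<Longrightarrow> group_hom G G \<phi>"
  by (simp add: auto_def group_hom_def group_hom_axioms_def is_group)

lemma (in group) auto_image: "\<phi> \<in> auto G \<Longrightarrow> \<phi> ` carrier G = carrier G"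
  by (simp add: auto_def Bij_def bij_betw_def)

lemma (in group) auto_surj:
  "\<phi> \<in> auto G \<Longrightarrow> g \<in> carrier G \<Longrightarrow> \<exists>h\<in>carrier G. g = \<phi> h"
  using auto_image[of \<phi>] by (metis imageE)

text \<open>By surjectivity of \<phi>, each commutator is the image of a commutator, and
  \<open>w\<close> commutes with the latter.\<close>

lemma (in group) auto_comm_centralizer:
  assumes "\<phi> \<in> auto G" "w \<in> comm_centralizer G"
  shows "\<phi> w \<in> comm_centralizer G"
proof -
  interpret group_hom G G \<phi> by (rule auto_hom[OF assms(1)])
  have w: "w \<in> carrier G" using assms by (simp add: comm_centralizer_def)
  show ?thesis
  proof (rule comm_centralizer_eqI)
    show "\<phi> w \<in> carrier G" using w by simp
    fix a b assume "a \<in> carrier G" "b \<in> carrier G"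
    then obtain a' b' where ab: "a' \<in> carrier G" "a = \<phi> a'" "b' \<in> carrier G" "b = \<phi> b'"
      using auto_surj[OF assms(1)] by metis
    have "w \<otimes> (a' \<otimes> b' \<otimes> inv a' \<otimes> inv b') = (a' \<otimes> b' \<otimes> inv a' \<otimes> inv b') \<otimes> w"
      using assms ab by (simp add: comm_centralizer_def)
    hence "\<phi> (w \<otimes> (a' \<otimes> b' \<otimes> inv a' \<otimes> inv b')) = \<phi> ((a' \<otimes> b' \<otimes> inv a' \<otimes> inv b') \<otimes> w)" by simp
    thus "\<phi> w \<otimes> (a \<otimes> b \<otimes> inv a \<otimes> inv b) = (a \<otimes> b \<otimes> inv a \<otimes> inv b) \<otimes> \<phi> w"
      using w ab by simp
  qed
qed

text \<open>Conjugation permutes the commutators: with \<open>a' = inv g a g\<close> and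
  \<open>b' = inv g b g\<close>, the commutator of \<open>a\<close> and \<open>b\<close> is the
  conjugate by \<open>g\<close> of that of \<open>a'\<close> and \<open>b'\<close>.\<close>

lemma (in group) conj_comm_centralizer:
  assumes g: "g \<in> carrier G" and w: "w \<in> comm_centralizer G"
  shows "g \<otimes> w \<otimes> inv g \<in> comm_centralizer G"
proof -
  have wc: "w \<in> carrier G" using w by (simp add: comm_centralizer_def)
  show ?thesis
  proof (rule comm_centralizer_eqI)
    show "g \<otimes> w \<otimes> inv g \<in> carrier G" using g wc by simp
    fix a b assume ab: "a \<in> carrier G" "b \<in> carrier G"
    define a' where "a' = inv g \<otimes> a \<otimes> g"
    define b' where "b' = inv g \<otimes> b \<otimes> g"
    define c where "c = a' \<otimes> b' \<otimes> inv a' \<otimes> inv b'"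
    have ab': "a' \<in> carrier G" "b' \<in> carrier G" using ab g by (auto simp: a'_def b'_def)
    have cc: "c \<in> carrier G" using ab' by (simp add: c_def)
    have ca: "inv a' = inv g \<otimes> inv a \<otimes> g" "inv b' = inv g \<otimes> inv b \<otimes> g"
      using g ab by (simp_all add: a'_def b'_def inv_mult_group m_assoc)
    have canc: "g \<otimes> (inv g \<otimes> x) = x" "inv g \<otimes> (g \<otimes> x) = x" if "x \<in> carrier G" for x
      using g that by (simp_all add: m_assoc[symmetric])
    have c: "a \<otimes> b \<otimes> inv a \<otimes> inv b = g \<otimes> c \<otimes> inv g"
      using g ab unfolding c_def ca unfolding a'_def b'_def by (simp add: m_assoc canc)
    have "w \<otimes> c = c \<otimes> w" using w ab' unfolding c_def by (simp add: comm_centralizer_def)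
    hence "g \<otimes> (w \<otimes> c) \<otimes> inv g = g \<otimes> (c \<otimes> w) \<otimes> inv g" by simp
    thus "g \<otimes> w \<otimes> inv g \<otimes> (a \<otimes> b \<otimes> inv a \<otimes> inv b) = a \<otimes> b \<otimes> inv a \<otimes> inv b \<otimes> (g \<otimes> w \<otimes> inv g)"
      unfolding c using g wc cc by (simp add: m_assoc canc)
  qed
qed

section \<open>Subrings of a field with a group of units\<close>

locale subring_of =
  fixes T :: "'k::field set"
  assumes one_T: "1 \<in> T" and add_T: "\<And>x y. x \<in> T \<Longrightarrow> y \<in> T \<Longrightarrow> x + y \<in> T"
    and minus_T: "\<And>x. x \<in> T \<Longrightarrow> - x \<in> T" and mult_T: "\<And>x y. x \<in> T \<Longrightarrow> y \<in> T \<Longrightarrow> x * y \<in> T"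
begin

lemma zero_T: "0 \<in> T"
  using add_T[OF one_T minus_T[OF one_T]] by simp

end

locale subring_units = subring_of T for T :: "'k::field set" +
  fixes V :: "'k set"
  assumes V_T: "V \<subseteq> T" and one_V: "1 \<in> V" and mult_V: "\<And>x y. x \<in> V \<Longrightarrow> y \<in> V \<Longrightarrow> x * y \<in> V"
    and inverse_V: "\<And>x. x \<in> V \<Longrightarrow> inverse x \<in> V" and zero_V: "0 \<notin> V"
begin

lemma power_V: "x \<in> V \<Longrightarrow> x ^ n \<in> V"
  by (induction n) (auto simp: one_V mult_V)

end

text \<open>The interface between groups and arithmetic. It is abstract in the group because it is
  needed for matrices as well as for cosets modulo scalars. The coordinate \<xi> is constrained only
  on the centraliser, and its kernel there is exactly the centre of the group: one inclusion is
  \<open>xi_zero\<close>, the other follows from \<open>nontriv\<close>.\<close>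

locale axial_group = group G + subring_units T V
  for G :: "('a, 'b) monoid_scheme" (structure) and T V :: "'k::field set" +
  fixes \<chi> \<xi> :: "'a \<Rightarrow> 'k"
  assumes chi_mult: "\<And>g h. g \<in> carrier G \<Longrightarrow> h \<in> carrier G \<Longrightarrow> \<chi> (g \<otimes> h) = \<chi> g * \<chi> h"
    and chi_image: "\<chi> ` carrier G = V"
    and xi_mult: "\<And>v w. v \<in> comm_centralizer G \<Longrightarrow> w \<in> comm_centralizer G \<Longrightarrow> \<xi> (v \<otimes> w) = \<xi> v + \<xi> w"
    and xi_conj: "\<And>g w. g \<in> carrier G \<Longrightarrow> w \<in> comm_centralizer G \<Longrightarrow> \<xi> (g \<otimes> w \<otimes> inv g) = \<chi> g * \<xi> w"
    and xi_zero: "\<And>g w. w \<in> comm_centralizer G \<Longrightarrow> \<xi> w = 0 \<Longrightarrow> g \<in> carrier G \<Longrightarrow> g \<otimes> w = w \<otimes> g"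
    and xi_image: "\<xi> ` comm_centralizer G = T"
    and nontriv: "V \<noteq> {1}"
begin

abbreviation "W \<equiv> comm_centralizer G"

lemma W_carrier: "w \<in> W \<Longrightarrow> w \<in> carrier G"
  by (simp add: comm_centralizer_def)

lemma chi_V: "g \<in> carrier G \<Longrightarrow> \<chi> g \<in> V"
  using chi_image by blast

lemma chi_surj: "u \<in> V \<Longrightarrow> \<exists>g\<in>carrier G. u = \<chi> g"
  using chi_image by blast

lemma xi_surj: "x \<in> T \<Longrightarrow> \<exists>w\<in>W. x = \<xi> w"
  using xi_image by blast

lemma chi_nonzero: "g \<in> carrier G \<Longrightarrow> \<chi> g \<noteq> 0"
  using chi_V zero_V by metis

lemma chi_inv: "g \<in> carrier G \<Longrightarrow> \<chi> (inv g) = inverse (\<chi> g)"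
proof -
  assume g: "g \<in> carrier G"
  have "\<chi> \<one> = \<chi> \<one> * \<chi> \<one>" using chi_mult[of \<one> \<one>] by simp
  hence "\<chi> \<one> = 1" using chi_nonzero[of \<one>] by simp
  hence "\<chi> g * \<chi> (inv g) = 1" using chi_mult[of g "inv g"] g by simp
  thus ?thesis using inverse_unique by metis
qed

text \<open>A central \<open>w\<close> satisfies \<open>\<xi> w = \<chi> g * \<xi> w\<close> for
  every \<open>g\<close>, and some \<open>\<chi> g\<close> differs from 1 in the field.\<close>

lemma xi_central:
  assumes w: "w \<in> W" and c: "\<And>g. g \<in> carrier G \<Longrightarrow> g \<otimes> w = w \<otimes> g"
  shows "\<xi> w = 0"
proof -
  obtain u where "u \<in> V" "u \<noteq> 1" using nontriv one_V by blast
  then obtain g where g: "g \<in> carrier G" "\<chi> g \<noteq> 1" using chi_surj by blast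
  have "g \<otimes> w \<otimes> inv g = w" using g c W_carrier[OF w] by (simp add: m_assoc)
  hence "\<xi> w = \<chi> g * \<xi> w" using xi_conj[OF g(1) w] by simp
  thus ?thesis using g by simp
qed

text \<open>Equality of coordinates becomes centrality of a quotient, a condition on the group
  alone, which automorphisms preserve. This is what lets an automorphism act on
  \<open>T\<close>.\<close>

lemma xi_eq_iff:
  assumes vw: "v \<in> W" "w \<in> W"
  shows "\<xi> v = \<xi> w \<longleftrightarrow> (\<forall>g\<in>carrier G. g \<otimes> (v \<otimes> inv w) = (v \<otimes> inv w) \<otimes> g)"
proof -
  interpret W: subgroup W G by (rule subgroup_comm_centralizer)
  have "\<xi> (v \<otimes> inv w \<otimes> w) = \<xi> (v \<otimes> inv w) + \<xi> w"
    using vw by (intro xi_mult) auto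
  moreover have "v \<otimes> inv w \<otimes> w = v" using vw W_carrier by (simp add: m_assoc)
  ultimately have "\<xi> v = \<xi> w \<longleftrightarrow> \<xi> (v \<otimes> inv w) = 0" by simp
  also have "\<dots> \<longleftrightarrow> (\<forall>g\<in>carrier G. g \<otimes> (v \<otimes> inv w) = (v \<otimes> inv w) \<otimes> g)"
    using xi_zero xi_central vw by (meson W.m_closed W.m_inv_closed)
  finally show ?thesis .
qed

lemma auto_xi_eq:
  assumes phi: "\<phi> \<in> auto G" and vw: "v \<in> W" "w \<in> W" and eq: "\<xi> v = \<xi> w"
  shows "\<xi> (\<phi> v) = \<xi> (\<phi> w)"
proof -
  interpret group_hom G G \<phi> by (rule auto_hom[OF phi])
  have "g \<otimes> (\<phi> v \<otimes> inv (\<phi> w)) = (\<phi> v \<otimes> inv (\<phi> w)) \<otimes> g" if "g \<in> carrier G" for g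
  proof -
    from auto_surj[OF phi that] obtain h where h: "h \<in> carrier G" "g = \<phi> h" by blast
    have "h \<otimes> (v \<otimes> inv w) = (v \<otimes> inv w) \<otimes> h" using eq xi_eq_iff[OF vw] h(1) by blast
    hence "\<phi> (h \<otimes> (v \<otimes> inv w)) = \<phi> ((v \<otimes> inv w) \<otimes> h)" by (rule arg_cong)
    thus ?thesis using h W_carrier[OF vw(1)] W_carrier[OF vw(2)] by simp
  qed
  thus ?thesis
    by (subst xi_eq_iff) (simp_all add: auto_comm_centralizer[OF phi] vw)
qed

text \<open>The only place where an automorphism is analysed: everything afterwards uses just the
  action of \<gamma> on \<open>V\<close>.\<close>

lemma auto_chi:
  assumes rigid: "rigid T V" and phi: "\<phi> \<in> auto G"
  obtains \<gamma> where "\<And>g. g \<in> carrier G \<Longrightarrow> \<chi> (\<phi> g) = \<gamma> (\<chi> g)"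
    and "\<And>u v. u \<in> V \<Longrightarrow> v \<in> V \<Longrightarrow> \<gamma> (u * v) = \<gamma> u * \<gamma> v" and "\<gamma> ` V = V"
    and "\<And>u. u \<in> V \<Longrightarrow> \<gamma> (\<gamma> u) = u" and "\<exists>v\<in>V. \<forall>n>0. (v * \<gamma> v) ^ n \<noteq> 1"
proof -
  interpret group_hom G G \<phi> by (rule auto_hom[OF phi])
  interpret W: subgroup W G by (rule subgroup_comm_centralizer)
  note phiW = auto_comm_centralizer[OF phi]
  \<comment> \<open>The map that \<phi> induces on \<open>T\<close>, seen as \<open>W\<close> modulo
    the centre; \<open>auto_xi_eq\<close> makes the choice of the preimage immaterial.\<close>
  define F where "F x = \<xi> (\<phi> (SOME w. w \<in> W \<and> \<xi> w = x))" for x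
  have F: "F (\<xi> w) = \<xi> (\<phi> w)" if "w \<in> W" for w
  proof -
    have "(SOME v. v \<in> W \<and> \<xi> v = \<xi> w) \<in> W \<and> \<xi> (SOME v. v \<in> W \<and> \<xi> v = \<xi> w) = \<xi> w"
      using that by (intro someI[where P = "\<lambda>v. v \<in> W \<and> \<xi> v = \<xi> w"]) simp
    thus ?thesis unfolding F_def using auto_xi_eq[OF phi] that by blast
  qed
  have F_add: "F (x + y) = F x + F y" if "x \<in> T" "y \<in> T" for x y
  proof -
    from xi_surj[OF that(1)] xi_surj[OF that(2)]
    obtain v w where vw: "v \<in> W" "w \<in> W" "x = \<xi> v" "y = \<xi> w" by blast
    show ?thesis using F[of "v \<otimes> w"] F[of v] F[of w] vw phiW W_carrier by (simp add: xi_mult)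
  qed
  have F_smult: "F (\<chi> g * x) = \<chi> (\<phi> g) * F x" if "g \<in> carrier G" "x \<in> T" for g x
  proof -
    from xi_surj[OF that(2)] obtain w where w: "w \<in> W" "x = \<xi> w" by blast
    have "F (\<chi> g * x) = \<xi> (\<phi> (g \<otimes> w \<otimes> inv g))"
      using F[OF conj_comm_centralizer[OF that(1) w(1)]] w that xi_conj by simp
    also have "\<dots> = \<chi> (\<phi> g) * F x" using w that W_carrier phiW F by (simp add: xi_conj)
    finally show ?thesis .
  qed
  \<comment> \<open>The witness is 1. If \<open>F 1\<close> were 0, then \<phi> would send an
    element of coordinate 1 into the centre; by injectivity that element would be central, hence of
    coordinate 0.\<close>
  obtain x0 where x0: "x0 \<in> T" "F x0 \<noteq> 0"
  proof -
    obtain w where w: "w \<in> W" "\<xi> w = 1" using xi_surj[OF one_T] by force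
    have "\<xi> (\<phi> w) \<noteq> 0"
    proof
      assume z: "\<xi> (\<phi> w) = 0"
      have "g \<otimes> w = w \<otimes> g" if g: "g \<in> carrier G" for g
      proof -
        have "\<phi> (g \<otimes> w) = \<phi> (w \<otimes> g)"
          using xi_zero[OF phiW[OF w(1)] z] g w W_carrier by simp
        moreover have "inj_on \<phi> (carrier G)" using phi by (simp add: auto_def Bij_def bij_betw_def)
        moreover have "g \<otimes> w \<in> carrier G" "w \<otimes> g \<in> carrier G" using g W_carrier[OF w(1)] by simp_all
        ultimately show ?thesis by (auto dest: inj_onD)
      qed
      hence "\<xi> w = 0" using xi_central w by blast
      thus False using w by simp
    qed
    thus ?thesis using that[of 1] one_T F[OF w(1)] w by simp
  qed
  \<comment> \<open>Dividing by \<open>F x0\<close> achieves \<open>\<gamma> 1 = 1\<close>. As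
    \<open>F x0\<close> is not known to be a unit of \<open>T\<close>, the values lie only in the
    ambient field, which is why \<open>rigid\<close> does not require \<gamma> to map
    \<open>T\<close> into itself.\<close>
  define \<gamma> where "\<gamma> y = F (y * x0) / F x0" for y
  have chi: "\<gamma> (\<chi> g) = \<chi> (\<phi> g)" if "g \<in> carrier G" for g
    using F_smult[OF that x0(1)] x0 by (simp add: \<gamma>_def)
  have add: "\<gamma> (x + y) = \<gamma> x + \<gamma> y" if "x \<in> T" "y \<in> T" for x y
    using F_add[of "x * x0" "y * x0"] that x0 mult_T by (simp add: \<gamma>_def distrib_right add_divide_distrib)
  have mult: "\<gamma> (u * y) = \<gamma> u * \<gamma> y" if "u \<in> V" "y \<in> T" for u y
  proof -
    from chi_surj[OF that(1)] obtain g where g: "g \<in> carrier G" "u = \<chi> g" by blast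
    have "\<gamma> u = \<chi> (\<phi> g)" using chi g by simp
    thus ?thesis using F_smult[OF g(1), of "y * x0"] g that x0 mult_T by (simp add: \<gamma>_def mult.assoc)
  qed
  have one: "\<gamma> 1 = 1" using x0 by (simp add: \<gamma>_def)
  have "\<gamma> ` V = \<chi> ` \<phi> ` carrier G"
    unfolding chi_image[symmetric] image_image using chi by (auto intro: image_cong)
  hence img: "\<gamma> ` V = V" using auto_image[OF phi] chi_image by simp
  have "(\<forall>u\<in>V. \<gamma> (\<gamma> u) = u) \<and> (\<exists>v\<in>V. \<forall>n>0. (v * \<gamma> v) ^ n \<noteq> 1)"
    using rigid add mult one img unfolding rigid_def by blast
  moreover have "\<gamma> (u * v) = \<gamma> u * \<gamma> v" if "u \<in> V" "v \<in> V" for u v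
    using mult that V_T by blast
  ultimately show ?thesis using that[of \<gamma>] chi img by simp
qed

text \<open>The function \<open>\<lambda>g. \<chi> g * \<gamma> (\<chi> g)\<close> is constant on twisted conjugacy classes
  because \<open>\<gamma>\<close> is an involution.\<close>

lemma property_R_infinity_axial:
  assumes rigid: "rigid T V"
  shows "property_R_infinity G"
  unfolding property_R_infinity_def
proof
  fix \<phi> assume phi: "\<phi> \<in> auto G"
  interpret group_hom G G \<phi> by (rule auto_hom[OF phi])
  obtain \<gamma> v where chi: "\<And>g. g \<in> carrier G \<Longrightarrow> \<chi> (\<phi> g) = \<gamma> (\<chi> g)"
    and mult: "\<And>u v. u \<in> V \<Longrightarrow> v \<in> V \<Longrightarrow> \<gamma> (u * v) = \<gamma> u * \<gamma> v" and img: "\<gamma> ` V = V"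
    and invol: "\<And>u. u \<in> V \<Longrightarrow> \<gamma> (\<gamma> u) = u" and v: "v \<in> V" "\<forall>n>0. (v * \<gamma> v) ^ n \<noteq> 1"
    using auto_chi[OF rigid phi] by metis
  \<comment> \<open>A norm for \<gamma>: it is multiplicative and takes the same value at
    \<open>u\<close> and \<open>\<gamma> u\<close>, so the contributions of \<open>h\<close> and
    \<open>\<phi> h\<close> to a twisted conjugate cancel.\<close>
  define \<nu> where "\<nu> u = u * \<gamma> u" for u
  have gV: "\<gamma> u \<in> V" if "u \<in> V" for u using img that by blast
  have nu_mult: "\<nu> (u * w) = \<nu> u * \<nu> w" if "u \<in> V" "w \<in> V" for u w
    using that mult by (simp add: \<nu>_def mult_ac)
  have nu_g: "\<nu> (\<gamma> u) = \<nu> u" if "u \<in> V" for u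
    using invol that by (simp add: \<nu>_def mult_ac)
  have nu_nz: "\<nu> u \<noteq> 0" if "u \<in> V" for u
    using that gV zero_V by (metis \<nu>_def mult_eq_0_iff)
  have nu_pow: "\<nu> (v ^ n) = \<nu> v ^ n" for n
  proof (induction n)
    case 0 show ?case using nu_mult[OF one_V one_V] nu_nz[OF one_V] by simp
  next
    case (Suc n) show ?case using nu_mult[OF v(1) power_V[OF v(1)]] Suc by simp
  qed
  show "reidemeister_number G \<phi> = \<infinity>"
  proof (rule reidemeister_number_infinite)
    fix g h assume gh: "g \<in> carrier G" "h \<in> carrier G"
    have "\<nu> (\<chi> h) = \<nu> (\<gamma> (\<chi> h))" using nu_g chi_V gh by simp
    moreover have "\<nu> (inverse (\<gamma> (\<chi> h))) * \<nu> (\<gamma> (\<chi> h)) = \<nu> 1"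
      using nu_mult[of "inverse (\<gamma> (\<chi> h))" "\<gamma> (\<chi> h)"] gV[OF chi_V] gh inverse_V zero_V
      by (metis left_inverse)
    moreover have "\<nu> 1 = 1" using nu_pow[of 0] by simp
    moreover have "\<chi> (h \<otimes> g \<otimes> inv (\<phi> h)) = \<chi> h * \<chi> g * inverse (\<gamma> (\<chi> h))"
      using gh chi by (simp add: chi_mult chi_inv)
    moreover have "\<nu> (\<chi> h * \<chi> g * inverse (\<gamma> (\<chi> h))) = \<nu> (\<chi> h) * \<nu> (\<chi> g) * \<nu> (inverse (\<gamma> (\<chi> h)))"
      using gh chi_V gV mult_V inverse_V by (simp add: nu_mult)
    ultimately show "(\<nu> \<circ> \<chi>) (h \<otimes> g \<otimes> inv (\<phi> h)) = (\<nu> \<circ> \<chi>) g"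
      by (simp add: mult_ac)
  next
    have "inj (\<lambda>n. \<nu> v ^ n)"
    proof (rule linorder_injI)
      fix i j :: nat assume "i < j"
      show "\<nu> v ^ i \<noteq> \<nu> v ^ j"
      proof
        assume "\<nu> v ^ i = \<nu> v ^ j"
        also have "\<dots> = \<nu> v ^ i * \<nu> v ^ (j - i)" using \<open>i < j\<close> by (simp add: power_add[symmetric])
        finally have "\<nu> v ^ (j - i) = 1" using nu_nz[OF v(1)] by simp
        thus False using v(2) \<open>i < j\<close> by (simp add: \<nu>_def)
      qed
    qed
    hence "infinite (range (\<lambda>n. \<nu> v ^ n))" by (rule range_inj_infinite)
    moreover have "range (\<lambda>n. \<nu> v ^ n) \<subseteq> (\<nu> \<circ> \<chi>) ` carrier G"
      using nu_pow power_V[OF v(1)] chi_image by (auto simp: image_iff) metis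
    ultimately show "infinite ((\<nu> \<circ> \<chi>) ` carrier G)" using finite_subset by blast
  qed
qed

text \<open>Cosets of \<open>N\<close> are the fibres of \<chi>, so the induced automorphism is
  \<gamma> on \<open>V\<close>. With \<open>w = v * \<gamma> v\<close>, the fibres over the powers
  of \<open>w\<close> are fixed because \<gamma> is an involution, and they are distinct because
  \<open>w\<close> has infinite order.\<close>

lemma infinite_induced_fixed_points:
  assumes rigid: "rigid T V" and phi: "\<phi> \<in> auto G"
    and N: "N = {g \<in> carrier G. \<chi> g = 1}"
  shows "infinite (induced_fixed_points G N \<phi>)"
proof -
  interpret group_hom G G \<phi> by (rule auto_hom[OF phi])
  obtain \<gamma> v where chi: "\<And>g. g \<in> carrier G \<Longrightarrow> \<chi> (\<phi> g) = \<gamma> (\<chi> g)"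
    and mult: "\<And>u v. u \<in> V \<Longrightarrow> v \<in> V \<Longrightarrow> \<gamma> (u * v) = \<gamma> u * \<gamma> v" and img: "\<gamma> ` V = V"
    and invol: "\<And>u. u \<in> V \<Longrightarrow> \<gamma> (\<gamma> u) = u" and v: "v \<in> V" "\<forall>n>0. (v * \<gamma> v) ^ n \<noteq> 1"
    using auto_chi[OF rigid phi] by metis
  define w where "w = v * \<gamma> v"
  have gv: "\<gamma> v \<in> V" using img v by blast
  have w: "w \<in> V" "\<gamma> w = w" using v gv mult invol mult_V by (auto simp: w_def mult.commute)
  have g1: "\<gamma> 1 = 1" using chi[of \<one>] chi_inv[of \<one>]
    by (metis chi_mult chi_nonzero hom_one mult_cancel_left2 one_closed r_one)
  have wn: "\<gamma> (w ^ n) = w ^ n" for n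
    by (induction n) (simp_all add: g1 mult w power_V)
  have coset: "N #> g = {h \<in> carrier G. \<chi> h = \<chi> g}" if g: "g \<in> carrier G" for g
  proof (intro equalityI subsetI)
    fix h assume "h \<in> {h \<in> carrier G. \<chi> h = \<chi> g}"
    hence h: "h \<in> carrier G" "\<chi> h = \<chi> g" by auto
    have "h \<otimes> inv g \<in> N" using h g chi_nonzero by (simp add: N chi_mult chi_inv)
    moreover have "h \<otimes> inv g \<otimes> g = h" using h g by (simp add: m_assoc)
    ultimately show "h \<in> N #> g" unfolding r_coset_def by force
  qed (use g in \<open>auto simp: N r_coset_def chi_mult\<close>)
  have "{h \<in> carrier G. \<chi> h = w ^ n} \<in> induced_fixed_points G N \<phi>" for n
  proof -
    obtain g where g: "g \<in> carrier G" "\<chi> g = w ^ n"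
      using chi_surj[OF power_V[OF w(1), of n]] by metis
    let ?C = "{h \<in> carrier G. \<chi> h = w ^ n}"
    have "?C = N #> g" using coset g by simp
    hence "?C \<in> carrier (G Mod N)" using g by (auto simp: FactGroup_def RCOSETS_def)
    moreover have "\<phi> ` ?C = ?C"
    proof (intro equalityI subsetI)
      fix h assume "h \<in> ?C"
      hence h: "h \<in> carrier G" "\<chi> h = w ^ n" by auto
      then obtain h' where h': "h' \<in> carrier G" "h = \<phi> h'" using auto_surj[OF phi] by blast
      \<comment> \<open>Being an involution, \<gamma> is its own inverse, so the preimage
        \<open>h'\<close> of \<open>h\<close> again lies over \<open>w ^ n\<close>.\<close>
      have "\<chi> h' = \<gamma> (\<chi> h)" using h' chi invol chi_V by simp
      thus "h \<in> \<phi> ` ?C" using h h' wn by auto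
    qed (auto simp: chi wn)
    ultimately show ?thesis by (simp add: induced_fixed_points_def induced_auto_def)
  qed
  hence "range (\<lambda>n. {h \<in> carrier G. \<chi> h = w ^ n}) \<subseteq> induced_fixed_points G N \<phi>" by blast
  moreover have "inj (\<lambda>n::nat. {h \<in> carrier G. \<chi> h = w ^ n})"
  proof (rule linorder_injI)
    fix i j :: nat assume "i < j"
    show "{h \<in> carrier G. \<chi> h = w ^ i} \<noteq> {h \<in> carrier G. \<chi> h = w ^ j}"
    proof
      assume eq: "{h \<in> carrier G. \<chi> h = w ^ i} = {h \<in> carrier G. \<chi> h = w ^ j}"
      obtain g where g: "g \<in> carrier G" "\<chi> g = w ^ i"
        using chi_surj[OF power_V[OF w(1), of i]] by metis
      hence "g \<in> {h \<in> carrier G. \<chi> h = w ^ j}" by (simp flip: eq)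
      hence "w ^ i = w ^ j" using g by simp
      also have "\<dots> = w ^ i * w ^ (j - i)" using \<open>i < j\<close> by (simp add: power_add[symmetric])
      finally have "w ^ (j - i) = 1" using chi_nonzero g by (metis mult_cancel_left2)
      thus False using v(2) \<open>i < j\<close> by (simp add: w_def)
    qed
  qed
  ultimately show ?thesis using range_inj_infinite finite_subset by blast
qed

text \<open>Commuting modulo \<open>Z\<close> is weaker than commuting, so the centraliser of the
  commutators could grow in the quotient. \<open>Z_comm\<close> prevents this, and the new
  centraliser is just the image of \<open>W\<close>. Since \<chi> and \<xi> are trivial on
  \<open>Z\<close>, a chosen representative of a coset gives the right values.\<close>

lemma axial_group_quotient:
  assumes "Z \<lhd> G" and Z_chi: "\<And>z. z \<in> Z \<Longrightarrow> \<chi> z = 1"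
    and Z_W: "Z \<subseteq> W" and Z_xi: "\<And>z. z \<in> Z \<Longrightarrow> \<xi> z = 0"
    and Z_comm: "\<And>g h. g \<in> carrier G \<Longrightarrow> h \<in> carrier G \<Longrightarrow>
      g \<otimes> h \<otimes> inv g \<otimes> inv h \<in> Z \<Longrightarrow> g \<otimes> h \<otimes> inv g \<otimes> inv h = \<one>"
  shows "axial_group (G Mod Z) T V (\<lambda>X. \<chi> (SOME x. x \<in> X)) (\<lambda>X. \<xi> (SOME x. x \<in> X))"
proof -
  interpret normal Z G by fact
  interpret Q: group "G Mod Z" by (rule factorgroup_is_group)
  let ?q = "\<lambda>x. Z #> x"
  have car: "carrier (G Mod Z) = ?q ` carrier G"
    by (auto simp: FactGroup_def RCOSETS_def)
  have qi: "inv\<^bsub>G Mod Z\<^esub> (?q x) = ?q (inv x)" if "x \<in> carrier G" for x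
    using that by (subst inv_FactGroup) (auto simp: car rcos_inv)
  have rep: "\<exists>z\<in>Z. (SOME y. y \<in> ?q x) = z \<otimes> x" if "x \<in> carrier G" for x
  proof -
    have "x \<in> ?q x" using rcos_self[OF that subgroup_axioms] by simp
    hence "(SOME y. y \<in> ?q x) \<in> ?q x" by (rule someI)
    thus ?thesis by (auto simp: r_coset_def)
  qed
  have chi: "\<chi> (SOME y. y \<in> ?q x) = \<chi> x" if "x \<in> carrier G" for x
    using rep[OF that] that Z_chi chi_mult by fastforce
  have xi: "\<xi> (SOME y. y \<in> ?q x) = \<xi> x" if "x \<in> W" for x
    using rep[OF W_carrier[OF that]] that Z_xi xi_mult Z_W by fastforce
  have eq: "?q x = ?q y \<longleftrightarrow> x \<otimes> inv y \<in> Z" if "x \<in> carrier G" "y \<in> carrier G" for x y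
  proof
    assume "?q x = ?q y"
    hence "x \<in> ?q y" using rcos_self[OF that(1) subgroup_axioms] by simp
    then obtain z where "z \<in> Z" "x = z \<otimes> y" by (auto simp: r_coset_def)
    thus "x \<otimes> inv y \<in> Z" using that by (simp add: m_assoc)
  next
    assume a: "x \<otimes> inv y \<in> Z"
    have "x = x \<otimes> inv y \<otimes> y" using that by (simp add: m_assoc)
    hence "x \<in> ?q y" using a by (auto simp: r_coset_def)
    thus "?q x = ?q y" using repr_independence[OF _ that(2)] subgroup_axioms by simp
  qed
  have WQ: "comm_centralizer (G Mod Z) = ?q ` W"
  proof (intro equalityI subsetI)
    fix X assume X: "X \<in> comm_centralizer (G Mod Z)"
    then obtain x where x: "x \<in> carrier G" "X = ?q x"
      by (auto simp: comm_centralizer_def car)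
    have "x \<in> W"
    proof (rule comm_centralizer_eqI[OF x(1)])
      fix a b assume ab: "a \<in> carrier G" "b \<in> carrier G"
      define c where "c = a \<otimes> b \<otimes> inv a \<otimes> inv b"
      have c: "c \<in> carrier G" using ab by (simp add: c_def)
      have "?q a \<in> carrier (G Mod Z)" "?q b \<in> carrier (G Mod Z)" using ab car by auto
      moreover have "?q a \<otimes>\<^bsub>G Mod Z\<^esub> ?q b \<otimes>\<^bsub>G Mod Z\<^esub> inv\<^bsub>G Mod Z\<^esub> (?q a) \<otimes>\<^bsub>G Mod Z\<^esub> inv\<^bsub>G Mod Z\<^esub> (?q b) = ?q c"
        using ab by (simp add: c_def qi rcos_sum)
      ultimately have "X \<otimes>\<^bsub>G Mod Z\<^esub> ?q c = ?q c \<otimes>\<^bsub>G Mod Z\<^esub> X"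
        using X unfolding comm_centralizer_def by fastforce
      hence "?q (x \<otimes> c) = ?q (c \<otimes> x)" using x c by (simp add: rcos_sum)
      \<comment> \<open>Commuting with \<open>c\<close> modulo \<open>Z\<close> puts the commutator
        of \<open>x\<close> and \<open>c\<close> into \<open>Z\<close>, where \<open>Z_comm\<close>
        makes it trivial.\<close>
      hence "x \<otimes> c \<otimes> inv x \<otimes> inv c \<in> Z" using eq[of "x \<otimes> c" "c \<otimes> x"] x c by (simp add: inv_mult_group m_assoc)
      hence "x \<otimes> c \<otimes> inv x \<otimes> inv c = \<one>" using Z_comm x c by blast
      hence "x \<otimes> c \<otimes> inv (c \<otimes> x) = \<one>" using x c by (simp add: inv_mult_group m_assoc)
      hence "x \<otimes> c = c \<otimes> x" using x(1) c inv_solve_right'[of \<one> "x \<otimes> c" "c \<otimes> x"] by simp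
      thus "x \<otimes> (a \<otimes> b \<otimes> inv a \<otimes> inv b) = a \<otimes> b \<otimes> inv a \<otimes> inv b \<otimes> x" unfolding c_def .
    qed
    thus "X \<in> ?q ` W" using x by blast
  next
    fix X assume "X \<in> ?q ` W"
    then obtain w where w: "w \<in> W" "X = ?q w" by blast
    note wc = W_carrier[OF w(1)]
    show "X \<in> comm_centralizer (G Mod Z)"
    proof (rule Q.comm_centralizer_eqI)
      show "X \<in> carrier (G Mod Z)" using w wc car by blast
      fix A B assume "A \<in> carrier (G Mod Z)" "B \<in> carrier (G Mod Z)"
      then obtain a b where ab: "a \<in> carrier G" "A = ?q a" "b \<in> carrier G" "B = ?q b"
        unfolding car by blast
      define c where "c = a \<otimes> b \<otimes> inv a \<otimes> inv b"
      have c: "c \<in> carrier G" "w \<otimes> c = c \<otimes> w" using ab w by (auto simp: c_def comm_centralizer_def)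
      have "A \<otimes>\<^bsub>G Mod Z\<^esub> B \<otimes>\<^bsub>G Mod Z\<^esub> inv\<^bsub>G Mod Z\<^esub> A \<otimes>\<^bsub>G Mod Z\<^esub> inv\<^bsub>G Mod Z\<^esub> B = ?q c"
        using ab by (simp add: c_def qi rcos_sum)
      thus "X \<otimes>\<^bsub>G Mod Z\<^esub> (A \<otimes>\<^bsub>G Mod Z\<^esub> B \<otimes>\<^bsub>G Mod Z\<^esub> inv\<^bsub>G Mod Z\<^esub> A \<otimes>\<^bsub>G Mod Z\<^esub> inv\<^bsub>G Mod Z\<^esub> B)
          = A \<otimes>\<^bsub>G Mod Z\<^esub> B \<otimes>\<^bsub>G Mod Z\<^esub> inv\<^bsub>G Mod Z\<^esub> A \<otimes>\<^bsub>G Mod Z\<^esub> inv\<^bsub>G Mod Z\<^esub> B \<otimes>\<^bsub>G Mod Z\<^esub> X"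
        using w wc c by (simp add: rcos_sum)
    qed
  qed
  interpret W: subgroup W G by (rule subgroup_comm_centralizer)
  show ?thesis
  proof
    show "(\<lambda>X. \<chi> (SOME x. x \<in> X)) ` carrier (G Mod Z) = V"
      unfolding car chi_image[symmetric] image_image by (rule image_cong) (auto simp: chi)
    show "(\<lambda>X. \<xi> (SOME x. x \<in> X)) ` comm_centralizer (G Mod Z) = T"
      unfolding WQ xi_image[symmetric] image_image by (rule image_cong) (auto simp: xi)
    show "V \<noteq> {1}" by (rule nontriv)
  next
    fix X Y assume "X \<in> carrier (G Mod Z)" "Y \<in> carrier (G Mod Z)"
    thus "\<chi> (SOME x. x \<in> X \<otimes>\<^bsub>G Mod Z\<^esub> Y) = \<chi> (SOME x. x \<in> X) * \<chi> (SOME x. x \<in> Y)"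
      unfolding car by (auto simp: rcos_sum chi chi_mult)
  next
    fix X Y assume "X \<in> comm_centralizer (G Mod Z)" "Y \<in> comm_centralizer (G Mod Z)"
    thus "\<xi> (SOME x. x \<in> X \<otimes>\<^bsub>G Mod Z\<^esub> Y) = \<xi> (SOME x. x \<in> X) + \<xi> (SOME x. x \<in> Y)"
      unfolding WQ by (auto simp: rcos_sum xi xi_mult W_carrier)
  next
    fix X Y assume "X \<in> carrier (G Mod Z)" "Y \<in> comm_centralizer (G Mod Z)"
    thus "\<xi> (SOME x. x \<in> X \<otimes>\<^bsub>G Mod Z\<^esub> Y \<otimes>\<^bsub>G Mod Z\<^esub> inv\<^bsub>G Mod Z\<^esub> X) = \<chi> (SOME x. x \<in> X) * \<xi> (SOME x. x \<in> Y)"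
      unfolding WQ car by (auto simp: rcos_sum qi xi chi xi_conj W_carrier conj_comm_centralizer)
  next
    fix X Y assume "Y \<in> comm_centralizer (G Mod Z)" "\<xi> (SOME x. x \<in> Y) = 0" "X \<in> carrier (G Mod Z)"
    then obtain x y where "y \<in> W" "Y = ?q y" "\<xi> y = 0" "x \<in> carrier G" "X = ?q x"
      unfolding WQ car by (auto simp: xi)
    thus "X \<otimes>\<^bsub>G Mod Z\<^esub> Y = Y \<otimes>\<^bsub>G Mod Z\<^esub> X"
      using xi_zero[of y x] by (simp add: rcos_sum W_carrier)
  qed
qed

end

subsection \<open>Groups of triangular matrices\<close>

text \<open>A bare record, so that the groups obtained by successively restricting carriers are
  literally equal to one common form.\<close>

definition mat_grp :: "nat \<Rightarrow> 'k::field mat set \<Rightarrow> 'k mat monoid" where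
  "mat_grp n C = \<lparr>carrier = C, monoid.mult = (*), one = 1\<^sub>m n\<rparr>"

lemma mat_grp_simps [simp]:
  "carrier (mat_grp n C) = C" "A \<otimes>\<^bsub>mat_grp n C\<^esub> B = A * B" "\<one>\<^bsub>mat_grp n C\<^esub> = 1\<^sub>m n"
  by (simp_all add: mat_grp_def)

section \<open>Matrix products, transvections, dilations and triangular matrices\<close>

lemma mat_mult_entry:
  assumes "A \<in> carrier_mat n n" "B \<in> carrier_mat n n" "i < n" "j < n"
  shows "(A * B) $$ (i, j) = (\<Sum>k<n. A $$ (i, k) * B $$ (k, j))"
  using assms by (auto simp: scalar_prod_def atLeast0LessThan)

lemma scalar_mat_mult:
  assumes "A \<in> carrier_mat n n"
  shows "(u \<cdot>\<^sub>m 1\<^sub>m n) * A = u \<cdot>\<^sub>m A" and "A * (u \<cdot>\<^sub>m 1\<^sub>m n) = u \<cdot>\<^sub>m (A :: 'k::field mat)"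
  using mult_smult_assoc_mat[OF one_carrier_mat assms, of u] mult_smult_distrib[OF assms one_carrier_mat, of u]
    left_mult_one_mat[OF assms] right_mult_one_mat[OF assms] by simp_all

lemma scalar_mat_mult_scalar:
  "(u \<cdot>\<^sub>m 1\<^sub>m n) * (v \<cdot>\<^sub>m 1\<^sub>m n) = (u * v) \<cdot>\<^sub>m (1\<^sub>m n :: 'k::field mat)"
  by (subst scalar_mat_mult) (auto intro!: eq_matI)

text \<open>The transvection \<open>1 + x e_ij\<close>. Indices start at 0, so the corner line
  consists of the matrices \<open>elem_mat n 0 (n - 1) x\<close>.\<close>

definition elem_mat :: "nat \<Rightarrow> nat \<Rightarrow> nat \<Rightarrow> 'k::field \<Rightarrow> 'k mat" where
  "elem_mat n i j x = mat n n (\<lambda>(a, b). (if a = b then 1 else 0) + (if a = i \<and> b = j then x else 0))"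

definition dilation_mat :: "nat \<Rightarrow> nat \<Rightarrow> 'k::field \<Rightarrow> 'k mat" where
  "dilation_mat n i u = mat n n (\<lambda>(a, b). if a = b then (if a = i then u else 1) else 0)"

lemma elem_mat_carrier [simp]: "elem_mat n i j x \<in> carrier_mat n n"
  by (simp add: elem_mat_def)

lemma elem_mat_dim [simp]: "dim_row (elem_mat n i j x) = n" "dim_col (elem_mat n i j x) = n"
  by (simp_all add: elem_mat_def)

lemma dilation_mat_carrier [simp]: "dilation_mat n i u \<in> carrier_mat n n"
  by (simp add: dilation_mat_def)

lemma dilation_mat_dim [simp]: "dim_row (dilation_mat n i u) = n" "dim_col (dilation_mat n i u) = n"
  by (simp_all add: dilation_mat_def)

lemma elem_mat_entry: "a < n \<Longrightarrow> b < n \<Longrightarrow>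
    elem_mat n i j x $$ (a, b) = (if a = b then 1 else 0) + (if a = i \<and> b = j then x else 0)"
  by (simp add: elem_mat_def)

lemma dilation_mat_entry: "a < n \<Longrightarrow> b < n \<Longrightarrow>
    dilation_mat n i u $$ (a, b) = (if a = b then (if a = i then u else 1) else 0)"
  by (simp add: dilation_mat_def)

lemma elem_mat_mult_left:
  assumes "A \<in> carrier_mat n n" "j < n" "a < n" "b < n"
  shows "(elem_mat n i j x * A) $$ (a, b) = A $$ (a, b) + (if a = i then x * A $$ (j, b) else 0)"
proof -
  have "(elem_mat n i j x * A) $$ (a, b)
      = (\<Sum>k<n. (if a = k then A $$ (k, b) else 0) + (if j = k then (if a = i then x * A $$ (k, b) else 0) else 0))"
    unfolding mat_mult_entry[OF elem_mat_carrier assms(1,3,4)]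
    using assms by (intro sum.cong) (auto simp: elem_mat_entry algebra_simps)
  thus ?thesis using assms by (simp add: sum.distrib)
qed

lemma elem_mat_mult_right:
  assumes "A \<in> carrier_mat n n" "i < n" "a < n" "b < n"
  shows "(A * elem_mat n i j x) $$ (a, b) = A $$ (a, b) + (if b = j then A $$ (a, i) * x else 0)"
proof -
  have "(A * elem_mat n i j x) $$ (a, b)
      = (\<Sum>k<n. (if b = k then A $$ (a, k) else 0) + (if i = k then (if b = j then A $$ (a, k) * x else 0) else 0))"
    unfolding mat_mult_entry[OF assms(1) elem_mat_carrier assms(3,4)]
    using assms by (intro sum.cong) (auto simp: elem_mat_entry algebra_simps)
  thus ?thesis using assms by (simp add: sum.distrib)
qed

lemma dilation_mat_mult_left:
  assumes "A \<in> carrier_mat n n" "a < n" "b < n"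
  shows "(dilation_mat n i u * A) $$ (a, b) = (if a = i then u else 1) * A $$ (a, b)"
proof -
  have "(dilation_mat n i u * A) $$ (a, b) = (\<Sum>k<n. if a = k then (if k = i then u else 1) * A $$ (k, b) else 0)"
    unfolding mat_mult_entry[OF dilation_mat_carrier assms]
    using assms by (intro sum.cong) (auto simp: dilation_mat_entry)
  thus ?thesis using assms by simp
qed

lemma diag_mult_upper_triangular:
  fixes A B :: "'k::field mat"
  assumes "A \<in> carrier_mat n n" "B \<in> carrier_mat n n" "upper_triangular A" "upper_triangular B" "i < n"
  shows "(A * B) $$ (i, i) = A $$ (i, i) * B $$ (i, i)"
proof -
  have "(A * B) $$ (i, i) = (\<Sum>k<n. if i = k then A $$ (i, k) * B $$ (k, i) else 0)"
    unfolding mat_mult_entry[OF assms(1,2,5,5)]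
  proof (rule sum.cong)
    fix k assume "k \<in> {..<n}"
    thus "A $$ (i, k) * B $$ (k, i) = (if i = k then A $$ (i, k) * B $$ (k, i) else 0)"
      using assms upper_triangularD[OF assms(3), of k i] upper_triangularD[OF assms(4), of i k]
      by (cases i k rule: linorder_cases) auto
  qed simp
  thus ?thesis using assms by simp
qed

lemma upper_triangular_mult:
  fixes A B :: "'k::field mat"
  assumes "A \<in> carrier_mat n n" "B \<in> carrier_mat n n" "upper_triangular A" "upper_triangular B"
  shows "upper_triangular (A * B)"
proof
  fix i j assume ij: "j < i" "i < dim_row (A * B)"
  hence n: "i < n" "j < n" using assms by auto
  have "A $$ (i, k) * B $$ (k, j) = 0" if "k < n" for k
    using assms ij n that upper_triangularD[OF assms(3), of k i] upper_triangularD[OF assms(4), of j k]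
    by (cases "k < i") auto
  thus "(A * B) $$ (i, j) = 0"
    unfolding mat_mult_entry[OF assms(1,2) n] by (intro sum.neutral) blast
qed

text \<open>Strong induction on the column: in the entry \<open>(i, j)\<close> of
  \<open>B * A = 1\<close>, earlier columns of \<open>B\<close> vanish by induction and entries of
  \<open>A\<close> below the diagonal vanish by hypothesis. What remains is
  \<open>B_ij * A_jj = 0\<close>, and \<open>A_jj\<close> is nonzero because \<open>det A\<close>
  is.\<close>

lemma upper_triangular_left_inverse:
  fixes A B :: "'k::field mat"
  assumes A: "A \<in> carrier_mat n n" and B: "B \<in> carrier_mat n n"
    and ut: "upper_triangular A" and BA: "B * A = 1\<^sub>m n"
  shows "upper_triangular B"
proof
  have "det B * det A = 1" using det_mult[OF B A] BA by simp
  hence nz: "A $$ (j, j) \<noteq> 0" if "j < n" for j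
    using that upper_triangular_imp_det_eq_0_iff[OF A ut] A by (auto simp: diag_mat_def)
  fix i j assume "j < i" "i < dim_row B"
  hence ij: "j < i" "i < n" using B by auto
  show "B $$ (i, j) = 0" using ij(1)
  proof (induction j rule: less_induct)
    case (less j)
    have j: "j < n" using less.prems ij by simp
    have "0 = (\<Sum>k<n. B $$ (i, k) * A $$ (k, j))"
      using mat_mult_entry[OF B A ij(2) j] BA less.prems ij j by simp
    also have "\<dots> = (\<Sum>k<n. if j = k then B $$ (i, k) * A $$ (k, j) else 0)"
    proof (rule sum.cong)
      fix k assume "k \<in> {..<n}"
      thus "B $$ (i, k) * A $$ (k, j) = (if j = k then B $$ (i, k) * A $$ (k, j) else 0)"
        using less j upper_triangularD[OF ut, of j k] A by (cases k j rule: linorder_cases) auto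
    qed simp
    finally show ?case using nz j by simp
  qed
qed

text \<open>The character by which the group acts on the corner line \<open>e\<^sub>1\<^sub>n\<close>, and the coordinate on that
  line; the denominators make both invariant under scaling.\<close>

definition corner_char :: "nat \<Rightarrow> 'k::field mat \<Rightarrow> 'k" where
  "corner_char n A = A $$ (0, 0) / A $$ (n - 1, n - 1)"

definition corner_entry :: "nat \<Rightarrow> 'k::field mat \<Rightarrow> 'k" where
  "corner_entry n A = A $$ (0, n - 1) / A $$ (n - 1, n - 1)"

text \<open>The common ground of Borel groups and affine groups. Dilations are demanded only for
  \<open>Suc i < n\<close>, since affine matrices have last diagonal entry 1; the commutators needed
  below dilate only at the smaller index of a pair \<open>i < j\<close>.\<close>

locale triangular_group = subring_units T V for T V :: "'k::field set" +
  fixes n :: nat and C :: "'k mat set"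
  assumes n_ge_2: "n \<ge> 2"
    and C_carrier: "\<And>A. A \<in> C \<Longrightarrow> A \<in> carrier_mat n n"
    and C_upper: "\<And>A. A \<in> C \<Longrightarrow> upper_triangular A"
    and C_entries: "\<And>A i j. A \<in> C \<Longrightarrow> i < n \<Longrightarrow> j < n \<Longrightarrow> A $$ (i, j) \<in> T"
    and C_diag: "\<And>A i. A \<in> C \<Longrightarrow> i < n \<Longrightarrow> A $$ (i, i) \<in> V"
    and C_one: "1\<^sub>m n \<in> C"
    and C_mult: "\<And>A B. A \<in> C \<Longrightarrow> B \<in> C \<Longrightarrow> A * B \<in> C"
    and C_inverse: "\<And>A. A \<in> C \<Longrightarrow> \<exists>B\<in>C. B * A = 1\<^sub>m n"
    and C_elem: "\<And>i j x. i < j \<Longrightarrow> j < n \<Longrightarrow> x \<in> T \<Longrightarrow> elem_mat n i j x \<in> C"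
    and C_dilation: "\<And>i u. Suc i < n \<Longrightarrow> u \<in> V \<Longrightarrow> dilation_mat n i u \<in> C"
    and V_nontriv: "V \<noteq> {1}"
begin

abbreviation G where "G \<equiv> mat_grp n C"

lemma group_G: "group G"
  by (rule groupI) (auto simp: C_mult C_one C_inverse C_carrier dest!: C_carrier)

sublocale group "mat_grp n C" by (rule group_G)

lemma diag_nonzero: "A \<in> C \<Longrightarrow> i < n \<Longrightarrow> A $$ (i, i) \<noteq> 0"
  using C_diag zero_V by metis

lemma lower_zero: "A \<in> C \<Longrightarrow> j < i \<Longrightarrow> i < n \<Longrightarrow> A $$ (i, j) = 0"
  using C_upper C_carrier by fastforce

lemma diag_mult: "A \<in> C \<Longrightarrow> B \<in> C \<Longrightarrow> i < n \<Longrightarrow> (A * B) $$ (i, i) = A $$ (i, i) * B $$ (i, i)"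
  by (rule diag_mult_upper_triangular) (auto simp: C_carrier C_upper)

lemma diag_inv: "A \<in> C \<Longrightarrow> i < n \<Longrightarrow> (inv\<^bsub>G\<^esub> A) $$ (i, i) = inverse (A $$ (i, i))"
proof -
  assume A: "A \<in> C" and i: "i < n"
  have "inv\<^bsub>G\<^esub> A \<in> C" "A * inv\<^bsub>G\<^esub> A = 1\<^sub>m n" using inv_closed[of A] r_inv[of A] A by auto
  hence "A $$ (i, i) * (inv\<^bsub>G\<^esub> A) $$ (i, i) = 1" using diag_mult[of A "inv\<^bsub>G\<^esub> A" i] A i by simp
  thus ?thesis using inverse_unique by metis
qed

lemma commutator_diag:
  assumes "A \<in> C" "B \<in> C" "i < n"
  shows "(A * B * inv\<^bsub>G\<^esub> A * inv\<^bsub>G\<^esub> B) $$ (i, i) = 1"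
proof -
  have "inv\<^bsub>G\<^esub> A \<in> C" "inv\<^bsub>G\<^esub> B \<in> C" using inv_closed assms by auto
  thus ?thesis using assms diag_nonzero[OF assms(1,3)] diag_nonzero[OF assms(2,3)]
    by (simp add: diag_mult C_mult diag_inv field_simps del: index_mult_mat(1))
qed

text \<open>The dilation conjugates \<open>1 + e_ij\<close> into \<open>1 + u e_ij\<close>; removing
  \<open>1 + e_ij\<close> leaves \<open>u - 1\<close>. This need not be a unit of \<open>T\<close>,
  but for \<open>u\<close> other than 1 it can be cancelled in the field.\<close>

lemma elem_mat_commutator:
  assumes "i < j" "j < n" "u \<in> V"
  shows "dilation_mat n i u * elem_mat n i j 1 * inv\<^bsub>G\<^esub> (dilation_mat n i u) * inv\<^bsub>G\<^esub> (elem_mat n i j 1)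
    = elem_mat n i j (u - 1)"
proof -
  let ?D = "dilation_mat n i u" and ?E = "elem_mat n i j (1::'k)" and ?F = "elem_mat n i j (u - 1)"
  have u1: "u - 1 \<in> T" using add_T[OF _ minus_T[OF one_T]] V_T assms by fastforce
  have DE: "?D \<in> C" "?E \<in> C" "?F \<in> C" using assms C_dilation C_elem one_T u1 by auto
  have "?D * ?E = ?F * (?E * ?D)"
  proof (rule eq_matI)
    fix a b assume "a < dim_row (?F * (?E * ?D))" "b < dim_col (?F * (?E * ?D))"
    hence ab: "a < n" "b < n" by (auto simp: elem_mat_def dilation_mat_def)
    show "(?D * ?E) $$ (a, b) = (?F * (?E * ?D)) $$ (a, b)"
      using assms ab mult_carrier_mat[OF elem_mat_carrier[of n i j 1] dilation_mat_carrier[of n i u]]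
      by (auto simp: elem_mat_mult_left dilation_mat_mult_left elem_mat_entry dilation_mat_entry
          simp del: index_mult_mat(1))
  qed (auto simp: elem_mat_def dilation_mat_def)
  hence "?D \<otimes>\<^bsub>G\<^esub> ?E = ?F \<otimes>\<^bsub>G\<^esub> (?E \<otimes>\<^bsub>G\<^esub> ?D)" by simp
  moreover have "?D \<in> carrier G" "?E \<in> carrier G" "?F \<in> carrier G" using DE by simp_all
  ultimately have "?D \<otimes>\<^bsub>G\<^esub> ?E \<otimes>\<^bsub>G\<^esub> inv\<^bsub>G\<^esub> ?D \<otimes>\<^bsub>G\<^esub> inv\<^bsub>G\<^esub> ?E = ?F"
    by (metis inv_closed inv_solve_right' m_assoc m_closed)
  thus ?thesis by simp
qed

lemma comm_centralizer_form:
  assumes W: "w \<in> comm_centralizer G"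
  shows "w = w $$ (0, 0) \<cdot>\<^sub>m elem_mat n 0 (n - 1) (corner_entry n w)" "w $$ (n - 1, n - 1) = w $$ (0, 0)"
proof -
  have w: "w \<in> C" using W by (simp add: comm_centralizer_def)
  obtain u where u: "u \<in> V" "u \<noteq> 1" using V_nontriv one_V by blast
  \<comment> \<open>The entry \<open>(a, b)\<close> of the identity that \<open>w\<close> commutes
    with \<open>1 + (u - 1) e_ij\<close>, after cancelling \<open>u - 1\<close>.\<close>
  have key: "(if b = j then w $$ (a, i) else 0) = (if a = i then w $$ (j, b) else 0)"
    if ij: "i < j" "j < n" and ab: "a < n" "b < n" for a b i j
  proof -
    let ?F = "elem_mat n i j (u - 1)"
    have "dilation_mat n i u \<in> C" "elem_mat n i j 1 \<in> C" using ij u C_dilation C_elem one_T by auto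
    hence "w * ?F = ?F * w"
      using W elem_mat_commutator[OF ij u(1)] unfolding comm_centralizer_def by fastforce
    hence "(w * ?F) $$ (a, b) = (?F * w) $$ (a, b)" by simp
    thus ?thesis using ij ab u C_carrier[OF w]
      by (auto simp: elem_mat_mult_left elem_mat_mult_right simp del: index_mult_mat(1) split: if_splits)
  qed
  \<comment> \<open>Taking \<open>j = n - 1\<close> clears all columns but the last off the
    diagonal, taking \<open>i = 0\<close> clears all rows but the first, and comparing at
    \<open>(0, i)\<close> equalises the diagonal. Off the diagonal only the corner entry
    survives.\<close>
  have col: "w $$ (a, i) = 0" if "i < n - 1" "a < n" "a \<noteq> i" for a i
    using key[of i "n - 1" a "n - 1"] that by simp
  have row: "w $$ (j, b) = 0" if "0 < j" "j < n" "b < n" "b \<noteq> j" for j b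
    using key[of 0 j 0 b] that by simp
  have diag: "w $$ (i, i) = w $$ (0, 0)" if "i < n" for i
    using key[of 0 i 0 i] that n_ge_2 by (cases "i = 0") auto
  show nn: "w $$ (n - 1, n - 1) = w $$ (0, 0)" using diag[of "n - 1"] n_ge_2 by simp
  show "w = w $$ (0, 0) \<cdot>\<^sub>m elem_mat n 0 (n - 1) (corner_entry n w)"
  proof (rule eq_matI)
    fix a b assume "a < dim_row (w $$ (0, 0) \<cdot>\<^sub>m elem_mat n 0 (n - 1) (corner_entry n w))"
      "b < dim_col (w $$ (0, 0) \<cdot>\<^sub>m elem_mat n 0 (n - 1) (corner_entry n w))"
    hence ab: "a < n" "b < n" by (auto simp: elem_mat_def)
    show "w $$ (a, b) = (w $$ (0, 0) \<cdot>\<^sub>m elem_mat n 0 (n - 1) (corner_entry n w)) $$ (a, b)"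
    proof (cases "a = b")
      case True thus ?thesis using ab diag[OF ab(2)] n_ge_2 by (auto simp: elem_mat_def)
    next
      case False
      show ?thesis
      proof (cases "a = 0 \<and> b = n - 1")
        case True thus ?thesis
          using ab nn diag_nonzero[OF w, of 0] n_ge_2 by (simp add: elem_mat_def corner_entry_def)
      next
        case F: False
        hence "w $$ (a, b) = 0" using col[of b a] row[of a b] ab False by (cases "a = 0") auto
        thus ?thesis using ab F False by (auto simp: elem_mat_def)
      qed
    qed
  qed (use C_carrier[OF w] in \<open>auto simp: elem_mat_def\<close>)
qed

text \<open>Up to a scalar, \<open>w\<close> is a corner transvection: on the right it adds a
  multiple of the first column to the last, on the left a multiple of the last row to the
  first.\<close>

lemma mult_comm_centralizer:
  assumes "w \<in> comm_centralizer G" and A: "A \<in> C" and ab: "a < n" "b < n"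
  shows "(A * w) $$ (a, b) = w $$ (0, 0) * (A $$ (a, b) + (if b = n - 1 then A $$ (a, 0) * corner_entry n w else 0))"
    and "(w * A) $$ (a, b) = w $$ (0, 0) * (A $$ (a, b) + (if a = 0 then corner_entry n w * A $$ (n - 1, b) else 0))"
proof -
  let ?E = "elem_mat n 0 (n - 1) (corner_entry n w)"
  have "A * w = w $$ (0, 0) \<cdot>\<^sub>m (A * ?E)"
    by (subst comm_centralizer_form(1)[OF assms(1)]) (rule mult_smult_distrib[OF C_carrier[OF A] elem_mat_carrier])
  thus "(A * w) $$ (a, b) = w $$ (0, 0) * (A $$ (a, b) + (if b = n - 1 then A $$ (a, 0) * corner_entry n w else 0))"
    using ab C_carrier[OF A] n_ge_2 index_smult_mat(1)[of a "A * ?E" b "w $$ (0, 0)"]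
      mult_carrier_mat[OF C_carrier[OF A] elem_mat_carrier[of n 0 "n - 1" "corner_entry n w"]]
    by (auto simp: elem_mat_mult_right simp del: index_mult_mat(1) index_smult_mat(1))
  have "w * A = w $$ (0, 0) \<cdot>\<^sub>m (?E * A)"
    by (subst comm_centralizer_form(1)[OF assms(1)]) (rule mult_smult_assoc_mat[OF elem_mat_carrier C_carrier[OF A]])
  thus "(w * A) $$ (a, b) = w $$ (0, 0) * (A $$ (a, b) + (if a = 0 then corner_entry n w * A $$ (n - 1, b) else 0))"
    using ab C_carrier[OF A] n_ge_2 index_smult_mat(1)[of a "?E * A" b "w $$ (0, 0)"]
      mult_carrier_mat[OF elem_mat_carrier[of n 0 "n - 1" "corner_entry n w"] C_carrier[OF A]]
    by (auto simp: elem_mat_mult_left simp del: index_mult_mat(1) index_smult_mat(1))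
qed

text \<open>A commutator is triangular with diagonal 1, so its first column and last row are those
  of the identity. Only these enter the two products with a corner transvection, and both products
  change the corner entry by \<open>x\<close>.\<close>

lemma elem_mat_comm_centralizer:
  assumes x: "x \<in> T"
  shows "elem_mat n 0 (n - 1) x \<in> comm_centralizer G"
proof (rule comm_centralizer_eqI)
  let ?E = "elem_mat n 0 (n - 1) x"
  show "?E \<in> carrier G" using C_elem[of 0 "n - 1"] n_ge_2 x by simp
  fix A B assume "A \<in> carrier G" "B \<in> carrier G"
  hence AB: "A \<in> C" "B \<in> C" by simp_all
  define c where "c = A * B * inv\<^bsub>G\<^esub> A * inv\<^bsub>G\<^esub> B"
  have "inv\<^bsub>G\<^esub> A \<in> C" "inv\<^bsub>G\<^esub> B \<in> C" using AB inv_closed by auto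
  hence c: "c \<in> C" using AB by (simp add: c_def C_mult)
  have d: "c $$ (i, i) = 1" if "i < n" for i
    using commutator_diag[OF AB that] by (simp add: c_def)
  have "?E * c = c * ?E"
  proof (rule eq_matI)
    fix a b assume "a < dim_row (c * ?E)" "b < dim_col (c * ?E)"
    hence ab: "a < n" "b < n" using C_carrier[OF c] by (auto simp: elem_mat_def)
    have "c $$ (a, 0) = (if a = 0 then 1 else 0)" using d lower_zero[OF c, of 0 a] ab by auto
    moreover have "c $$ (n - 1, b) = (if b = n - 1 then 1 else 0)"
      using d lower_zero[OF c, of b "n - 1"] ab n_ge_2 by auto
    ultimately show "(?E * c) $$ (a, b) = (c * ?E) $$ (a, b)"
      using ab C_carrier[OF c] n_ge_2 d[of "n - 1"]
      by (auto simp: elem_mat_mult_left elem_mat_mult_right simp del: index_mult_mat(1))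
  qed (use C_carrier[OF c] in \<open>auto simp: elem_mat_def\<close>)
  thus "?E \<otimes>\<^bsub>G\<^esub> (A \<otimes>\<^bsub>G\<^esub> B \<otimes>\<^bsub>G\<^esub> inv\<^bsub>G\<^esub> A \<otimes>\<^bsub>G\<^esub> inv\<^bsub>G\<^esub> B)
      = A \<otimes>\<^bsub>G\<^esub> B \<otimes>\<^bsub>G\<^esub> inv\<^bsub>G\<^esub> A \<otimes>\<^bsub>G\<^esub> inv\<^bsub>G\<^esub> B \<otimes>\<^bsub>G\<^esub> ?E"
    by (simp add: c_def)
qed

lemma axial: "axial_group G T V (corner_char n) (corner_entry n)"
proof
  interpret W: subgroup "comm_centralizer G" G by (rule subgroup_comm_centralizer)
  have n: "0 < n" "n - 1 < n" "n - 1 \<noteq> 0" "0 \<noteq> n - 1" using n_ge_2 by auto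
  have WC: "w \<in> C" if "w \<in> comm_centralizer G" for w
    using that by (simp add: comm_centralizer_def)
  show "V \<noteq> {1}" by (rule V_nontriv)
  show "corner_char n (A \<otimes>\<^bsub>G\<^esub> B) = corner_char n A * corner_char n B"
    if "A \<in> carrier G" "B \<in> carrier G" for A B
    using that n by (simp add: corner_char_def diag_mult del: index_mult_mat(1))
  show "corner_char n ` carrier G = V"
  proof (intro equalityI subsetI)
    fix u assume "u \<in> corner_char n ` carrier G"
    thus "u \<in> V" using n C_diag mult_V inverse_V by (auto simp: corner_char_def divide_inverse)
  next
    fix u assume u: "u \<in> V"
    have "corner_char n (dilation_mat n 0 u) = u" using n by (simp add: corner_char_def dilation_mat_entry)
    thus "u \<in> corner_char n ` carrier G" using C_dilation[of 0 u] u n_ge_2 by force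
  qed
  show "corner_entry n (v \<otimes>\<^bsub>G\<^esub> w) = corner_entry n v + corner_entry n w"
    if vw: "v \<in> comm_centralizer G" "w \<in> comm_centralizer G" for v w
  proof -
    have z: "v $$ (0, 0) \<noteq> 0" "w $$ (0, 0) \<noteq> 0" using vw WC diag_nonzero n by auto
    have "(v * w) $$ (0, n - 1) = w $$ (0, 0) * (v $$ (0, n - 1) + v $$ (0, 0) * corner_entry n w)"
      using mult_comm_centralizer(1)[OF vw(2) WC[OF vw(1)], of 0 "n - 1"] n by simp
    moreover have "(v * w) $$ (n - 1, n - 1) = w $$ (0, 0) * v $$ (0, 0)"
      using diag_mult[of v w "n - 1"] vw WC n comm_centralizer_form(2) by simp
    ultimately have "corner_entry n (v * w) = (v $$ (0, n - 1) + v $$ (0, 0) * corner_entry n w) / v $$ (0, 0)"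
      unfolding corner_entry_def[of n "v * w"] using z by simp
    also have "\<dots> = corner_entry n v + corner_entry n w"
      using z comm_centralizer_form(2)[OF vw(1)] by (simp add: corner_entry_def[of n v] add_divide_distrib)
    finally show ?thesis by simp
  qed
  show "corner_entry n (g \<otimes>\<^bsub>G\<^esub> w \<otimes>\<^bsub>G\<^esub> inv\<^bsub>G\<^esub> g) = corner_char n g * corner_entry n w"
    if g: "g \<in> carrier G" and w: "w \<in> comm_centralizer G" for g w
  proof -
    define w' where "w' = g \<otimes>\<^bsub>G\<^esub> w \<otimes>\<^bsub>G\<^esub> inv\<^bsub>G\<^esub> g"
    have gC: "g \<in> C" using g by simp
    have w': "w' \<in> comm_centralizer G" unfolding w'_def by (rule conj_comm_centralizer[OF g w])
    have wc: "w \<in> carrier G" using WC[OF w] by simp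
    have "w' \<otimes>\<^bsub>G\<^esub> g = g \<otimes>\<^bsub>G\<^esub> w"
      using g wc unfolding w'_def by (simp only: m_assoc inv_closed m_closed l_inv r_one)
    \<comment> \<open>Written without an inverse, the conjugation can be read off entrywise: the
      entry \<open>(0, 0)\<close> shows that the scalars of \<open>w\<close> and \<open>w'\<close>
      agree, the corner entry then compares the coordinates.\<close>
    hence eq: "g * w = w' * g" by simp
    note nz = diag_nonzero[OF gC] diag_nonzero[OF WC[OF w]] diag_nonzero[OF WC[OF w']]
    have "w $$ (0, 0) = w' $$ (0, 0)"
      using diag_mult[of g w 0] diag_mult[of w' g 0] eq gC WC[OF w] WC[OF w'] n nz by simp
    moreover have "w $$ (0, 0) * (g $$ (0, n - 1) + g $$ (0, 0) * corner_entry n w)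
        = w' $$ (0, 0) * (g $$ (0, n - 1) + corner_entry n w' * g $$ (n - 1, n - 1))"
      using mult_comm_centralizer(1)[OF w gC n(1,2)] mult_comm_centralizer(2)[OF w' gC n(1,2)] eq by simp
    ultimately have "g $$ (0, 0) * corner_entry n w = corner_entry n w' * g $$ (n - 1, n - 1)"
      using nz n by simp
    thus ?thesis using nz n unfolding w'_def[symmetric] by (simp add: corner_char_def field_simps)
  qed
  show "g \<otimes>\<^bsub>G\<^esub> w = w \<otimes>\<^bsub>G\<^esub> g" if w: "w \<in> comm_centralizer G" and z: "corner_entry n w = 0"
    and g: "g \<in> carrier G" for g w
  proof -
    have gC: "g \<in> C" using g by simp
    have "g * w = w * g"
    proof (rule eq_matI)
      fix a b assume "a < dim_row (w * g)" "b < dim_col (w * g)"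
      hence ab: "a < n" "b < n" using C_carrier[OF gC] C_carrier[OF WC[OF w]] by auto
      show "(g * w) $$ (a, b) = (w * g) $$ (a, b)"
        unfolding mult_comm_centralizer[OF w gC ab] z by simp
    qed (use C_carrier[OF gC] C_carrier[OF WC[OF w]] in auto)
    thus ?thesis by simp
  qed
  show "corner_entry n ` comm_centralizer G = T"
  proof (intro equalityI subsetI)
    fix x assume "x \<in> corner_entry n ` comm_centralizer G"
    then obtain w where w: "w \<in> comm_centralizer G" "x = corner_entry n w" by blast
    have "inverse (w $$ (n - 1, n - 1)) \<in> T"
      using C_diag[OF WC[OF w(1)] n(2)] inverse_V V_T by blast
    thus "x \<in> T" using C_entries[OF WC[OF w(1)] n(1,2)] mult_T w by (simp add: corner_entry_def divide_inverse)
  next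
    fix x assume x: "x \<in> T"
    have "corner_entry n (elem_mat n 0 (n - 1) x) = x" using n by (simp add: corner_entry_def elem_mat_entry)
    thus "x \<in> corner_entry n ` comm_centralizer G" using elem_mat_comm_centralizer[OF x] by force
  qed
qed

sublocale axial_group "mat_grp n C" T V "corner_char n" "corner_entry n"
  by (rule axial)

lemma comm_centralizer_scalar:
  assumes "u \<in> V" "u \<cdot>\<^sub>m 1\<^sub>m n \<in> C"
  shows "u \<cdot>\<^sub>m 1\<^sub>m n \<in> comm_centralizer G"
proof (rule comm_centralizer_eqI)
  fix A B assume "A \<in> carrier G" "B \<in> carrier G"
  hence "A \<otimes>\<^bsub>G\<^esub> B \<otimes>\<^bsub>G\<^esub> inv\<^bsub>G\<^esub> A \<otimes>\<^bsub>G\<^esub> inv\<^bsub>G\<^esub> B \<in> carrier G" (is "?c \<in> _") by blast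
  hence "?c \<in> carrier_mat n n" using C_carrier by simp
  thus "u \<cdot>\<^sub>m 1\<^sub>m n \<otimes>\<^bsub>G\<^esub> ?c = ?c \<otimes>\<^bsub>G\<^esub> (u \<cdot>\<^sub>m 1\<^sub>m n)"
    by (simp add: scalar_mat_mult)
qed (use assms in simp)

text \<open>The requirement on commutators in the quotient holds because every commutator has
  diagonal 1: the only scalar commutator is the identity.\<close>

lemma axial_scalar_quotient:
  assumes scalars: "scalar_mats n V \<subseteq> C"
  shows "axial_group (G Mod scalar_mats n V) T V
    (\<lambda>X. corner_char n (SOME x. x \<in> X)) (\<lambda>X. corner_entry n (SOME x. x \<in> X))"
proof (rule axial_group_quotient)
  have n: "0 < n" "n - 1 < n" "n - 1 \<noteq> 0" "0 \<noteq> n - 1" using n_ge_2 by auto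
  have smult_comm: "u \<cdot>\<^sub>m 1\<^sub>m n * A = A * (u \<cdot>\<^sub>m 1\<^sub>m n)" if "A \<in> C" for u A
    using C_carrier[OF that] by (simp add: scalar_mat_mult)
  note smult = scalar_mat_mult_scalar[where 'k = 'k and n = n]
  have mem: "u \<cdot>\<^sub>m 1\<^sub>m n \<in> C" if "u \<in> V" for u
    using that scalars by (auto simp: scalar_mats_def)
  have "subgroup (scalar_mats n V) G"
  proof
    show "scalar_mats n V \<subseteq> carrier G" using scalars by simp
    show "x \<otimes>\<^bsub>G\<^esub> y \<in> scalar_mats n V" if "x \<in> scalar_mats n V" "y \<in> scalar_mats n V" for x y
      using that smult mult_V unfolding scalar_mats_def by auto
    have "1\<^sub>m n = (1::'k) \<cdot>\<^sub>m 1\<^sub>m n" by (rule eq_matI) auto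
    thus "\<one>\<^bsub>G\<^esub> \<in> scalar_mats n V" using one_V by (auto simp: scalar_mats_def)
    show "inv\<^bsub>G\<^esub> x \<in> scalar_mats n V" if x: "x \<in> scalar_mats n V" for x
    proof -
      obtain u where u: "u \<in> V" "x = u \<cdot>\<^sub>m 1\<^sub>m n" using x by (auto simp: scalar_mats_def)
      have "inverse u * u = 1" using u zero_V by (metis left_inverse)
      hence "(inverse u \<cdot>\<^sub>m 1\<^sub>m n) \<otimes>\<^bsub>G\<^esub> x = \<one>\<^bsub>G\<^esub>" using smult[of "inverse u" u] u by (auto intro!: eq_matI)
      hence "inv\<^bsub>G\<^esub> x = inverse u \<cdot>\<^sub>m 1\<^sub>m n" using inv_equality mem u inverse_V by simp
      thus ?thesis using inverse_V u by (auto simp: scalar_mats_def)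
    qed
  qed
  thus "scalar_mats n V \<lhd> G"
  proof (rule normal_invI)
    fix x z assume xz: "x \<in> carrier G" "z \<in> scalar_mats n V"
    then obtain u where u: "u \<in> V" "z = u \<cdot>\<^sub>m 1\<^sub>m n" by (auto simp: scalar_mats_def)
    have "z \<in> carrier G" using mem u by simp
    moreover have "x \<otimes>\<^bsub>G\<^esub> z = z \<otimes>\<^bsub>G\<^esub> x" using smult_comm[of x u] xz u by simp
    ultimately have "x \<otimes>\<^bsub>G\<^esub> z \<otimes>\<^bsub>G\<^esub> inv\<^bsub>G\<^esub> x = z" using xz by (simp only: m_assoc r_inv r_one inv_closed)
    thus "x \<otimes>\<^bsub>G\<^esub> z \<otimes>\<^bsub>G\<^esub> inv\<^bsub>G\<^esub> x \<in> scalar_mats n V" using xz by simp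
  qed
  show "corner_char n z = 1" if "z \<in> scalar_mats n V" for z
    using that n zero_V by (auto simp: scalar_mats_def corner_char_def)
  show "corner_entry n z = 0" if "z \<in> scalar_mats n V" for z
    using that n by (auto simp: scalar_mats_def corner_entry_def)
  show "scalar_mats n V \<subseteq> comm_centralizer G"
    using comm_centralizer_scalar mem by (auto simp: scalar_mats_def)
  fix A B assume AB: "A \<in> carrier G" "B \<in> carrier G"
    "A \<otimes>\<^bsub>G\<^esub> B \<otimes>\<^bsub>G\<^esub> inv\<^bsub>G\<^esub> A \<otimes>\<^bsub>G\<^esub> inv\<^bsub>G\<^esub> B \<in> scalar_mats n V"
  then obtain u where u: "A * B * inv\<^bsub>G\<^esub> A * inv\<^bsub>G\<^esub> B = u \<cdot>\<^sub>m 1\<^sub>m n" by (auto simp: scalar_mats_def)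
  hence "u = 1" using commutator_diag[of A B 0] AB n by simp
  thus "A \<otimes>\<^bsub>G\<^esub> B \<otimes>\<^bsub>G\<^esub> inv\<^bsub>G\<^esub> A \<otimes>\<^bsub>G\<^esub> inv\<^bsub>G\<^esub> B = \<one>\<^bsub>G\<^esub>"
    using u by (auto intro!: eq_matI)
qed

end

section \<open>Affine matrices, and the concrete groups as triangular groups\<close>

lemma aff_mat_carrier [simp]: "aff_mat u r \<in> carrier_mat 2 2"
  by (rule carrier_matI) (simp_all add: aff_mat_def mat_of_rows_list_def)

lemma aff_mat_dim [simp]: "dim_row (aff_mat u r) = 2" "dim_col (aff_mat u r) = 2"
  using aff_mat_carrier[of u r] by blast+

lemma aff_mat_entries:
  "aff_mat u r $$ (0, 0) = u" "aff_mat u r $$ (0, Suc 0) = r"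
  "aff_mat u r $$ (Suc 0, 0) = 0" "aff_mat u r $$ (Suc 0, Suc 0) = 1"
  by (simp_all add: aff_mat_def mat_of_rows_list_def)

lemma mat2_eqI:
  assumes "A \<in> carrier_mat 2 2" "B \<in> carrier_mat 2 2"
    and "A $$ (0, 0) = B $$ (0, 0)" "A $$ (0, Suc 0) = B $$ (0, Suc 0)"
    and "A $$ (Suc 0, 0) = B $$ (Suc 0, 0)" "A $$ (Suc 0, Suc 0) = B $$ (Suc 0, Suc 0)"
  shows "A = B"
  using assms by (intro eq_matI) (auto simp: less_2_cases_iff)

lemma aff_mat_mult:
  fixes u :: "'k::field"
  shows "aff_mat u r * aff_mat v s = aff_mat (u * v) (u * s + r)"
proof -
  have sum2: "(\<Sum>k<2. h k) = h 0 + h (Suc 0)" for h :: "nat \<Rightarrow> 'k"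
    by (simp add: numeral_2_eq_2)
  show ?thesis
    by (rule mat2_eqI)
      (simp_all add: mat_mult_entry[OF aff_mat_carrier aff_mat_carrier] sum2 aff_mat_entries
         mult_carrier_mat[OF aff_mat_carrier aff_mat_carrier] del: index_mult_mat(1))
qed

lemma aff_mat_one: "aff_mat 1 0 = 1\<^sub>m 2"
  by (rule mat2_eqI) (simp_all add: aff_mat_entries aff_mat_carrier)

lemma Units_ring_on:
  "u \<in> Units (ring_on T) \<longleftrightarrow> u \<in> T \<and> (\<exists>v\<in>T. v * u = 1 \<and> u * v = 1)"
  by (auto simp: Units_def ring_on_def)

locale subring_unit_group = subring_units T V for T V :: "'k::field set" +
  assumes V_Units: "V \<subseteq> Units (ring_on T)" and V_nontrivial: "V \<noteq> {1}"
begin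

lemma sum_T: "(\<And>i. i \<in> I \<Longrightarrow> h i \<in> T) \<Longrightarrow> sum h I \<in> T"
  by (induction I rule: infinite_finite_induct) (auto simp: zero_T add_T)

lemma GL_carrier:
  "A \<in> carrier (GL n T) \<longleftrightarrow> A \<in> carrier_mat n n \<and> elements_mat A \<subseteq> T
     \<and> (\<exists>B. B \<in> carrier_mat n n \<and> elements_mat B \<subseteq> T \<and> B * A = 1\<^sub>m n \<and> A * B = 1\<^sub>m n)"
  unfolding GL_def units_of_carrier by (auto simp: Units_def ring_mat_def)

lemma elements_mult:
  assumes "A \<in> carrier_mat n n" "B \<in> carrier_mat n n" "elements_mat A \<subseteq> T" "elements_mat B \<subseteq> T"
  shows "elements_mat (A * B) \<subseteq> T"
proof
  fix x assume "x \<in> elements_mat (A * B)"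
  then obtain i j where ij: "i < n" "j < n" "x = (A * B) $$ (i, j)"
    using elements_matD[of x "A * B"] assms(1,2) by (auto simp del: index_mult_mat(1))
  have "A $$ (i, k) \<in> T" "B $$ (k, j) \<in> T" if "k < n" for k
    using assms ij that by (auto intro: elements_matI)
  thus "x \<in> T" unfolding ij(3) mat_mult_entry[OF assms(1,2) ij(1,2)]
    by (intro sum_T mult_T) auto
qed

lemma GL_mult: "A \<in> carrier (GL n T) \<Longrightarrow> B \<in> carrier (GL n T) \<Longrightarrow> A * B \<in> carrier (GL n T)"
proof -
  assume A: "A \<in> carrier (GL n T)" and B: "B \<in> carrier (GL n T)"
  obtain A' B' where 1: "A' \<in> carrier_mat n n" "elements_mat A' \<subseteq> T" "A' * A = 1\<^sub>m n" "A * A' = 1\<^sub>m n"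
    "B' \<in> carrier_mat n n" "elements_mat B' \<subseteq> T" "B' * B = 1\<^sub>m n" "B * B' = 1\<^sub>m n"
    using A B unfolding GL_carrier by metis
  have 2: "A \<in> carrier_mat n n" "B \<in> carrier_mat n n" using A B unfolding GL_carrier by auto
  have "(B' * A') * (A * B) = B' * ((A' * A) * B)"
    unfolding assoc_mult_mat[OF 1(5) 1(1) mult_carrier_mat[OF 2]] assoc_mult_mat[OF 1(1) 2] ..
  hence l: "(B' * A') * (A * B) = 1\<^sub>m n" unfolding 1(3) left_mult_one_mat[OF 2(2)] 1(7) .
  have "(A * B) * (B' * A') = A * ((B * B') * A')"
    unfolding assoc_mult_mat[OF 2(1) 2(2) mult_carrier_mat[OF 1(5) 1(1)]] assoc_mult_mat[OF 2(2) 1(5) 1(1)] ..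
  hence r: "(A * B) * (B' * A') = 1\<^sub>m n" unfolding 1(8) left_mult_one_mat[OF 1(1)] 1(4) .
  have "elements_mat A \<subseteq> T" "elements_mat B \<subseteq> T" using A B unfolding GL_carrier by auto
  thus "A * B \<in> carrier (GL n T)"
    unfolding GL_carrier
    using l r mult_carrier_mat[OF 2] mult_carrier_mat[OF 1(5,1)] elements_mult[OF 2] elements_mult[OF 1(5,1) 1(6,2)]
    by blast
qed

lemma borel_plus_mat_grp: "borel_plus n T V = mat_grp n (carrier (borel_plus n T V))"
  by (simp add: borel_plus_def borel_def GL_def units_of_def mat_grp_def ring_mat_def)

lemma borel_plus_carrier:
  "A \<in> carrier (borel_plus n T V) \<longleftrightarrow> A \<in> carrier (GL n T) \<and> upper_triangular A \<and> (\<forall>i<n. A $$ (i, i) \<in> V)"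
  by (auto simp: borel_plus_def borel_def)

lemma elem_mat_GL:
  assumes "i < j" "j < n" "x \<in> T" shows "elem_mat n i j x \<in> carrier (GL n T)"
proof -
  have el: "elements_mat (elem_mat n i j y) \<subseteq> T" if "y \<in> T" for y
    using assms that one_T zero_T add_T by (fastforce simp: elem_mat_entry dest!: elements_matD)
  have pr: "elem_mat n i j y * elem_mat n i j z = 1\<^sub>m n" if "y + z = 0" for y z :: 'k
    using assms that
    by (intro eq_matI) (auto simp: elem_mat_mult_left elem_mat_entry add.commute simp del: index_mult_mat(1))
  show ?thesis unfolding GL_carrier
    using el[OF assms(3)] el[OF minus_T[OF assms(3)]] pr[of x "- x"] pr[of "- x" x] elem_mat_carrier
    by (metis add.right_inverse add.left_inverse)
qed

lemma dilation_mat_GL: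
  assumes "u \<in> V" shows "dilation_mat n i u \<in> carrier (GL n T)"
proof -
  have el: "elements_mat (dilation_mat n i v) \<subseteq> T" if "v \<in> V" for v
    using that one_T zero_T V_T by (auto simp: dilation_mat_entry dest!: elements_matD)
  have pr: "dilation_mat n i v * dilation_mat n i w = 1\<^sub>m n" if "v * w = 1" for v w :: 'k
    using that
    by (intro eq_matI) (auto simp: dilation_mat_mult_left dilation_mat_entry simp del: index_mult_mat(1))
  have "u \<noteq> 0" using assms zero_V by blast
  thus ?thesis unfolding GL_carrier
    using el[OF assms] el[OF inverse_V[OF assms]] pr[of u "inverse u"] pr[of "inverse u" u] dilation_mat_carrier
    by (metis left_inverse right_inverse)
qed

lemma triangular_borel_plus:
  assumes "n \<ge> 2" shows "triangular_group T V n (carrier (borel_plus n T V))"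
proof
  show "n \<ge> 2" "V \<noteq> {1}" by (fact assms V_nontrivial)+
  show "A \<in> carrier_mat n n" "upper_triangular A" if "A \<in> carrier (borel_plus n T V)" for A
    using that by (auto simp: borel_plus_carrier GL_carrier)
  show "A $$ (i, j) \<in> T" if "A \<in> carrier (borel_plus n T V)" "i < n" "j < n" for A i j
    using that by (auto simp: borel_plus_carrier GL_carrier)
  show "A $$ (i, i) \<in> V" if "A \<in> carrier (borel_plus n T V)" "i < n" for A i
    using that by (auto simp: borel_plus_carrier)
  show "1\<^sub>m n \<in> carrier (borel_plus n T V)"
    using one_V one_T zero_T by (fastforce simp: borel_plus_carrier GL_carrier intro!: exI[of _ "1\<^sub>m n"])
  show "A * B \<in> carrier (borel_plus n T V)"
    if "A \<in> carrier (borel_plus n T V)" "B \<in> carrier (borel_plus n T V)" for A B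
    using that diag_mult_upper_triangular[of A n B] upper_triangular_mult[of A n B] GL_mult mult_V
    by (simp add: borel_plus_carrier GL_carrier[of A] GL_carrier[of B])
  show "\<exists>B\<in>carrier (borel_plus n T V). B * A = 1\<^sub>m n" if "A \<in> carrier (borel_plus n T V)" for A
  proof -
    have A: "A \<in> carrier_mat n n" "elements_mat A \<subseteq> T" "upper_triangular A" "\<forall>i<n. A $$ (i, i) \<in> V"
      using that by (auto simp: borel_plus_carrier GL_carrier)
    from that obtain B
      where B: "B \<in> carrier_mat n n" "elements_mat B \<subseteq> T" "B * A = 1\<^sub>m n" "A * B = 1\<^sub>m n"
      unfolding borel_plus_carrier GL_carrier by blast
    have ut: "upper_triangular B" by (rule upper_triangular_left_inverse[OF A(1) B(1) A(3) B(3)])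
    have "B $$ (i, i) \<in> V" if i: "i < n" for i
    proof -
      have "A $$ (i, i) * B $$ (i, i) = 1"
        using diag_mult_upper_triangular[OF A(1) B(1) A(3) ut i] B(4) i by simp
      hence "B $$ (i, i) = inverse (A $$ (i, i))" by (metis inverse_unique)
      thus ?thesis using A(4) i inverse_V by simp
    qed
    hence "B \<in> carrier (borel_plus n T V)"
      unfolding borel_plus_carrier GL_carrier using A(1,2) B ut by blast
    thus ?thesis using B(3) by blast
  qed
  show "elem_mat n i j x \<in> carrier (borel_plus n T V)" if "i < j" "j < n" "x \<in> T" for i j x
    using elem_mat_GL[OF that] that one_V by (auto simp: borel_plus_carrier elem_mat_entry intro!: upper_triangularI)
  show "dilation_mat n i u \<in> carrier (borel_plus n T V)" if "Suc i < n" "u \<in> V" for i u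
    using dilation_mat_GL[OF that(2)] that one_V by (auto simp: borel_plus_carrier dilation_mat_entry intro!: upper_triangularI)
qed

lemma scalar_mats_borel_plus: "scalar_mats n V \<subseteq> carrier (borel_plus n T V)"
proof
  fix z assume "z \<in> scalar_mats n V"
  then obtain u where u: "u \<in> V" "z = u \<cdot>\<^sub>m 1\<^sub>m n" by (auto simp: scalar_mats_def)
  have u0: "u \<noteq> 0" using u zero_V by blast
  have el: "elements_mat (v \<cdot>\<^sub>m 1\<^sub>m n) \<subseteq> T" if "v \<in> V" for v
    using that zero_T V_T by (fastforce dest!: elements_matD)
  have pr: "v \<cdot>\<^sub>m 1\<^sub>m n * (w \<cdot>\<^sub>m 1\<^sub>m n) = 1\<^sub>m n" if "v * w = 1" for v w :: 'k
    using that by (auto simp: scalar_mat_mult_scalar intro!: eq_matI)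
  have "z \<in> carrier (GL n T)" unfolding GL_carrier u(2)
    using el[OF u(1)] el[OF inverse_V[OF u(1)]] pr[of u "inverse u"] pr[of "inverse u" u] u0
    by (metis left_inverse right_inverse one_carrier_mat smult_carrier_mat)
  thus "z \<in> carrier (borel_plus n T V)" using u by (auto simp: borel_plus_carrier intro!: upper_triangularI)
qed

lemma aff_plus_mat_grp: "aff_plus T V = mat_grp 2 {aff_mat u r | u r. u \<in> V \<and> r \<in> T}"
  by (simp add: aff_plus_def GL_def units_of_def mat_grp_def ring_mat_def)

lemma triangular_aff_plus: "triangular_group T V 2 {aff_mat u r | u r. u \<in> V \<and> r \<in> T}"
proof
  let ?C = "{aff_mat u r | u r. u \<in> V \<and> r \<in> T}"
  show "2 \<le> (2::nat)" "V \<noteq> {1}" using V_nontrivial by auto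
  show "A \<in> carrier_mat 2 2" "upper_triangular A" if "A \<in> ?C" for A
    using that by (auto simp: less_2_cases_iff aff_mat_entries intro!: upper_triangularI)
  show "A $$ (i, j) \<in> T" if "A \<in> ?C" "i < 2" "j < 2" for A i j
    using that V_T one_T zero_T by (auto simp: less_2_cases_iff aff_mat_entries)
  show "A $$ (i, i) \<in> V" if "A \<in> ?C" "i < 2" for A i
    using that one_V by (auto simp: less_2_cases_iff aff_mat_entries)
  show "1\<^sub>m 2 \<in> ?C" unfolding aff_mat_one[symmetric] using one_V zero_T by blast
  show "A * B \<in> ?C" if "A \<in> ?C" "B \<in> ?C" for A B
  proof -
    from that obtain u r v s where *: "u \<in> V" "r \<in> T" "A = aff_mat u r" "v \<in> V" "s \<in> T" "B = aff_mat v s"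
      by blast
    have "u * v \<in> V" "u * s + r \<in> T" using * V_T mult_V mult_T add_T by blast+
    thus ?thesis unfolding *(3,6) aff_mat_mult by blast
  qed
  show "\<exists>B\<in>?C. B * A = 1\<^sub>m 2" if "A \<in> ?C" for A
  proof -
    from that obtain u r where ur: "u \<in> V" "r \<in> T" "A = aff_mat u r" by auto
    have u0: "u \<noteq> 0" using ur zero_V by blast
    have "inverse u \<in> V" "- (inverse u * r) \<in> T" using ur inverse_V V_T mult_T minus_T by blast+
    moreover have "aff_mat (inverse u) (- (inverse u * r)) * A = 1\<^sub>m 2"
      using u0 by (simp add: ur aff_mat_mult flip: aff_mat_one)
    ultimately show ?thesis by blast
  qed
  show "elem_mat 2 i j x \<in> ?C" if ij: "i < j" "j < 2" and x: "x \<in> T" for i j x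
  proof -
    have "elem_mat 2 i j x = aff_mat 1 x"
      using ij by (intro mat2_eqI) (auto simp: aff_mat_carrier aff_mat_entries elem_mat_entry)
    thus ?thesis using x one_V by blast
  qed
  show "dilation_mat 2 i u \<in> ?C" if "Suc i < 2" "u \<in> V" for i u
  proof -
    have "dilation_mat 2 i u = aff_mat u 0"
      using that by (intro mat2_eqI) (auto simp: aff_mat_carrier aff_mat_entries dilation_mat_entry)
    thus ?thesis using that zero_T by blast
  qed
qed

theorem rigid_R_infinity:
  assumes rigid: "rigid T V" and n: "n \<ge> 2"
  shows "property_R_infinity (borel_plus n T V)" and "property_R_infinity (proj_borel_plus n T V)"
    and "property_R_infinity (aff_plus T V)"
proof -
  interpret B: triangular_group T V n "carrier (borel_plus n T V)" by (rule triangular_borel_plus[OF n])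
  interpret A: triangular_group T V 2 "{aff_mat u r | u r. u \<in> V \<and> r \<in> T}" by (rule triangular_aff_plus)
  interpret P: axial_group "B.G Mod scalar_mats n V" T V
      "\<lambda>X. corner_char n (SOME x. x \<in> X)" "\<lambda>X. corner_entry n (SOME x. x \<in> X)"
    by (rule B.axial_scalar_quotient[OF scalar_mats_borel_plus])
  show "property_R_infinity (borel_plus n T V)"
    by (subst borel_plus_mat_grp) (rule B.property_R_infinity_axial[OF rigid])
  show "property_R_infinity (proj_borel_plus n T V)"
    unfolding proj_borel_plus_def by (subst borel_plus_mat_grp) (rule P.property_R_infinity_axial[OF rigid])
  show "property_R_infinity (aff_plus T V)"
    by (subst aff_plus_mat_grp) (rule A.property_R_infinity_axial[OF rigid])
qed

theorem rigid_induced_fixed_points: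
  assumes rigid: "rigid T V" and psi: "\<psi> \<in> auto (aff_plus T V)"
  shows "infinite (induced_fixed_points (aff_plus T V) (aff_unipotent T) \<psi>)"
proof -
  interpret A: triangular_group T V 2 "{aff_mat u r | u r. u \<in> V \<and> r \<in> T}" by (rule triangular_aff_plus)
  \<comment> \<open>The last diagonal entry of an affine matrix is 1, so \<open>corner_char\<close>
    is its upper left entry.\<close>
  have "aff_unipotent T = {g \<in> carrier A.G. corner_char 2 g = 1}"
    using one_V by (auto simp: aff_unipotent_def corner_char_def aff_mat_entries)
  thus ?thesis
    using A.infinite_induced_fixed_points[OF rigid] psi unfolding aff_plus_mat_grp by blast
qed

end

text \<open>The inverse over \<open>T\<close> of a triangular matrix is again triangular, so the
  diagonal entries are units of \<open>T\<close>. The full Borel group is thus the case in which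
  \<open>V\<close> consists of all units.\<close>

lemma borel_eq_borel_plus: 
  assumes "subring_unit_group T (Units (ring_on T))"
  shows "borel n T = borel_plus n T (Units (ring_on T))"
proof -
  interpret subring_unit_group T "Units (ring_on T)" by fact
  have "A $$ (i, i) \<in> Units (ring_on T)" if A: "A \<in> carrier (borel n T)" and i: "i < n" for A i
  proof -
    have A: "A \<in> carrier_mat n n" "elements_mat A \<subseteq> T" "upper_triangular A"
      using A by (auto simp: borel_def GL_carrier)
    from that obtain B
      where B: "B \<in> carrier_mat n n" "elements_mat B \<subseteq> T" "B * A = 1\<^sub>m n" "A * B = 1\<^sub>m n"
      unfolding borel_def by (auto simp: GL_carrier)
    have ut: "upper_triangular B" by (rule upper_triangular_left_inverse[OF A(1) B(1) A(3) B(3)])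
    have "A $$ (i, i) * B $$ (i, i) = 1"
      using diag_mult_upper_triangular[OF A(1) B(1) A(3) ut i] B(4) i by simp
    moreover have "A $$ (i, i) \<in> T" "B $$ (i, i) \<in> T"
      using A(2) B(2) elements_matI[OF A(1) i i refl] elements_matI[OF B(1) i i refl] by auto
    ultimately show ?thesis unfolding Units_ring_on by (metis mult.commute)
  qed
  hence "carrier (borel n T) = carrier (borel_plus n T (Units (ring_on T)))"
    by (auto simp: borel_plus_def)
  thus ?thesis by (simp add: borel_plus_def)
qed

section \<open>Generated subrings, generated unit groups and additive maps on them\<close>

lemma field_ring_on_UNIV: "field (ring_on (UNIV :: 'k::field set))"
proof -
  let ?R = "ring_on (UNIV :: 'k set)"
  have s: "carrier ?R = UNIV" "x \<otimes>\<^bsub>?R\<^esub> y = x * y" "x \<oplus>\<^bsub>?R\<^esub> y = x + y" "\<one>\<^bsub>?R\<^esub> = 1" "\<zero>\<^bsub>?R\<^esub> = 0" for x y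
    by (simp_all add: ring_on_def)
  have "abelian_group ?R"
    by (rule abelian_groupI) (auto simp: s add.assoc add.commute intro: exI[of _ "- x" for x] add.left_inverse)
  moreover have "comm_monoid ?R" by (rule comm_monoidI) (auto simp: s)
  ultimately interpret cring ?R by (rule cringI) (auto simp: s distrib_right)
  show ?thesis
  proof (rule field_intro2)
    fix x assume "x \<in> carrier ?R - {\<zero>\<^bsub>?R\<^esub>}"
    hence "inverse x * x = 1 \<and> x * inverse x = 1" by (simp add: s)
    thus "x \<in> Units ?R" unfolding Units_def s by blast
  qed (simp add: s)
qed

lemma a_inv_ring_on_UNIV: "\<ominus>\<^bsub>ring_on UNIV\<^esub> x = - (x :: 'k::field)"
proof -
  interpret field "ring_on (UNIV :: 'k set)" by (rule field_ring_on_UNIV)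
  show ?thesis by (rule minus_equality) (auto simp: ring_on_def)
qed

lemma subring_of_generate_ring: "subring_of (generate_ring (ring_on UNIV) (X :: 'k::field set))"
proof
  let ?T = "generate_ring (ring_on UNIV) X"
  show "1 \<in> ?T" using generate_ring.one[of "ring_on UNIV" X] by (simp add: ring_on_def)
  show "x + y \<in> ?T" if "x \<in> ?T" "y \<in> ?T" for x y
    using generate_ring.eng_add[OF that] by (simp add: ring_on_def)
  show "x * y \<in> ?T" if "x \<in> ?T" "y \<in> ?T" for x y
    using generate_ring.eng_mult[OF that] by (simp add: ring_on_def)
  show "- x \<in> ?T" if "x \<in> ?T" for x
    using generate_ring.a_inv[OF that] by (simp add: a_inv_ring_on_UNIV)
qed

lemma subring_of_generate_field: "subring_of (generate_field (ring_on UNIV) (X :: 'k::field set))"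
proof
  let ?T = "generate_field (ring_on UNIV) X"
  show "1 \<in> ?T" using generate_field.one[of "ring_on UNIV" X] by (simp add: ring_on_def)
  show "x + y \<in> ?T" if "x \<in> ?T" "y \<in> ?T" for x y
    using generate_field.eng_add[OF that] by (simp add: ring_on_def)
  show "x * y \<in> ?T" if "x \<in> ?T" "y \<in> ?T" for x y
    using generate_field.eng_mult[OF that] by (simp add: ring_on_def)
  show "- x \<in> ?T" if "x \<in> ?T" for x
    using generate_field.a_inv[OF that] by (simp add: a_inv_ring_on_UNIV)
qed

context subring_of
begin

lemma of_nat_T: "of_nat k \<in> T"
  by (induction k) (auto simp: zero_T one_T add_T)

lemma of_int_T: "of_int k \<in> T"
  by (cases k rule: int_diff_cases) (metis add_T minus_T of_nat_T of_int_diff of_int_of_nat_eq uminus_add_conv_diff add.commute)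

lemma monoid_ring_on: "monoid (ring_on T)"
  by (rule monoidI) (auto simp: ring_on_def mult_T one_T mult.assoc)

lemma group_units_of: "group (units_of (ring_on T))"
  by (rule monoid.units_group[OF monoid_ring_on])

lemma units_of_simps: "carrier (units_of (ring_on T)) = Units (ring_on T)"
  "x \<otimes>\<^bsub>units_of (ring_on T)\<^esub> y = x * y" "\<one>\<^bsub>units_of (ring_on T)\<^esub> = 1"
  by (simp_all add: units_of_def ring_on_def)

lemma inv_units_of:
  assumes "u \<in> Units (ring_on T)" shows "inv\<^bsub>units_of (ring_on T)\<^esub> u = inverse u"
proof -
  interpret group "units_of (ring_on T)" by (rule group_units_of)
  have "u * inv\<^bsub>units_of (ring_on T)\<^esub> u = 1"
    using r_inv[of u] assms by (simp add: units_of_simps)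
  thus ?thesis using inverse_unique by metis
qed

lemma subring_unitsI:
  assumes "subgroup V (units_of (ring_on T))"
  shows "subring_units T V"
proof -
  interpret subgroup V "units_of (ring_on T)" by fact
  have U: "V \<subseteq> Units (ring_on T)" using subset by (simp add: units_of_simps)
  show ?thesis
  proof
    show "V \<subseteq> T" using U by (auto simp: Units_ring_on)
    show "0 \<notin> V" using U by (auto simp: Units_ring_on)
    show "1 \<in> V" using one_closed by (simp add: units_of_simps)
    show "x * y \<in> V" if "x \<in> V" "y \<in> V" for x y
      using m_closed[OF that] by (simp add: units_of_simps)
    show "inverse x \<in> V" if "x \<in> V" for x
      using m_inv_closed[OF that] inv_units_of[OF subsetD[OF U that]] by auto
  qed
qed

lemma subring_units_Units: "subring_units T (Units (ring_on T))"
  using subring_unitsI group.subgroup_self[OF group_units_of] by (simp add: units_of_simps)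

lemma subring_units_generate:
  assumes "X \<subseteq> Units (ring_on T)"
  shows "subring_units T (generate (units_of (ring_on T)) X)"
    and "generate (units_of (ring_on T)) X \<subseteq> Units (ring_on T)"
  using subring_unitsI group.generate_is_subgroup[OF group_units_of, of X]
    group.generate_incl[OF group_units_of, of X] assms by (auto simp: units_of_simps)

text \<open>Replaces the group inverse in the unit group by the inverse of the ambient
  field.\<close>

lemma generate_units_induct [consumes 2, case_names one incl inverse mult]:
  assumes X: "X \<subseteq> Units (ring_on T)" and u: "u \<in> generate (units_of (ring_on T)) X"
    and "P 1" "\<And>x. x \<in> X \<Longrightarrow> P x" "\<And>x. x \<in> X \<Longrightarrow> P (inverse x)"
    and "\<And>u v. u \<in> generate (units_of (ring_on T)) X \<Longrightarrow> v \<in> generate (units_of (ring_on T)) X \<Longrightarrow>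
      P u \<Longrightarrow> P v \<Longrightarrow> P (u * v)"
  shows "P u"
  using u
proof induction
  case (inv h)
  have "h \<in> Units (ring_on T)" using inv X by blast
  thus ?case using assms(5)[OF inv] by (simp add: inv_units_of)
qed (use assms in \<open>auto simp: units_of_simps\<close>)

lemma additive_zero:
  assumes "\<forall>x\<in>T. \<forall>y\<in>T. \<gamma> (x + y) = \<gamma> x + (\<gamma> y :: 'k)" shows "\<gamma> 0 = 0"
  using assms[rule_format, OF zero_T zero_T] by (metis add.right_neutral add_cancel_left_right)

text \<open>The factor \<open>x\<close> allows integer coefficients to be pulled out of the terms of
  a polynomial expression; \<open>x = 1\<close> gives the values at integers.\<close>

lemma additive_of_int:
  assumes add: "\<forall>x\<in>T. \<forall>y\<in>T. \<gamma> (x + y) = \<gamma> x + (\<gamma> y :: 'k)" and x: "x \<in> T"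
  shows "\<gamma> (of_int k * x) = of_int k * \<gamma> x"
proof -
  have z: "\<gamma> 0 = 0" by (rule additive_zero[OF add])
  have nat: "\<gamma> (of_nat j * x) = of_nat j * \<gamma> x" for j
  proof (induction j)
    case (Suc j)
    have "\<gamma> (of_nat (Suc j) * x) = \<gamma> (x + of_nat j * x)" by (simp add: distrib_right)
    also have "\<dots> = \<gamma> x + \<gamma> (of_nat j * x)" using add x of_nat_T mult_T by blast
    finally show ?case using Suc by (simp add: distrib_right)
  qed (simp add: z)
  have neg: "\<gamma> (- y) = - \<gamma> y" if "y \<in> T" for y
    using add[rule_format, OF that minus_T[OF that]] z by (simp add: eq_neg_iff_add_eq_0 add.commute)
  show ?thesis
  proof (cases "k \<ge> 0")
    case True thus ?thesis using nat[of "nat k"] by simp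
  next
    case False
    hence e: "of_int k * x = - (of_nat (nat (- k)) * x)" by simp
    show ?thesis unfolding e neg[OF mult_T[OF of_nat_T x]] nat using False by simp
  qed
qed

end

subsection \<open>The ring \<open>\<int>[1/m]\<close>\<close>

text \<open>For \<open>u = a / b\<close>, additivity gives
  \<open>b * \<gamma> u = \<gamma> a = a\<close>, so \<gamma> is the identity on \<open>T\<close>
  and \<open>v * \<gamma> v\<close> is \<open>v * v\<close>, which exceeds 1.\<close>

lemma rigid_rat:
  fixes T :: "rat set"
  assumes TV: "subring_units T V" and v: "v \<in> V" "v > 1"
  shows "rigid T V"
  unfolding rigid_def
proof (intro allI impI)
  interpret subring_units T V by fact
  fix \<gamma> :: "rat \<Rightarrow> rat"
  assume a: "(\<forall>x\<in>T. \<forall>y\<in>T. \<gamma> (x + y) = \<gamma> x + \<gamma> y) \<and> (\<forall>u\<in>V. \<forall>y\<in>T. \<gamma> (u * y) = \<gamma> u * \<gamma> y)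
     \<and> \<gamma> 1 = 1 \<and> \<gamma> ` V = V"
  have id: "\<gamma> u = u" if u: "u \<in> T" for u
  proof -
    obtain a b where ab: "quotient_of u = (a, b)" by force
    hence b: "b > 0" using quotient_of_denom_pos by auto
    hence bu: "of_int b * u = of_int a" using quotient_of_div[OF ab] by simp
    have "of_int b * \<gamma> u = \<gamma> (of_int b * u)" using additive_of_int[of \<gamma> u b] a u by simp
    also have "\<dots> = of_int b * u" unfolding bu using additive_of_int[of \<gamma> 1 a] a one_T by simp
    finally show ?thesis using b by simp
  qed
  have "\<forall>n>0. (v * \<gamma> v) ^ n \<noteq> 1"
  proof (intro allI impI)
    fix n :: nat assume "n > 0"
    have "1 < v * v" using v by (metis less_1_mult)
    hence "1 < (v * v) ^ n" using \<open>n > 0\<close> by (rule one_less_power)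
    thus "(v * \<gamma> v) ^ n \<noteq> 1" using id[of v] v V_T by auto
  qed
  thus "(\<forall>u\<in>V. \<gamma> (\<gamma> u) = u) \<and> (\<exists>v\<in>V. \<forall>n>0. (v * \<gamma> v) ^ n \<noteq> 1)"
    using v id V_T by auto
qed

lemma Z_inv_units:
  assumes "m \<ge> 2"
  shows "subring_unit_group (Z_inv m) (Z_inv_tf m)" "rigid (Z_inv m) (Z_inv_tf m)"
    and "subring_unit_group (Z_inv m) (Units (ring_on (Z_inv m)))"
    and "rigid (Z_inv m) (Units (ring_on (Z_inv m)))"
proof -
  interpret subring_of "Z_inv m" unfolding Z_inv_def by (rule subring_of_generate_ring)
  define X where "X = {of_nat l :: rat | l. prime l \<and> l dvd m}"
  have X: "X \<subseteq> Units (ring_on (Z_inv m))"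
  proof
    fix x assume "x \<in> X"
    then obtain l where l: "x = of_nat l" "prime l" "l dvd m" by (auto simp: X_def)
    then obtain j where j: "m = l * j" by (elim dvdE)
    have "1 / of_nat m \<in> Z_inv m" unfolding Z_inv_def by (rule generate_ring.incl) simp
    \<comment> \<open>With \<open>m = l * j\<close>, the inverse of \<open>l\<close> is
      \<open>j / m\<close>.\<close>
    hence "of_nat j * (1 / of_nat m) \<in> Z_inv m" using of_nat_T mult_T by blast
    moreover have "of_nat j * (1 / of_nat m) * x = (1::rat)" using j l assms by (cases "j = 0") auto
    ultimately show "x \<in> Units (ring_on (Z_inv m))"
      unfolding Units_ring_on using of_nat_T[of l] l(1) by (metis mult.commute)
  qed
  obtain l where l: "prime l" "l dvd m" using assms prime_factor_nat[of m] by auto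
  have tf: "Z_inv_tf m = generate (units_of (ring_on (Z_inv m))) X"
    by (simp add: Z_inv_tf_def X_def)
  have l1: "(of_nat l :: rat) > 1" using prime_gt_1_nat[OF l(1)] by simp
  have lV: "of_nat l \<in> Z_inv_tf m" unfolding tf using l by (intro generate.incl) (auto simp: X_def)
  have sub: "Z_inv_tf m \<subseteq> Units (ring_on (Z_inv m))" unfolding tf by (rule subring_units_generate[OF X])
  interpret tf: subring_units "Z_inv m" "Z_inv_tf m" unfolding tf by (rule subring_units_generate[OF X])
  interpret all: subring_units "Z_inv m" "Units (ring_on (Z_inv m))" by (rule subring_units_Units)
  show "subring_unit_group (Z_inv m) (Z_inv_tf m)"
    using sub lV l1 by unfold_locales auto
  show "subring_unit_group (Z_inv m) (Units (ring_on (Z_inv m)))"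
    using sub lV l1 by unfold_locales auto
  show "rigid (Z_inv m) (Z_inv_tf m)"
    by (rule rigid_rat[OF tf.subring_units_axioms lV l1])
  show "rigid (Z_inv m) (Units (ring_on (Z_inv m)))"
    by (rule rigid_rat[OF all.subring_units_axioms subsetD[OF sub lV] l1])
qed

subsection \<open>Integers of a real quadratic field\<close>

definition int_span :: "'k::field set \<Rightarrow> 'k set" where
  "int_span B = {(\<Sum>b\<in>B. of_int (c b) * b) | c. True}"

lemma int_span_base:
  assumes "finite B" "b \<in> B" shows "b \<in> int_span B"
proof -
  have "(\<Sum>x\<in>B. of_int ((\<lambda>x. if x = b then 1 else 0) x) * x) = (\<Sum>x\<in>B. if x = b then x else 0)"
    by (rule sum.cong) auto
  also have "\<dots> = b" using assms by simp
  finally show ?thesis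
    unfolding int_span_def by (intro CollectI exI[of _ "\<lambda>x. if x = b then 1 else 0"]) simp
qed

lemma int_span_add: "x \<in> int_span B \<Longrightarrow> y \<in> int_span B \<Longrightarrow> x + y \<in> int_span B"
proof -
  assume "x \<in> int_span B" "y \<in> int_span B"
  then obtain c d where "x = (\<Sum>b\<in>B. of_int (c b) * b)" "y = (\<Sum>b\<in>B. of_int (d b) * b)"
    unfolding int_span_def by blast
  hence "x + y = (\<Sum>b\<in>B. of_int ((\<lambda>b. c b + d b) b) * b)" by (simp add: sum.distrib distrib_right)
  thus ?thesis unfolding int_span_def by (intro CollectI exI[of _ "\<lambda>b. c b + d b"]) simp
qed

lemma int_span_smult: "x \<in> int_span B \<Longrightarrow> of_int k * x \<in> int_span B"
proof -
  assume "x \<in> int_span B"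
  then obtain c where "x = (\<Sum>b\<in>B. of_int (c b) * b)" unfolding int_span_def by blast
  hence "of_int k * x = (\<Sum>b\<in>B. of_int ((\<lambda>b. k * c b) b) * b)" by (simp add: sum_distrib_left mult.assoc)
  thus ?thesis unfolding int_span_def by (intro CollectI exI[of _ "\<lambda>b. k * c b"]) simp
qed

lemma int_span_zero: "0 \<in> int_span B"
  unfolding int_span_def by (auto intro: exI[of _ "\<lambda>_. 0"])

lemma int_span_sum:
  "(\<And>i. i \<in> I \<Longrightarrow> h i \<in> int_span B) \<Longrightarrow> (\<Sum>i\<in>I. of_int (k i) * h i) \<in> int_span B"
  by (induction I rule: infinite_finite_induct) (auto simp: int_span_zero int_span_add int_span_smult)

lemma int_span_mult:
  assumes "\<And>b. b \<in> B \<Longrightarrow> x * b \<in> int_span B" "y \<in> int_span B"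
  shows "x * y \<in> int_span B"
proof -
  obtain c where "y = (\<Sum>b\<in>B. of_int (c b) * b)" using assms(2) unfolding int_span_def by blast
  hence "x * y = (\<Sum>b\<in>B. of_int (c b) * (x * b))" by (simp add: sum_distrib_left mult_ac)
  thus ?thesis using int_span_sum[of B "\<lambda>b. x * b" B c] assms(1) by simp
qed

text \<open>Multiplication by \<open>x\<close> on the span has an integer matrix, and \<open>x\<close> is a root of its
  characteristic polynomial.\<close>

lemma algebraic_int_by_span:
  fixes x :: "'k::field_char_0"
  assumes B: "finite B" "b0 \<in> B" "b0 \<noteq> 0" and stable: "\<And>b. b \<in> B \<Longrightarrow> x * b \<in> int_span B"
  shows "algebraic_int x"
proof -
  obtain bs where bs: "set bs = B" "distinct bs" using finite_distinct_list[OF B(1)] by blast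
  define n where "n = length bs"
  have "\<exists>c. x * b = (\<Sum>a\<in>B. of_int (c a) * a)" if "b \<in> B" for b
    using stable[OF that] unfolding int_span_def by blast
  then obtain c where c: "\<And>b. b \<in> B \<Longrightarrow> x * b = (\<Sum>a\<in>B. of_int (c b a) * a)" by metis
  define A where "A = mat n n (\<lambda>(i, j). c (bs ! i) (bs ! j))"
  define M where "M = map_mat (of_int :: int \<Rightarrow> 'k) A"
  define v where "v = vec n (\<lambda>i. bs ! i)"
  have A: "A \<in> carrier_mat n n" and M: "M \<in> carrier_mat n n" by (auto simp: A_def M_def)
  have "M *\<^sub>v v = x \<cdot>\<^sub>v v"
  proof (rule eq_vecI)
    fix i assume "i < dim_vec (x \<cdot>\<^sub>v v)"
    hence i: "i < n" by (simp add: v_def)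
    have "(M *\<^sub>v v) $ i = (\<Sum>j<n. of_int (c (bs ! i) (bs ! j)) * bs ! j)"
      using i by (auto simp: M_def A_def v_def scalar_prod_def atLeast0LessThan)
    also have "\<dots> = (\<Sum>a\<in>B. of_int (c (bs ! i) a) * a)"
      using sum.reindex_bij_betw[OF bij_betw_nth[OF bs(2) refl bs(1)[symmetric]], of "\<lambda>a. of_int (c (bs ! i) a) * a"]
      by (simp add: n_def)
    also have "\<dots> = x * bs ! i" using c[of "bs ! i"] nth_mem[of i bs] bs i by (simp add: n_def)
    finally show "(M *\<^sub>v v) $ i = (x \<cdot>\<^sub>v v) $ i" using i by (simp add: v_def)
  qed (auto simp: M_def A_def v_def)
  moreover obtain i where i: "i < n" "bs ! i = b0" using B bs by (metis in_set_conv_nth n_def)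
  have "v \<noteq> 0\<^sub>v n"
  proof
    assume "v = 0\<^sub>v n"
    hence "v $ i = 0" using i by simp
    thus False using i B by (simp add: v_def)
  qed
  ultimately have "eigenvalue M x"
    using M by (auto simp: eigenvalue_def eigenvector_def v_def intro!: exI[of _ v])
  hence "poly (char_poly M) x = 0" using eigenvalue_root_char_poly[OF M] by simp
  moreover have "char_poly M = map_poly of_int (char_poly A)"
    unfolding M_def using of_int_hom.char_poly_hom[OF A] by simp
  moreover have "lead_coeff (char_poly A) = 1" using degree_monic_char_poly[OF A] by simp
  ultimately show ?thesis unfolding algebraic_int_altdef_ipoly by auto
qed

lemma algebraic_int_power_span:
  fixes x :: "'k::field_char_0"
  assumes "algebraic_int x"
  obtains n k where "n > 0" "x ^ n = (\<Sum>i<n. of_int (k i) * x ^ i)"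
proof -
  obtain p :: "int poly" where p: "poly (map_poly of_int p) x = 0" "lead_coeff p = 1"
    using assms unfolding algebraic_int_altdef_ipoly by auto
  let ?n = "degree p"
  have deg: "degree (map_poly (of_int :: int \<Rightarrow> 'k) p) = ?n" by (intro degree_map_poly) (use p in auto)
  have "0 = (\<Sum>i\<le>?n. of_int (coeff p i) * x ^ i)"
    using p(1) unfolding poly_altdef deg by (simp add: coeff_map_poly)
  also have "\<dots> = (\<Sum>i<?n. of_int (coeff p i) * x ^ i) + x ^ ?n"
    using p(2) by (simp add: lessThan_Suc_atMost[symmetric])
  finally have eq: "x ^ ?n = (\<Sum>i<?n. of_int (- coeff p i) * x ^ i)"
    by (simp add: sum_negf eq_neg_iff_add_eq_0 add.commute)
  \<comment> \<open>In degree 0 the relation would read 1 = 0. Positivity ensures that the monomial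
    1 belongs to the spanning set used later.\<close>
  have "?n > 0"
  proof (rule ccontr)
    assume "\<not> ?n > 0"
    thus False using eq by simp
  qed
  thus ?thesis using that[of ?n "\<lambda>i. - coeff p i"] eq by blast
qed

text \<open>The monomials \<open>x ^ i * y ^ j\<close> below the two degrees span a lattice stable
  under \<open>x\<close> and under \<open>y\<close>, hence under \<open>x + y\<close> and
  \<open>x * y\<close>.\<close>

lemma algebraic_int_add_mult:
  fixes x y :: "'k::field_char_0"
  assumes "algebraic_int x" "algebraic_int y"
  shows "algebraic_int (x + y)" "algebraic_int (x * y)"
proof -
  obtain n k where x: "n > 0" "x ^ n = (\<Sum>i<n. of_int (k i) * x ^ i)" using algebraic_int_power_span[OF assms(1)] by metis
  obtain m l where y: "m > 0" "y ^ m = (\<Sum>i<m. of_int (l i) * y ^ i)" using algebraic_int_power_span[OF assms(2)] by metis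
  define B where "B = (\<lambda>(i, j). x ^ i * y ^ j) ` ({..<n} \<times> {..<m})"
  have fin: "finite B" by (simp add: B_def)
  have one: "1 \<in> B" unfolding B_def using x y by (intro image_eqI[of _ _ "(0, 0)"]) auto
  have mem: "x ^ i * y ^ j \<in> int_span B" if "i < n" "j < m" for i j
    using that by (intro int_span_base fin) (auto simp: B_def)
  have xB: "x * b \<in> int_span B" if "b \<in> B" for b
  proof -
    from that obtain i j where ij: "i < n" "j < m" "b = x ^ i * y ^ j" by (auto simp: B_def)
    show ?thesis
    proof (cases "Suc i < n")
      case True thus ?thesis using mem[of "Suc i" j] ij by (simp add: mult.assoc)
    next
      case False
      hence "Suc i = n" using ij by simp
      \<comment> \<open>At the top exponent the monic relation for \<open>x\<close> rewrites
        \<open>x ^ n\<close> by lower powers.\<close>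
      hence "x * b = x ^ n * y ^ j" using ij by (auto simp: mult.assoc)
      also have "\<dots> = (\<Sum>i<n. of_int (k i) * (x ^ i * y ^ j))" unfolding x(2) by (simp add: sum_distrib_right mult.assoc)
      finally show ?thesis using int_span_sum[of "{..<n}" "\<lambda>i. x ^ i * y ^ j" B k] mem ij by simp
    qed
  qed
  have yB: "y * b \<in> int_span B" if "b \<in> B" for b
  proof -
    from that obtain i j where ij: "i < n" "j < m" "b = x ^ i * y ^ j" by (auto simp: B_def)
    show ?thesis
    proof (cases "Suc j < m")
      case True thus ?thesis using mem[of i "Suc j"] ij by (simp add: mult_ac)
    next
      case False
      hence "Suc j = m" using ij by simp
      hence "y * b = y ^ m * x ^ i" using ij by (auto simp: mult_ac)
      also have "\<dots> = (\<Sum>j<m. of_int (l j) * (x ^ i * y ^ j))" unfolding y(2) by (simp add: sum_distrib_left mult_ac)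
      finally show ?thesis using int_span_sum[of "{..<m}" "\<lambda>j. x ^ i * y ^ j" B l] mem ij by simp
    qed
  qed
  show "algebraic_int (x + y)"
    by (rule algebraic_int_by_span[OF fin one]) (auto simp: distrib_right intro: int_span_add xB yB)
  show "algebraic_int (x * y)"
    by (rule algebraic_int_by_span[OF fin one]) (auto simp: mult.assoc intro: int_span_mult xB yB)
qed

lemma subring_of_quad_int: "subring_of (quad_int d)"
proof -
  interpret subring_of "generate_field (ring_on UNIV) {sqrt (real d)}" by (rule subring_of_generate_field)
  show ?thesis
    by unfold_locales (auto simp: quad_int_def one_T add_T minus_T mult_T algebraic_int_add_mult int_imp_algebraic_int)
qed

text \<open>The constant term -1 is decisive: with +1 the other root would be the inverse of \<eta>,
  Galois conjugation would invert the unit group, and \<open>u * \<gamma> u\<close> would be 1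
  throughout.\<close>

lemma quad_int_units:
  assumes eta: "\<eta> \<in> Units (ring_on (quad_int d))" and mp: "is_min_poly [:-1, of_int a, 1:] \<eta>"
  shows "subring_unit_group (quad_int d) (quad_int_tf d \<eta>)" "rigid (quad_int d) (quad_int_tf d \<eta>)"
proof -
  interpret subring_of "quad_int d" by (rule subring_of_quad_int)
  let ?V = "quad_int_tf d \<eta>"
  have X: "{\<eta>} \<subseteq> Units (ring_on (quad_int d))" using eta by simp
  note sub = subring_units_generate[OF X, folded quad_int_tf_def]
  interpret subring_units "quad_int d" ?V by (rule sub)
  have etaV: "\<eta> \<in> ?V" unfolding quad_int_tf_def by (rule generate.incl) simp
  have eta0: "\<eta> \<noteq> 0" using etaV zero_V by blast
  have etaT: "\<eta> \<in> quad_int d" using etaV V_T by blast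
  have root: "\<eta> * \<eta> + of_int a * \<eta> - 1 = 0"
    using mp by (simp add: is_min_poly_def map_poly_pCons algebra_simps)
  \<comment> \<open>Otherwise \<eta> would be 1 or -1, a root of a linear rational polynomial,
    against the minimality of degree 2.\<close>
  have abs1: "\<bar>\<eta>\<bar> \<noteq> 1"
  proof
    assume "\<bar>\<eta>\<bar> = 1"
    then obtain s :: rat where s: "\<eta> = of_rat s" by (metis abs_eq_iff' abs_1 of_rat_1 of_rat_minus)
    have "poly (map_poly of_rat [:-s, 1:]) \<eta> = 0" using s by (simp add: map_poly_pCons of_rat_minus)
    hence "degree [:-1, rat_of_int a, 1:] \<le> degree [:-s, 1:]"
      using mp[unfolded is_min_poly_def, THEN conjunct2, THEN conjunct2, rule_format, of "[:-s, 1:]"] by simp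
    thus False by simp
  qed
  have pow: "\<exists>k. u = \<eta> powi k" if "u \<in> ?V" for u
    using X that unfolding quad_int_tf_def
  proof (induction rule: generate_units_induct)
    case one show ?case by (rule exI[of _ 0]) simp
  next
    case (incl x) thus ?case by (intro exI[of _ 1]) simp
  next
    case (inverse x) thus ?case by (intro exI[of _ "-1"]) (simp add: power_int_minus)
  next
    case (mult u v) thus ?case using eta0 by (metis power_int_add)
  qed
  \<comment> \<open>Taking absolute values leaves only \<open>k = 0\<close>, where the power is
    1.\<close>
  have nofin: "\<eta> powi k \<noteq> -1" for k
  proof
    assume "\<eta> powi k = -1"
    hence 1: "\<bar>\<eta>\<bar> powi k = 1" by (metis abs_minus abs_1 power_int_abs)
    show False
    proof (cases k rule: int_cases3)
      case zero thus ?thesis using \<open>\<eta> powi k = -1\<close> by simp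
    next
      case (pos n)
      hence "\<bar>\<eta>\<bar> ^ n = 1" "n > 0" using 1 by simp_all
      thus ?thesis using abs1 power_eq_imp_eq_base[of "\<bar>\<eta>\<bar>" n 1] by simp
    next
      case (neg n)
      hence "\<bar>\<eta>\<bar> ^ n = 1" "n > 0" using 1 by (simp_all add: power_int_minus)
      thus ?thesis using abs1 power_eq_imp_eq_base[of "\<bar>\<eta>\<bar>" n 1] by simp
    qed
  qed
  show "subring_unit_group (quad_int d) ?V"
    by unfold_locales (use sub etaV abs1 in auto)
  show "rigid (quad_int d) ?V"
    unfolding rigid_def
  proof (intro allI impI)
    fix \<gamma> :: "real \<Rightarrow> real"
    assume a: "(\<forall>x\<in>quad_int d. \<forall>y\<in>quad_int d. \<gamma> (x + y) = \<gamma> x + \<gamma> y)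
      \<and> (\<forall>u\<in>?V. \<forall>y\<in>quad_int d. \<gamma> (u * y) = \<gamma> u * \<gamma> y) \<and> \<gamma> 1 = 1 \<and> \<gamma> ` ?V = ?V"
    hence add: "\<forall>x\<in>quad_int d. \<forall>y\<in>quad_int d. \<gamma> (x + y) = \<gamma> x + \<gamma> y"
      and mul: "\<And>u y. u \<in> ?V \<Longrightarrow> y \<in> quad_int d \<Longrightarrow> \<gamma> (u * y) = \<gamma> u * \<gamma> y"
      and g1: "\<gamma> 1 = 1" and img: "\<gamma> ` ?V = ?V" by blast+
    define s where "s = \<gamma> \<eta>"
    have "s \<in> ?V" using img etaV by (auto simp: s_def)
    have "\<gamma> (\<eta> * \<eta> + of_int a * \<eta>) = s * s + of_int a * s"
      using add additive_of_int[OF add etaT, of a] mul[OF etaV etaT] etaT mult_T of_int_T by (simp add: s_def)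
    moreover have "\<eta> * \<eta> + of_int a * \<eta> = 1" using root by simp
    ultimately have "s * s + of_int a * s - 1 = 0" using g1 by simp
    \<comment> \<open>The difference of the two quadratic equations for \<open>s\<close> and \<eta>,
      factored; the second factor vanishes exactly when \<open>s\<close> is the conjugate
      root.\<close>
    hence "(s - \<eta>) * (s + \<eta> + of_int a) = 0" using root by (simp add: algebra_simps)
    moreover have "s + \<eta> + of_int a \<noteq> 0"
    proof
      assume "s + \<eta> + of_int a = 0"
      hence "s = - \<eta> - of_int a" by simp
      hence "s * \<eta> = (- \<eta> - of_int a) * \<eta>" by simp
      hence "s * \<eta> = -1" using root by (simp add: algebra_simps)
      moreover have "s * \<eta> \<in> ?V" using \<open>s \<in> ?V\<close> etaV mult_V by blast
      ultimately show False using pow nofin by metis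
    qed
    ultimately have s: "\<gamma> \<eta> = \<eta>" by (simp add: s_def)
    have id: "\<gamma> u = u" if "u \<in> ?V" for u
      using X that unfolding quad_int_tf_def
    proof (induction rule: generate_units_induct)
      case one show ?case by (rule g1)
    next
      case (incl x) thus ?case using s by simp
    next
      case (inverse x)
      have "\<gamma> (\<eta> * inverse \<eta>) = \<gamma> \<eta> * \<gamma> (inverse \<eta>)"
        using mul[OF etaV] inverse_V[OF etaV] V_T by blast
      hence "\<eta> * \<gamma> (inverse \<eta>) = 1" using s g1 eta0 by simp
      hence "\<gamma> (inverse \<eta>) = inverse \<eta>" by (metis inverse_unique)
      thus ?case using inverse by simp
    next
      case (mult u v) thus ?case using mul V_T unfolding quad_int_tf_def by auto
    qed
    have "(\<eta> * \<gamma> \<eta>) ^ n \<noteq> 1" if "n > 0" for n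
    proof
      assume "(\<eta> * \<gamma> \<eta>) ^ n = 1"
      hence "\<bar>(\<eta> * \<eta>) ^ n\<bar> = 1" using s by simp
      hence "\<bar>\<eta>\<bar> ^ (n + n) = 1" by (simp add: power_abs power_add power_mult_distrib abs_mult)
      thus False using abs1 that power_eq_imp_eq_base[of "\<bar>\<eta>\<bar>" "n + n" 1] by simp
    qed
    thus "(\<forall>u\<in>?V. \<gamma> (\<gamma> u) = u) \<and> (\<exists>v\<in>?V. \<forall>n>0. (v * \<gamma> v) ^ n \<noteq> 1)"
      using id etaV by auto
  qed
qed

subsection \<open>The ring \<open>\<bbbF>\<^sub>q[t, 1/t, 1/f]\<close>\<close>

lemma of_pol_eq_to_fract: "of_pol = to_fract"
  by (rule ext) (simp add: of_pol_def to_fract_def)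

lemma to_fract_of_nat: "to_fract (of_nat k) = of_nat k"
  by (induction k) simp_all

lemma to_fract_power: "to_fract (x ^ k) = to_fract x ^ k"
  by (induction k) simp_all

text \<open>A comparison of multiplicities that stays in the ring: a larger power on the left would
  leave a factor \<pi> in \<open>B\<close>.\<close>

lemma prime_power_exponent_le:
  fixes \<pi> A B :: "'a::idom"
  assumes "\<pi> ^ i * A = \<pi> ^ k * B" "\<not> \<pi> dvd B" "\<pi> \<noteq> 0"
  shows "i \<le> k"
proof (rule ccontr)
  assume "\<not> i \<le> k"
  then obtain j where "i = k + Suc j" by (metis add_Suc_right less_imp_Suc_add not_le)
  hence "\<pi> ^ k * (\<pi> * (\<pi> ^ j * A)) = \<pi> ^ k * B" using assms(1) by (simp add: power_add mult_ac)
  hence "\<pi> * (\<pi> ^ j * A) = B" using assms(3) by simp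
  thus False using assms(2) by (metis dvd_triv_left)
qed

text \<open>Translation by 1 permutes the field, so the sums of \<open>x + 1\<close> and of
  \<open>x\<close> over all elements agree; they differ by the cardinality times 1.\<close>

lemma of_nat_card_UNIV: "of_nat (card (UNIV :: 'q set)) = (0 :: 'q::{field,finite})"
proof -
  have "(\<Sum>x\<in>UNIV. x + 1 :: 'q) = (\<Sum>x\<in>UNIV. x)"
    by (rule sum.reindex_bij_betw[of "\<lambda>x. x + 1" UNIV UNIV "\<lambda>x. x"])
      (auto simp: bij_betw_def inj_def intro: surjI[of _ "\<lambda>x. x - 1"])
  thus ?thesis by (simp add: sum.distrib)
qed

text \<open>The condition \<open>coeff_range\<close> says that the coefficients lie in the prime
  field. They are integer multiples of 1, so a merely additive \<gamma> can be moved past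
  them.\<close>

locale function_field_ring =
  fixes p k :: nat and f :: "'q::{field,finite} poly"
  assumes p: "prime p" and k: "k \<ge> 1" and card: "card (UNIV :: 'q set) = p ^ k"
    and coeff_range: "\<forall>i. coeff f i \<in> range of_nat"
    and deg: "degree f > 0" and monic: "lead_coeff f = 1" and irred: "irreducible f"
    and f_neq_t: "f \<noteq> [:0, 1:]" and f_char2: "p = 2 \<longrightarrow> f \<noteq> [:-1, 1:]"
begin

abbreviation t :: "'q poly" where "t \<equiv> [:0, 1:]"
abbreviation "T \<equiv> to_fract t"
abbreviation "F \<equiv> to_fract f"
abbreviation "n \<equiv> degree f"
abbreviation "V \<equiv> S_tf f"

lemma prime_elem_t: "prime_elem t"
  by (rule prime_elem_linear_field_poly) simp

lemma prime_elem_f: "prime_elem f"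
  by (rule field_poly_irreducible_imp_prime[OF irred])

lemma f_nonzero: "f \<noteq> 0"
  using deg by auto

lemma t_dvd_iff: "t dvd g \<longleftrightarrow> coeff g 0 = 0"
  using poly_eq_0_iff_dvd[of g 0] by (simp add: poly_0_coeff_0)

text \<open>If \<open>t\<close> divided \<open>f\<close>, irreducibility would leave a constant
  cofactor, which is 1 as \<open>f\<close> is monic. The nonvanishing is used for the multiplicities
  of \<open>f(N/D)\<close> and for the degree of the reversed polynomial.\<close>

lemma coeff_f_0: "coeff f 0 \<noteq> 0"
proof
  assume "coeff f 0 = 0"
  hence "t dvd f" by (simp only: t_dvd_iff)
  then obtain g where g: "f = t * g" by (elim dvdE)
  have "\<not> is_unit t" by (simp add: is_unit_iff_degree)
  hence "is_unit g" using irreducibleD[OF irred g] by simp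
  moreover have "g \<noteq> 0" using g f_nonzero by auto
  ultimately have "degree g = 0" by (simp add: is_unit_iff_degree)
  then obtain c where "g = [:c:]" by (rule degree_eq_zeroE)
  hence "f = [:0, c:]" using g by simp
  thus False using monic f_neq_t by (cases "c = 0") auto
qed

lemma t_not_dvd_f: "\<not> t dvd f"
  using coeff_f_0 t_dvd_iff by simp

lemma f_not_dvd_t: "\<not> f dvd t"
proof
  assume "f dvd t"
  then obtain g where g: "t = f * g" by (elim dvdE)
  hence "g \<noteq> 0" by auto
  hence "degree t = degree f + degree g" unfolding g by (rule degree_mult_eq[OF f_nonzero])
  hence "degree g = 0" using deg by simp
  then obtain c where "g = [:c:]" by (rule degree_eq_zeroE)
  hence "coeff t 0 = c * coeff f 0" using g by simp
  hence "c = 0" using coeff_f_0 by simp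
  thus False using \<open>g = [:c:]\<close> \<open>g \<noteq> 0\<close> by simp
qed

lemma t_not_dvd_f_power: "\<not> t dvd f ^ j"
  using prime_elem_t t_not_dvd_f prime_elem_dvd_power by blast

lemma f_not_dvd_t_power: "\<not> f dvd t ^ j"
  using prime_elem_f f_not_dvd_t prime_elem_dvd_power by blast

lemma exponents_unique_nat:
  assumes "t ^ i * f ^ j = t ^ i' * f ^ j'" shows "i = i'" "j = j'"
proof -
  show "i = i'"
    using prime_power_exponent_le[OF assms t_not_dvd_f_power] prime_power_exponent_le[OF assms[symmetric] t_not_dvd_f_power]
    by simp
  have a: "f ^ j * t ^ i = f ^ j' * t ^ i'" using assms by (simp add: mult.commute)
  show "j = j'"
    using prime_power_exponent_le[OF a f_not_dvd_t_power] prime_power_exponent_le[OF a[symmetric] f_not_dvd_t_power]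
      f_nonzero by simp
qed

section \<open>The torsion-free unit group as the lattice of monomials in t and f\<close>

lemma T_nonzero: "T \<noteq> 0" and F_nonzero: "F \<noteq> 0"
  using f_nonzero by simp_all

definition mon :: "int \<Rightarrow> int \<Rightarrow> 'q poly fract" where
  "mon a b = T powi a * F powi b"

lemma powi_nat_diff: "x \<noteq> 0 \<Longrightarrow> x powi a = x ^ nat a / x ^ nat (- a)" for x :: "'q poly fract"
  by (simp add: power_int_def field_simps)

lemma mon_fraction:
  "mon a b = to_fract (t ^ nat a * f ^ nat b) / to_fract (t ^ nat (- a) * f ^ nat (- b))"
  using T_nonzero F_nonzero by (simp add: mon_def powi_nat_diff to_fract_power)

lemma mon_mult: "mon a b * mon c e = mon (a + c) (b + e)"
  using T_nonzero F_nonzero by (simp add: mon_def power_int_add mult_ac)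

lemma mon_powi: "mon a b powi i = mon (a * i) (b * i)"
  by (simp add: mon_def power_int_mult_distrib flip: power_int_mult)

lemma mon_0: "mon 0 0 = 1"
  by (simp add: mon_def)

lemma mon_inj:
  assumes "mon a b = mon c e" shows "a = c" "b = e"
proof -
  have "to_fract (t ^ nat a * f ^ nat b * (t ^ nat (- c) * f ^ nat (- e)))
      = to_fract (t ^ nat c * f ^ nat e * (t ^ nat (- a) * f ^ nat (- b)))"
    using assms T_nonzero F_nonzero unfolding mon_fraction by (simp add: to_fract_power field_simps)
  hence "t ^ nat a * f ^ nat b * (t ^ nat (- c) * f ^ nat (- e))
      = t ^ nat c * f ^ nat e * (t ^ nat (- a) * f ^ nat (- b))"
    by (simp only: to_fract_eq_iff)
  hence "t ^ (nat a + nat (- c)) * f ^ (nat b + nat (- e)) = t ^ (nat c + nat (- a)) * f ^ (nat e + nat (- b))"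
    by (simp only: power_add mult_ac)
  from exponents_unique_nat[OF this] show "a = c" "b = e" by linarith+
qed

lemma subring_of_S: "subring_of (S_ring f)"
  unfolding S_ring_def by (rule subring_of_generate_ring)

lemma S_units: "{T, F} \<subseteq> Units (ring_on (S_ring f))"
proof -
  interpret subring_of "S_ring f" by (rule subring_of_S)
  have gen: "x \<in> S_ring f" if "x \<in> {of_pol [:c:] | c. True}
      \<union> {of_pol [:0, 1:], inverse (of_pol [:0, 1:]), inverse (of_pol f)}" for x
    using that unfolding S_ring_def by (rule generate_ring.incl)
  have T: "T \<in> S_ring f" "inverse T \<in> S_ring f" "inverse F \<in> S_ring f"
    using gen by (auto simp: of_pol_eq_to_fract)
  have C: "to_fract [:c:] \<in> S_ring f" for c using gen[of "of_pol [:c:]"] by (auto simp: of_pol_eq_to_fract)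
  have "to_fract g \<in> S_ring f" for g
  proof (induction g)
    case 0 show ?case by (simp add: zero_T)
  next
    case (pCons c g)
    have "pCons c g = [:c:] + t * g" by simp
    hence "to_fract (pCons c g) = to_fract [:c:] + T * to_fract g" by (simp only: to_fract_add to_fract_mult)
    thus ?case using C T(1) pCons.IH add_T mult_T by simp
  qed
  thus ?thesis using T T_nonzero F_nonzero unfolding Units_ring_on insert_subset
    by (metis empty_subsetI left_inverse right_inverse)
qed

lemma S_tf_alt: "V = generate (units_of (ring_on (S_ring f))) {T, F}"
  by (simp add: S_tf_def of_pol_eq_to_fract)

lemma subring_units_S: "subring_units (S_ring f) V"
  unfolding S_tf_alt by (rule subring_of.subring_units_generate[OF subring_of_S S_units])

sublocale subring_units "S_ring f" V by (rule subring_units_S)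

lemma V_Units: "V \<subseteq> Units (ring_on (S_ring f))"
  unfolding S_tf_alt by (rule subring_units_generate[OF S_units])

lemma TF_V: "T \<in> V" "F \<in> V"
  unfolding S_tf_alt by (auto intro: generate.incl)

lemma V_mon:
  assumes "u \<in> V" shows "\<exists>a b. u = mon a b"
  using S_units assms unfolding S_tf_alt
proof (induction rule: generate_units_induct)
  case one show ?case by (metis mon_0)
next
  case (incl x)
  have "T = mon 1 0" "F = mon 0 1" by (simp_all add: mon_def)
  thus ?case using incl by auto
next
  case (inverse x)
  have "inverse T = mon (-1) 0" "inverse F = mon 0 (-1)" by (simp_all add: mon_def power_int_minus)
  thus ?case using inverse by auto
next
  case (mult u v) thus ?case by (metis mon_mult)
qed

text \<open>The numerator of \<open>f(N/D)\<close>.\<close>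

definition homogenised :: "'q poly \<Rightarrow> 'q poly \<Rightarrow> 'q poly" where
  "homogenised N D = (\<Sum>i\<le>n. [:coeff f i:] * N ^ i * D ^ (n - i))"

text \<open>Modulo \<pi> a single term survives: the constant term of \<open>f\<close> when \<pi>
  divides the numerator, the leading term when it divides the denominator. Neither coefficient is
  zero.\<close>

lemma dvd_homogenised:
  assumes pi: "prime_elem \<pi>" and NM: "\<pi> dvd N" and D: "\<not> \<pi> dvd D"
  shows "\<not> \<pi> dvd homogenised N D" "\<not> \<pi> dvd homogenised D N"
proof -
  have Dn: "\<not> \<pi> dvd D ^ n" using pi D prime_elem_dvd_power by blast
  have scal: "\<not> \<pi> dvd [:c:] * D ^ n" if "c \<noteq> 0" for c
  proof
    assume "\<pi> dvd [:c:] * D ^ n"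
    hence "\<pi> dvd [:inverse c:] * ([:c:] * D ^ n)" by (rule dvd_mult)
    thus False using Dn that by simp
  qed
  have eq0: "homogenised N D = [:coeff f 0:] * D ^ n + (\<Sum>i\<in>{..n} - {0}. [:coeff f i:] * N ^ i * D ^ (n - i))"
    unfolding homogenised_def by (subst sum.remove[of _ 0]) auto
  have dvd0: "\<pi> dvd (\<Sum>i\<in>{..n} - {0}. [:coeff f i:] * N ^ i * D ^ (n - i))"
    by (rule dvd_sum, rule dvd_mult2, rule dvd_mult, rule dvd_trans[OF NM]) (auto intro: dvd_power)
  show "\<not> \<pi> dvd homogenised N D"
    unfolding eq0 dvd_add_left_iff[OF dvd0] by (rule scal[OF coeff_f_0])
  have eqn: "homogenised D N = [:coeff f n:] * D ^ n + (\<Sum>i\<in>{..n} - {n}. [:coeff f i:] * D ^ i * N ^ (n - i))"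
    unfolding homogenised_def by (subst sum.remove[of _ n]) auto
  have dvdn: "\<pi> dvd (\<Sum>i\<in>{..n} - {n}. [:coeff f i:] * D ^ i * N ^ (n - i))"
    by (rule dvd_sum, rule dvd_mult, rule dvd_trans[OF NM]) (auto intro: dvd_power)
  show "\<not> \<pi> dvd homogenised D N"
    unfolding eqn dvd_add_left_iff[OF dvdn] by (rule scal) (use monic in simp)
qed

text \<open>Since \<open>p\<close> is zero in the field, an odd \<open>p\<close> together with 2 = 0
  would give 1 = 0. So \<open>p = 2\<close>, where \<open>t + 1\<close> is the excluded polynomial
  \<open>t - 1\<close>.\<close>

lemma char2_contradiction:
  assumes "(2::'q) = 0" "f = [:1, 1:]" shows False
proof -
  have "(of_nat p :: 'q) ^ k = 0" using of_nat_card_UNIV[where 'q = 'q] card by simp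
  hence p0: "(of_nat p :: 'q) = 0" by simp
  have "p = 2"
  proof (rule ccontr)
    assume "p \<noteq> 2"
    hence "odd p" using p primes_dvd_imp_eq two_is_prime_nat by blast
    then obtain j where "p = 2 * j + 1" by (elim oddE)
    hence "(of_nat p :: 'q) = 2 * of_nat j + 1" by simp
    thus False using p0 assms(1) by simp
  qed
  moreover have "(1::'q) = -1" using assms(1) by (metis add_eq_0_iff one_add_one)
  ultimately show False using f_char2 assms(2) by simp
qed

lemma degree_1:
  assumes "n = 1" shows "f = [:coeff f 0, 1:]"
proof (rule poly_eqI)
  fix i show "coeff f i = coeff [:coeff f 0, 1:] i"
    using assms monic coeff_eq_0[of f i] by (cases i; cases "i - 1") (auto simp: coeff_pCons split: nat.split)
qed

lemma homogenised_degree_1: "n = 1 \<Longrightarrow> homogenised N D = [:coeff f 0:] * D + N"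
  using monic by (simp add: homogenised_def)

text \<open>Excludes the swap of \<open>t\<close> and \<open>f\<close>, that is
  \<open>f(f(t)) = t\<close>. Degrees force \<open>f = t + c\<close>, and then
  \<open>2 * c = 0\<close> with \<open>c\<close> nonzero.\<close>

lemma homogenised_f_1:
  assumes "homogenised f 1 = t" shows False
proof -
  have "homogenised f 1 = f \<circ>\<^sub>p f"
    by (simp add: homogenised_def pcompose_altdef poly_altdef degree_map_poly coeff_map_poly)
  hence "n * n = degree t" using assms degree_pcompose[of f f] by simp
  hence n: "n = 1" by simp
  let ?c = "coeff f 0"
  have "[:?c:] * 1 + f = t" using homogenised_degree_1[OF n, of f 1] assms by simp
  hence "coeff ([:?c:] * 1 + f) 0 = coeff t 0" by (rule arg_cong)
  hence "2 * ?c = 0" by simp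
  hence two: "(2::'q) = 0" using coeff_f_0 by simp
  \<comment> \<open>In characteristic 2 a nonzero element of the prime field is 1; the parity of
    \<open>j\<close> expresses this.\<close>
  obtain j where j: "?c = of_nat j" using coeff_range by blast
  have "odd j"
  proof
    assume "even j"
    then obtain i where "j = 2 * i" by (elim evenE)
    thus False using j two coeff_f_0 by simp
  qed
  then obtain i where "j = 2 * i + 1" by (elim oddE)
  hence "?c = 1" using j two by simp
  thus False using char2_contradiction[OF two] degree_1[OF n] by simp
qed

text \<open>Excludes \<open>t\<close> going to \<open>1/f\<close>. Here the numerator of
  \<open>f(1/f)\<close> is the reversed polynomial evaluated at \<open>f\<close>; it keeps degree
  \<open>n\<close> because the constant term is nonzero. Degrees again force \<open>n = 1\<close>,
  and comparing coefficients gives \<open>c = 1\<close> and 2 = 0: a map of order 3.\<close>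

lemma homogenised_1_f:
  assumes "homogenised 1 f = t" shows False
proof -
  have "homogenised 1 f = (\<Sum>i\<le>n. [:coeff f (n - i):] * f ^ i)"
    unfolding homogenised_def by (rule sum.reindex_bij_witness[of _ "\<lambda>i. n - i" "\<lambda>i. n - i"]) auto
  also have "\<dots> = reflect_poly f \<circ>\<^sub>p f"
  proof -
    have dm: "degree (map_poly (\<lambda>x. [:x:]) (reflect_poly f)) = n"
      using coeff_f_0 by (subst degree_map_poly) (auto simp: coeff_reflect_poly)
    show ?thesis unfolding pcompose_altdef poly_altdef dm
      by (rule sum.cong) (auto simp: coeff_map_poly coeff_reflect_poly)
  qed
  finally have "n * n = degree t"
    using assms degree_pcompose[of "reflect_poly f" f] coeff_f_0 by simp
  hence n: "n = 1" by simp
  let ?c = "coeff f 0"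
  have "[:?c:] * f + 1 = t" using homogenised_degree_1[OF n, of 1 f] assms by simp
  hence "coeff ([:?c:] * f + 1) i = coeff t i" for i by (rule arg_cong)
  from this[of 0] this[of 1] have "?c * ?c + 1 = 0" "?c = 1"
    using monic n by simp_all
  hence "(2::'q) = 0" "?c = 1" by simp_all
  thus False using char2_contradiction degree_1[OF n] by simp
qed

text \<open>Excludes \<open>t\<close> going to \<open>f/t\<close>, the other map of order 3;
  coefficients give \<open>c = 1\<close> and \<open>c + 1 = 0\<close>.\<close>

lemma homogenised_f_t:
  assumes n: "n = 1" and "homogenised f t = 1" shows False
proof -
  let ?c = "coeff f 0"
  have "[:?c:] * t + f = 1" using homogenised_degree_1[OF n, of f t] assms by simp
  hence "coeff ([:?c:] * t + f) i = coeff 1 i" for i by (rule arg_cong)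
  from this[of 0] this[of 1] have "?c = 1" "?c + 1 = 0"
    using monic n by simp_all
  hence "(2::'q) = 0" "?c = 1" by simp_all
  thus False using char2_contradiction degree_1[OF n] by simp
qed

lemma to_fract_homogenised:
  assumes "D \<noteq> 0"
  shows "(\<Sum>i\<le>n. to_fract [:coeff f i:] * (to_fract N / to_fract D) ^ i)
    = to_fract (homogenised N D) / to_fract D ^ n"
proof -
  have "to_fract (homogenised N D) = (\<Sum>i\<le>n. to_fract ([:coeff f i:] * N ^ i * D ^ (n - i)))"
    unfolding homogenised_def by (rule to_fract_sum)
  also have "\<dots> = (\<Sum>i\<le>n. to_fract [:coeff f i:] * (to_fract N / to_fract D) ^ i * to_fract D ^ n)"
  proof (rule sum.cong)
    fix i assume "i \<in> {..n}"
    hence "to_fract D ^ n = to_fract D ^ i * to_fract D ^ (n - i)" by (simp flip: power_add)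
    thus "to_fract ([:coeff f i:] * N ^ i * D ^ (n - i))
        = to_fract [:coeff f i:] * (to_fract N / to_fract D) ^ i * to_fract D ^ n"
      using assms by (simp only: to_fract_mult to_fract_power power_divide) simp
  qed simp
  finally show ?thesis using assms by (simp add: sum_distrib_right[symmetric])
qed

text \<open>Here \<open>a\<close> is the multiplicity of \<pi> in \<gamma>(t) and \<open>c\<close>
  that in f(\<gamma>(t)). The constant term of \<open>f\<close> dominates for positive
  \<open>a\<close> and the leading term for negative \<open>a\<close>; for \<open>a = 0\<close>
  cancellation is possible and only a bound remains. Denominators are cleared, with \<open>H\<close>
  the numerator of f(\<gamma>(t)).\<close>

lemma exponent_cases:
  fixes a c :: int
  assumes pi: "prime_elem \<pi>" and P: "\<not> \<pi> dvd P" and Q: "\<not> \<pi> dvd Q"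
    and H: "a \<noteq> 0 \<Longrightarrow> \<not> \<pi> dvd H"
    and eq: "H * (\<pi> ^ nat (- c) * P) = \<pi> ^ nat c * ((\<pi> ^ nat (- a)) ^ n * (Q :: 'q poly))"
  shows "a \<ge> 0 \<Longrightarrow> c \<ge> 0" "a > 0 \<Longrightarrow> c = 0" "a < 0 \<Longrightarrow> c = int n * a"
proof -
  have pi0: "\<pi> \<noteq> 0" using pi by auto
  have e: "\<pi> ^ nat (- c) * (H * P) = \<pi> ^ (nat c + nat (- a) * n) * Q"
    using eq unfolding power_add power_mult[of \<pi> "nat (- a)" n] by (simp only: mult_ac)
  have le: "nat (- c) \<le> nat c + nat (- a) * n" by (rule prime_power_exponent_le[OF e Q pi0])
  have ge: "nat c + nat (- a) * n \<le> nat (- c)" if "a \<noteq> 0"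
  proof (rule prime_power_exponent_le[OF e[symmetric] _ pi0])
    show "\<not> \<pi> dvd H * P" using H[OF that] P pi by (simp add: prime_elem_dvd_mult_iff)
  qed
  show "a \<ge> 0 \<Longrightarrow> c \<ge> 0" using le by simp
  show "a > 0 \<Longrightarrow> c = 0" using le ge by simp
  show "c = int n * a" if a: "a < 0"
  proof -
    have "nat c + nat (- a) * n = nat (- c)" using le ge a by simp
    hence "int (nat c) + int (nat (- a)) * int n = int (nat (- c))" by (metis of_nat_add of_nat_mult)
    moreover have "int (nat (- a)) = - a" using a by simp
    moreover have "int (nat c) - int (nat (- c)) = c" by simp
    ultimately show ?thesis by (simp add: algebra_simps)
  qed
qed

text \<open>The outcomes are the identity, \<open>t\<close> to \<open>1/t\<close> with
  \<open>f\<close> to \<open>f/t^n\<close>, and \<open>t\<close> to \<open>t/f\<close> with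
  \<open>f\<close> to \<open>1/f\<close>. The multiplicities of \<open>t\<close> relate
  \<open>a\<close> to \<open>c\<close>, those of \<open>f\<close> relate \<open>b\<close> to
  \<open>e\<close>, and the determinant leaves finitely many sign patterns.\<close>

lemma substitution_cases:
  fixes a b c e :: int
  assumes eq: "(\<Sum>i\<le>n. to_fract [:coeff f i:] * mon a b ^ i) = mon c e"
    and det: "\<bar>a * e - b * c\<bar> = 1"
  obtains "a = 1" "b = 0" "c = 0" "e = 1"
    | "a = -1" "b = 0" "c = - int n" "e = 1"
    | "a = 1" "b = -1" "c = 0" "e = -1"
proof -
  define N D where "N = t ^ nat a * f ^ nat b" and "D = t ^ nat (- a) * f ^ nat (- b)"
  define H where "H = homogenised N D"
  have D0: "D \<noteq> 0" using f_nonzero by (simp add: D_def)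
  have "to_fract H / to_fract D ^ n = to_fract (t ^ nat c * f ^ nat e) / to_fract (t ^ nat (- c) * f ^ nat (- e))"
    using eq unfolding mon_fraction[of a b] mon_fraction[of c e] N_def[symmetric] D_def[symmetric]
      to_fract_homogenised[OF D0] H_def .
  hence "to_fract H * to_fract (t ^ nat (- c) * f ^ nat (- e)) = to_fract (t ^ nat c * f ^ nat e) * to_fract D ^ n"
    using D0 f_nonzero by (simp add: frac_eq_eq)
  hence "to_fract (H * (t ^ nat (- c) * f ^ nat (- e))) = to_fract (t ^ nat c * f ^ nat e * D ^ n)"
    by (simp only: to_fract_mult to_fract_power)
  hence E: "H * (t ^ nat (- c) * f ^ nat (- e)) = t ^ nat c * f ^ nat e * D ^ n"
    by (simp only: to_fract_eq_iff)
  have tN: "t dvd t ^ j" "f dvd f ^ j" if "j > 0" for j using that by (auto intro: dvd_power)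
  have Ht: "\<not> t dvd H" if "a \<noteq> 0"
  proof (cases "a > 0")
    case True
    hence "t dvd N" "\<not> t dvd D" using tN(1)[of "nat a"] t_not_dvd_f_power by (auto simp: N_def D_def simp del: dvd_mult_right)
    thus ?thesis unfolding H_def by (rule dvd_homogenised(1)[OF prime_elem_t])
  next
    case False
    hence "t dvd D" "\<not> t dvd N" using that tN(1)[of "nat (- a)"] t_not_dvd_f_power by (auto simp: N_def D_def)
    thus ?thesis unfolding H_def by (rule dvd_homogenised(2)[OF prime_elem_t])
  qed
  have Hf: "\<not> f dvd H" if "b \<noteq> 0"
  proof (cases "b > 0")
    case True
    hence "f dvd N" "\<not> f dvd D" using tN(2)[of "nat b"] f_not_dvd_t_power by (auto simp: N_def D_def)
    thus ?thesis unfolding H_def by (rule dvd_homogenised(1)[OF prime_elem_f])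
  next
    case False
    hence "f dvd D" "\<not> f dvd N" using that tN(2)[of "nat (- b)"] f_not_dvd_t_power by (auto simp: N_def D_def)
    thus ?thesis unfolding H_def by (rule dvd_homogenised(2)[OF prime_elem_f])
  qed
  have nf: "\<not> t dvd f ^ i * (f ^ j) ^ l" "\<not> f dvd t ^ i * (t ^ j) ^ l" for i j l
    using t_not_dvd_f_power[of "i + j * l"] f_not_dvd_t_power[of "i + j * l"]
    by (simp_all only: power_add power_mult not_False_eq_True)
  have "H * (t ^ nat (- c) * f ^ nat (- e)) = t ^ nat c * ((t ^ nat (- a)) ^ n * (f ^ nat e * (f ^ nat (- b)) ^ n))"
    using E by (simp only: D_def power_mult_distrib mult_ac)
  note c = exponent_cases[OF prime_elem_t t_not_dvd_f_power nf(1) Ht this]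
  have "H * (f ^ nat (- e) * t ^ nat (- c)) = f ^ nat e * ((f ^ nat (- b)) ^ n * (t ^ nat c * (t ^ nat (- a)) ^ n))"
    using E by (simp only: D_def power_mult_distrib mult_ac)
  note e = exponent_cases[OF prime_elem_f f_not_dvd_t_power nf(2) Hf this]
  consider "b = 0" | "a = 0" "b \<noteq> 0" | "a > 0" "b > 0" | "a < 0" "b < 0" | "a > 0" "b < 0" | "a < 0" "b > 0"
    by linarith
  thus ?thesis
  proof cases
    case 1
    hence ae: "\<bar>a\<bar> = 1" "\<bar>e\<bar> = 1" using det by (auto simp: zmult_eq_1_iff abs_mult dest: abs_zmult_eq_1)
    hence e1: "e = 1" using e(1) 1 by linarith
    show ?thesis
    proof (cases "a > 0")
      case True thus ?thesis using that(1) ae e1 1 c(2) by simp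
    next
      case False
      hence "a = -1" using ae by linarith
      thus ?thesis using that(2) e1 1 c(3) by simp
    qed
  next
    case 2
    hence "\<bar>b * c\<bar> = 1" using det by simp
    hence bc: "\<bar>b\<bar> = 1" "\<bar>c\<bar> = 1" by (metis abs_zmult_eq_1, metis abs_zmult_eq_1 mult.commute)
    hence c1: "c = 1" using c(1) 2 by linarith
    show ?thesis
    proof (cases "b > 0")
      case True
      hence "b = 1" "e = 0" using bc e(2) by linarith+
      hence "homogenised f 1 = t" using E 2 c1 by (simp add: H_def N_def D_def)
      thus ?thesis using homogenised_f_1 by blast
    next
      case False
      hence b: "b = -1" using bc by linarith
      hence "e = - int n" using e(3) by simp
      hence "homogenised 1 f * f ^ n = t * f ^ n" using E 2 c1 b by (simp add: H_def N_def D_def)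
      hence "homogenised 1 f = t"
        using mult_right_cancel[of "f ^ n" "homogenised 1 f" t] f_nonzero by simp
      thus ?thesis using homogenised_1_f by blast
    qed
  next
    \<comment> \<open>Two positive exponents give \<open>c = e = 0\<close>, two negative ones give
      \<open>(c, e) = n (a, b)\<close>; the determinant is 0 either way.\<close>
    case 3 thus ?thesis using c(2) e(2) det by simp
  next
    case 4 thus ?thesis using c(3) e(3) det by (simp add: mult_ac)
  next
    case 5
    hence ce: "c = 0" "e = int n * b" using c(2) e(3) by auto
    \<comment> \<open>With \<open>c = 0\<close> the determinant is \<open>a * n * b\<close>, which
      forces \<open>n = 1\<close> along with the exponents.\<close>
    hence "\<bar>a * (int n * b)\<bar> = 1" using det by simp
    hence 1: "\<bar>a\<bar> = 1" "\<bar>int n * b\<bar> = 1" by (metis abs_zmult_eq_1, metis abs_zmult_eq_1 mult.commute)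
    hence "\<bar>int n\<bar> = 1" "\<bar>b\<bar> = 1" by (metis abs_zmult_eq_1, metis abs_zmult_eq_1 mult.commute)
    hence "int n = 1" "b = -1" "a = 1" using 1 5 by linarith+
    thus ?thesis using that(3) ce by simp
  next
    case 6
    hence ce: "e = 0" "c = int n * a" using e(2) c(3) by auto
    hence "\<bar>b * (int n * a)\<bar> = 1" using det by simp
    hence 1: "\<bar>b\<bar> = 1" "\<bar>int n * a\<bar> = 1" by (metis abs_zmult_eq_1, metis abs_zmult_eq_1 mult.commute)
    hence "\<bar>int n\<bar> = 1" "\<bar>a\<bar> = 1" by (metis abs_zmult_eq_1, metis abs_zmult_eq_1 mult.commute)
    hence n: "int n = 1" "b = 1" "a = -1" using 1 6 by linarith+
    hence n': "n = 1" by simp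
    have "homogenised f t * t = 1 * t" using E n n' ce by (simp add: H_def N_def D_def)
    hence "homogenised f t = 1" using mult_right_cancel[of t] by simp
    thus ?thesis using homogenised_f_t[OF n'] by blast
  qed
qed

lemma F_expansion: "F = (\<Sum>i\<le>n. to_fract [:coeff f i:] * T ^ i)"
proof -
  have "f = (\<Sum>i\<le>n. monom (coeff f i) i)" by (rule poly_as_sum_of_monoms[symmetric])
  also have "\<dots> = (\<Sum>i\<le>n. [:coeff f i:] * t ^ i)" by (simp add: monom_altdef)
  finally have "F = to_fract (\<Sum>i\<le>n. [:coeff f i:] * t ^ i)" by simp
  thus ?thesis by (simp only: to_fract_sum to_fract_mult to_fract_power)
qed

lemma rigid_S: "rigid (S_ring f) V"
  unfolding rigid_def
proof (intro allI impI)
  fix \<gamma> :: "'q poly fract \<Rightarrow> 'q poly fract"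
  assume "(\<forall>x\<in>S_ring f. \<forall>y\<in>S_ring f. \<gamma> (x + y) = \<gamma> x + \<gamma> y)
      \<and> (\<forall>u\<in>V. \<forall>y\<in>S_ring f. \<gamma> (u * y) = \<gamma> u * \<gamma> y) \<and> \<gamma> 1 = 1 \<and> \<gamma> ` V = V"
  hence add: "\<forall>x\<in>S_ring f. \<forall>y\<in>S_ring f. \<gamma> (x + y) = \<gamma> x + \<gamma> y"
    and mulS: "\<And>u y. u \<in> V \<Longrightarrow> y \<in> S_ring f \<Longrightarrow> \<gamma> (u * y) = \<gamma> u * \<gamma> y"
    and one: "\<gamma> 1 = 1" and img: "\<gamma> ` V = V" by blast+
  have mul: "\<gamma> (u * v) = \<gamma> u * \<gamma> v" if "u \<in> V" "v \<in> V" for u v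
    using mulS that V_T by blast
  have gV: "\<gamma> u \<in> V" if "u \<in> V" for u using img that by blast
  have g_inv: "\<gamma> (inverse u) = inverse (\<gamma> u)" if "u \<in> V" for u
  proof -
    have "u \<noteq> 0" using that zero_V by blast
    hence "\<gamma> u * \<gamma> (inverse u) = 1" using mul[OF that inverse_V[OF that]] one by simp
    thus ?thesis by (metis inverse_unique)
  qed
  have g_pow: "\<gamma> (u ^ i) = \<gamma> u ^ i" if "u \<in> V" for u i
    by (induction i) (simp_all add: one mul that power_V)
  have g_powi: "\<gamma> (u powi i) = \<gamma> u powi i" if "u \<in> V" for u i
    using that by (simp add: power_int_def g_pow g_inv inverse_V)
  have V_powi: "u powi i \<in> V" if "u \<in> V" for u i
    using that by (simp add: power_int_def power_V inverse_V)
  have mon_V: "mon i j \<in> V" for i j unfolding mon_def by (intro mult_V V_powi TF_V)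
  have TF: "T = mon 1 0" "F = mon 0 1" by (simp_all add: mon_def)
  obtain a b where aT: "\<gamma> T = mon a b" using V_mon[OF gV[OF TF_V(1)]] by blast
  obtain c e where aF: "\<gamma> F = mon c e" using V_mon[OF gV[OF TF_V(2)]] by blast
  have g_mon: "\<gamma> (mon i j) = mon (a * i + c * j) (b * i + e * j)" for i j
    unfolding mon_def[of i j] mul[OF V_powi[OF TF_V(1)] V_powi[OF TF_V(2)]]
      g_powi[OF TF_V(1)] g_powi[OF TF_V(2)] aT aF mon_powi mon_mult ..
  have surj: "\<exists>i j. mon x y = \<gamma> (mon i j)" for x y
  proof -
    have "mon x y \<in> \<gamma> ` V" unfolding img by (rule mon_V)
    then obtain u where "u \<in> V" "mon x y = \<gamma> u" by blast
    thus ?thesis using V_mon by blast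
  qed
  \<comment> \<open>The preimages of \<open>T\<close> and \<open>F\<close> form an integral right
    inverse of the exponent matrix, so its determinant is 1 or -1.\<close>
  obtain i j where "mon 1 0 = \<gamma> (mon i j)" using surj by blast
  hence 1: "1 = a * i + c * j" "0 = b * i + e * j" unfolding g_mon by (auto dest: mon_inj)
  obtain i' j' where "mon 0 1 = \<gamma> (mon i' j')" using surj by blast
  hence 2: "0 = a * i' + c * j'" "1 = b * i' + e * j'" unfolding g_mon by (auto dest: mon_inj)
  have "(a * e - b * c) * (i * j' - i' * j)
      = (a * i + c * j) * (b * i' + e * j') - (a * i' + c * j') * (b * i + e * j)"
    by (simp add: algebra_simps)
  hence "(a * e - b * c) * (i * j' - i' * j) = 1" using 1 2 by simp
  hence det: "\<bar>a * e - b * c\<bar> = 1" by (metis abs_1 abs_zmult_eq_1)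
  have T_S: "T ^ i \<in> S_ring f" for i using power_V[OF TF_V(1)] V_T by blast
  have "\<forall>i. \<exists>j. coeff f i = of_nat j" using coeff_range by blast
  then obtain l where l: "\<And>i. coeff f i = of_nat (l i)" by metis
  \<comment> \<open>This turns additivity into \<gamma>(f) = f(\<gamma>(t)), although \<gamma> need
    not fix other constants.\<close>
  have const: "to_fract [:coeff f i:] = of_int (int (l i))" for i
    unfolding l of_nat_poly[symmetric] to_fract_of_nat by simp
  have g_sum: "(\<Sum>i\<in>I. h i) \<in> S_ring f \<and> \<gamma> (\<Sum>i\<in>I. h i) = (\<Sum>i\<in>I. \<gamma> (h i))"
    if "finite I" "\<And>i. i \<in> I \<Longrightarrow> h i \<in> S_ring f" for I :: "nat set" and h
    using that
  proof (induction I)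
    case empty show ?case by (simp add: zero_T additive_zero[OF add])
  next
    case (insert x I) thus ?case using add add_T by simp
  qed
  have term_S: "to_fract [:coeff f i:] * T ^ i \<in> S_ring f" for i
    unfolding const by (intro mult_T of_int_T T_S)
  have "\<gamma> F = (\<Sum>i\<le>n. \<gamma> (to_fract [:coeff f i:] * T ^ i))"
    using g_sum[of "{..n}" "\<lambda>i. to_fract [:coeff f i:] * T ^ i"] term_S F_expansion by simp
  also have "\<dots> = (\<Sum>i\<le>n. to_fract [:coeff f i:] * mon a b ^ i)"
    unfolding const additive_of_int[OF add T_S] g_pow[OF TF_V(1)] aT ..
  finally have eq: "(\<Sum>i\<le>n. to_fract [:coeff f i:] * mon a b ^ i) = mon c e" using aF by simp
  have order: "\<forall>r>0. mon x y ^ r \<noteq> 1" if "x \<noteq> 0 \<or> y \<noteq> 0" for x y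
  proof (intro allI impI notI)
    fix r :: nat assume r: "r > 0" "mon x y ^ r = 1"
    hence "mon (x * int r) (y * int r) = mon 0 0" using mon_powi[of x y "int r"] by (simp add: mon_0)
    hence "x * int r = 0" "y * int r = 0" by (auto dest: mon_inj)
    thus False using that r by simp
  qed
  have invol: "\<gamma> (\<gamma> u) = u"
    \<comment> \<open>The two equations say that the exponent matrix squares to the
      identity.\<close>
    if "u \<in> V" and inv: "\<And>i j. a * (a * i + c * j) + c * (b * i + e * j) = i"
      "\<And>i j. b * (a * i + c * j) + e * (b * i + e * j) = j" for u
  proof -
    from V_mon[OF that(1)] obtain i j where "u = mon i j" by blast
    thus ?thesis by (simp only: g_mon inv)
  qed
  show "(\<forall>u\<in>V. \<gamma> (\<gamma> u) = u) \<and> (\<exists>v\<in>V. \<forall>n>0. (v * \<gamma> v) ^ n \<noteq> 1)"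
    using eq det
  proof (cases rule: substitution_cases)
    case 1
    have "T * \<gamma> T = mon 2 0" unfolding aT unfolding TF mon_mult using 1 by simp
    thus ?thesis using invol 1 order[of 2 0] TF_V by (intro conjI ballI bexI[of _ T]) simp_all
  next
    case 2
    \<comment> \<open>The witness has to change with the case: here \<open>T * \<gamma> T\<close> is
      1, while in the last case \<open>F * \<gamma> F\<close> is 1.\<close>
    have "F * \<gamma> F = mon (- int n) 2" unfolding aF unfolding TF mon_mult using 2 by simp
    thus ?thesis using invol 2 order[of "- int n" 2] TF_V
      by (intro conjI ballI bexI[of _ F]) (simp_all add: algebra_simps)
  next
    case 3
    have "T * \<gamma> T = mon 2 (-1)" unfolding aT unfolding TF mon_mult using 3 by simp
    thus ?thesis using invol 3 order[of 2 "-1"] TF_V by (intro conjI ballI bexI[of _ T]) simp_all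
  qed
qed

lemma subring_unit_group_S: "subring_unit_group (S_ring f) V"
proof
  show "V \<subseteq> Units (ring_on (S_ring f))" by (rule V_Units)
  have "mon 1 0 \<noteq> mon 0 0" using mon_inj(1)[of 1 0 0 0] by auto
  hence "T \<noteq> 1" by (simp add: mon_def)
  thus "V \<noteq> {1}" using TF_V by blast
qed

end

theorem theorem5p1:
  fixes m :: nat
    and p k :: nat and f :: "'q::{field,finite} poly"
    and d :: nat and \<eta> :: real
  defines "R \<equiv> Z_inv m" and "R\<^sub>t\<^sub>f \<equiv> Z_inv_tf m"
    and "S \<equiv> S_ring f" and "S\<^sub>t\<^sub>f \<equiv> S_tf f"
    and "\<O> \<equiv> quad_int d" and "\<O>\<^sub>t\<^sub>f \<equiv> quad_int_tf d \<eta>"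
  assumes "m \<ge> 2"
    and "prime p" and "k \<ge> 1" and "card (UNIV :: 'q set) = p ^ k"
    and "\<forall>i. coeff f i \<in> range of_nat"
    and "degree f > 0" and "lead_coeff f = 1" and "irreducible f"
    and "f \<noteq> [:0, 1:]" and "p = 2 \<longrightarrow> f \<noteq> [:-1, 1:]"
    and "d \<ge> 2" and "squarefree d" and "fundamental_unit d \<eta>"
    and "\<exists>a::int. is_min_poly [:-1, of_int a, 1:] \<eta>"
  shows
    "(\<forall>\<psi> \<in> auto (aff R). infinite (induced_fixed_points (aff R) (aff_unipotent R) \<psi>)) \<and>
     (\<forall>\<psi> \<in> auto (aff_plus R R\<^sub>t\<^sub>f).
        infinite (induced_fixed_points (aff_plus R R\<^sub>t\<^sub>f) (aff_unipotent R) \<psi>)) \<and>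
     (\<forall>\<psi> \<in> auto (aff_plus S S\<^sub>t\<^sub>f).
        infinite (induced_fixed_points (aff_plus S S\<^sub>t\<^sub>f) (aff_unipotent S) \<psi>)) \<and>
     (\<forall>\<psi> \<in> auto (aff_plus \<O> \<O>\<^sub>t\<^sub>f).
        infinite (induced_fixed_points (aff_plus \<O> \<O>\<^sub>t\<^sub>f) (aff_unipotent \<O>) \<psi>)) \<and>
     (\<forall>n\<ge>2.
        property_R_infinity (borel n R) \<and>
        property_R_infinity (proj_borel n R) \<and>
        property_R_infinity (aff R) \<and>
        property_R_infinity (borel_plus n R R\<^sub>t\<^sub>f) \<and>
        property_R_infinity (proj_borel_plus n R R\<^sub>t\<^sub>f) \<and>
        property_R_infinity (aff_plus R R\<^sub>t\<^sub>f) \<and>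
        property_R_infinity (borel_plus n S S\<^sub>t\<^sub>f) \<and>
        property_R_infinity (proj_borel_plus n S S\<^sub>t\<^sub>f) \<and>
        property_R_infinity (aff_plus S S\<^sub>t\<^sub>f) \<and>
        property_R_infinity (borel_plus n \<O> \<O>\<^sub>t\<^sub>f) \<and>
        property_R_infinity (proj_borel_plus n \<O> \<O>\<^sub>t\<^sub>f) \<and>
        property_R_infinity (aff_plus \<O> \<O>\<^sub>t\<^sub>f))"
proof -
  interpret S: function_field_ring p k f by unfold_locales (fact assms)+
  obtain a where a: "is_min_poly [:-1, of_int a, 1:] \<eta>" using assms by blast
  have eta: "\<eta> \<in> Units (ring_on (quad_int d))"
    using \<open>fundamental_unit d \<eta>\<close> by (simp add: fundamental_unit_def)
  note R = Z_inv_units[OF \<open>m \<ge> 2\<close>]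
  note O = quad_int_units[OF eta a]
  note S = S.subring_unit_group_S S.rigid_S
  note fixed = subring_unit_group.rigid_induced_fixed_points
  note infinity = subring_unit_group.rigid_R_infinity
  \<comment> \<open>For \<open>R\<close> the full groups are covered by taking all units as
    \<open>V\<close>; signs do no harm because \<gamma> is the identity there.\<close>
  have borel_R: "borel n (Z_inv m) = borel_plus n (Z_inv m) (Units (ring_on (Z_inv m)))" for n
    by (rule borel_eq_borel_plus[OF R(3)])
  have proj_R: "proj_borel n (Z_inv m) = proj_borel_plus n (Z_inv m) (Units (ring_on (Z_inv m)))" for n
    by (simp add: proj_borel_def proj_borel_plus_def borel_R)
  show ?thesis
    unfolding R_def R\<^sub>t\<^sub>f_def S_def S\<^sub>t\<^sub>f_def \<O>_def \<O>\<^sub>t\<^sub>f_def aff_def borel_R proj_R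
    by (intro conjI ballI allI impI fixed infinity R S O)
qed

end
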